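(* Let $N\ge 2$, $N\ge p>1$ and $q>p-1$. There is a constant $c_{N,p,q}>0$ depending only on $N,p,q$ such that for every domain $\Omega\subsetneq\mathbb{R}^N$ and every (possibly sign-changing) solution $u\in C^1(\Omega)$ of $$-\Delta_p u+|\nabla u|^q=0\quad\text{in }\Omega,$$ one has $$|\nabla u(x)|\le c_{N,p,q}\,\big(\operatorname{dist}(x,\partial\Omega)\big)^{-\frac{1}{q+1-p}}\qquad\text{for all }x\in\Omega.$$ If $\Omega=\mathbb{R}^N$, then every solution $u\in C^1(\mathbb{R}^N)$ of the equation is constant.
   Context: $\Delta_p u=\operatorname{div}(|\nabla u|^{p-2}\nabla u)$. A $C^1$ solution in an open set is understood in the weak (distributional) sense: $\int |\nabla u|^{p-2}\nabla u\cdot\nabla\varphi\,dx+\int|\nabla u|^q\varphi\,dx=0$ for all $\varphi\in C_c^\infty$ of that open set. *)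

theory Defs
  imports "HOL-Analysis.Analysis"
begin

definition grad :: "('a::real_inner \<Rightarrow> real) \<Rightarrow> 'a \<Rightarrow> 'a"
  where "grad f x = (THE D. GDERIV f x :> D)"

lemma grad_eq:
  fixes f :: "'a::real_inner \<Rightarrow> real"
  assumes "GDERIV f x :> D"
  shows "grad f x = D"
  unfolding grad_def
proof (rule the_equality)
  fix E assume "GDERIV f x :> E"
  with assms have "(\<lambda>h. inner h D) = (\<lambda>h. inner h E)"
    unfolding gderiv_def by (rule has_derivative_unique)
  then have "inner (E - D) (E - D) = 0"
    by (metis inner_diff_right diff_self)
  then show "E = D" by simp
qed (fact assms)

lemma GDERIV_grad:
  fixes f :: "'a::euclidean_space \<Rightarrow> real"
  assumes "f differentiable (at x)"
  shows "GDERIV f x :> grad f x"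
proof -
  obtain f' where f': "(f has_derivative f') (at x)"
    using assms unfolding differentiable_def by blast
  then have "linear f'" by (rule has_derivative_linear)
  have "f' h = inner h (adjoint f' 1)" for h
    using adjoint_works[OF \<open>linear f'\<close>, of h 1] by simp
  then have "f' = (\<lambda>h. inner h (adjoint f' 1))" by blast
  then have "GDERIV f x :> adjoint f' 1"
    using f' unfolding gderiv_def by simp
  then show ?thesis using grad_eq by metis
qed

text \<open>Intended for open \<open>S\<close>.\<close>

definition C1_on :: "'a::euclidean_space set \<Rightarrow> ('a \<Rightarrow> real) \<Rightarrow> bool"
  where "C1_on S u \<longleftrightarrow> (\<forall>x\<in>S. u differentiable (at x)) \<and> continuous_on S (grad u)"

fun Ck :: "nat \<Rightarrow> (real ^ 'n \<Rightarrow> real) \<Rightarrow> bool"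
  where
    "Ck 0 f \<longleftrightarrow> continuous_on UNIV f"
  | "Ck (Suc k) f \<longleftrightarrow>
       (\<forall>x. f differentiable (at x)) \<and> (\<forall>i. Ck k (\<lambda>x. grad f x $ i))"

text \<open>Elements of \<open>C\<^sub>c\<^sup>\<infinity>(S)\<close>, for open \<open>S\<close>, are represented by their extensions by zero
  to the whole space.\<close>

definition test_function :: "(real ^ 'n) set \<Rightarrow> (real ^ 'n \<Rightarrow> real) \<Rightarrow> bool"
  where "test_function S \<phi> \<longleftrightarrow>
    (\<forall>k. Ck k \<phi>) \<and> compact (closure {x. \<phi> x \<noteq> 0}) \<and> closure {x. \<phi> x \<noteq> 0} \<subseteq> S"

text \<open>\<open>C\<^sup>1\<close> weak solutions of \<open>- \<Delta>\<^sub>p u + |\<nabla>u|\<^sup>q = 0\<close> in the open set \<open>S\<close>. Both integrands are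
  continuous on \<open>S\<close> with compact support in \<open>S\<close> when \<open>p > 1\<close> and \<open>q > 0\<close>; in particular
  \<open>0 powr (p - 2) = 0\<close> gives the flux the value 0 where the gradient vanishes, also for
  \<open>p < 2\<close>.\<close>

definition C1_weak_solution ::
    "real \<Rightarrow> real \<Rightarrow> (real ^ 'n) set \<Rightarrow> (real ^ 'n \<Rightarrow> real) \<Rightarrow> bool"
  where "C1_weak_solution p q S u \<longleftrightarrow>
    C1_on S u \<and>
    (\<forall>\<phi>. test_function S \<phi> \<longrightarrow>
      (LINT x:S|lborel. ((norm (grad u x) powr (p - 2)) *\<^sub>R grad u x) \<bullet> grad \<phi> x) +
      (LINT x:S|lborel. (norm (grad u x) powr q) * \<phi> x) = 0)"

end

theory Submission
  imports Defs
begin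

text \<open>Bernstein's method for \<open>z = |\<nabla>u|\<^sup>2\<close>: differentiating the equation shows that a power of \<open>z\<close> is a
  subsolution of an elliptic equation with a superlinear absorption term, and comparison with
  \<open>M (R\<^sup>2 - |x - x\<^sub>0|\<^sup>2)\<^sup>-\<^sup>m\<close>, where \<open>m = 2 / (q + 1 - p)\<close>, bounds \<open>z\<close> on a ball of radius \<open>R\<close>.

  A weak solution has no second derivatives, so the argument is run for the mollified gradient
  \<open>\<xi> = \<nabla>u * \<rho>\<close> together with the mollified flux, whose divergence is exactly the mollified
  right-hand side. Where \<open>\<nabla>u \<noteq> 0\<close> the equation is uniformly elliptic, so the difference quotients
  of \<open>\<nabla>u\<close> are bounded in \<open>L\<^sup>2\<close>. By continuity of \<open>\<nabla>u\<close> the derivative of the mollified flux then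
  differs from \<open>DA(\<xi>) D\<xi>\<close>, where \<open>A(\<xi>) = |\<xi>|\<^sup>p\<^sup>-\<^sup>2 \<xi>\<close>, by an error that tends to 0 in \<open>L\<^sup>2\<close>. All integral
  identities of Bernstein's method hold up to such errors, and the comparison follows in the limit
  from the test functions \<open>z\<^sup>\<kappa> ((R\<^sup>2 - |x - x\<^sub>0|\<^sup>2)\<^sup>m z - M)\<^sub>+\<^sup>2\<close> with \<open>z = |\<xi>|\<^sup>2\<close> and large \<open>\<kappa>\<close>, which are
  supported where \<open>z\<close> is bounded below.\<close>

section \<open>Smooth bump functions\<close>

text \<open>The obstacle is that \<open>u\<close> has no second derivatives and that the flux is
  differentiable only away from zeros of the gradient. Two cancellations make the regularised
  computation work. The second derivatives of the mollified flux enter the Bochner identity only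
  through the gradient of its divergence, and there they cancel, so only the first derivatives
  \<open>B\<close> and \<open>L\<close> need estimates. Hence \<open>L\<close> differs from
  \<open>dflux p \<xi> \<circ> B\<close> by at most \<tau> S, with S bounded in L^2 independently of
  \<tau>. The exponent m is the one for which \<zeta>^(q+1-p) is the square of R^2 - |x - x0|^2,
  which is exactly how fast the squared gradient of log \<zeta> blows up at the sphere. The power of
  z in the test function has to be large because its derivative supplies the square that absorbs the
  gradient of |\<xi>|^q.\<close>

definition bump :: "nat \<Rightarrow> real \<Rightarrow> real"
  where "bump m t = (if t > 0 then exp (- inverse t) * inverse t ^ m else 0)"

lemma bump_tendsto_0: "(bump m \<longlongrightarrow> 0) (at 0)"
proof -
  have "((\<lambda>t. bump m t) \<longlongrightarrow> 0) (at_left 0)"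
    by (rule tendsto_eventually) (auto simp: eventually_at_filter bump_def)
  moreover have "((\<lambda>t. bump m t) \<longlongrightarrow> 0) (at_right 0)"
  proof -
    have "((\<lambda>t::real. (inverse t) ^ m / exp (inverse t)) \<longlongrightarrow> 0) (at_right 0)"
      by (rule filterlim_compose[OF tendsto_power_div_exp_0 filterlim_inverse_at_top_right])
    then show ?thesis
      by (rule Lim_transform_eventually)
        (auto simp: eventually_at_filter bump_def exp_minus divide_inverse mult.commute)
  qed
  ultimately show ?thesis by (simp add: filterlim_split_at)
qed

text \<open>The family indexed by \<open>m\<close> is closed under differentiation up to linear
  combinations, and this carries smoothness of exp (-1/t) through an induction. At 0 the difference
  quotient of \<open>bump m\<close> is \<open>bump (Suc m)\<close>, so the derivative there is the
  limit already known for the next index.\<close>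

lemma DERIV_bump: "DERIV (bump m) t :> bump (m + 2) t - real m * bump (m + 1) t"
proof -
  consider "t > 0" | "t < 0" | "t = 0" by linarith
  then show ?thesis
  proof cases
    case 1
    have p: "real m * (inverse t ^ (m - Suc 0) * (inverse t * inverse t)) = real m * (inverse t * inverse t ^ m)"
      by (cases m) simp_all
    have "DERIV (\<lambda>t. exp (- inverse t) * inverse t ^ m) t :>
        exp (- inverse t) * (inverse t * inverse t) * inverse t ^ m
        - exp (- inverse t) * (real m * (inverse t ^ (m - Suc 0) * (inverse t * inverse t)))"
      by (rule derivative_eq_intros refl | use 1 in simp)+
    then have "DERIV (\<lambda>t. exp (- inverse t) * inverse t ^ m) t :> bump (m + 2) t - real m * bump (m + 1) t"
      unfolding p using 1 by (simp add: bump_def algebra_simps)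
    then show ?thesis
      by (rule has_field_derivative_transform_within_open[where S = "{0<..}"])
        (use 1 in \<open>auto simp: bump_def\<close>)
  next
    case 2
    have "DERIV (\<lambda>t. 0) t :> bump (m + 2) t - real m * bump (m + 1) t"
      using 2 by (simp add: bump_def)
    then show ?thesis
      by (rule has_field_derivative_transform_within_open[where S = "{..<0}"])
        (use 2 in \<open>auto simp: bump_def\<close>)
  next
    case 3
    have "((\<lambda>h. (bump m (0 + h) - bump m 0) / h) \<longlongrightarrow> 0) (at 0)"
      by (rule Lim_transform_eventually[OF bump_tendsto_0[of "Suc m"]])
        (auto simp: eventually_at_filter bump_def divide_inverse mult.commute mult.left_commute)
    then show ?thesis using 3 by (simp add: DERIV_def bump_def)
  qed
qed

text \<open>The algebra generated by constants, coordinates and radial bumps. It is closed under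
  partial derivatives, so all its members are smooth by one induction, without separate product and
  chain rules for \<open>Ck\<close>.\<close>

inductive bump_poly :: "(real ^ 'n \<Rightarrow> real) \<Rightarrow> bool" where
  const: "bump_poly (\<lambda>x. c)"
| coord: "bump_poly (\<lambda>x. x $ i)"
| bump: "bump_poly (\<lambda>x. bump m (1 - x \<bullet> x))"
| add: "bump_poly f \<Longrightarrow> bump_poly g \<Longrightarrow> bump_poly (\<lambda>x. f x + g x)"
| mult: "bump_poly f \<Longrightarrow> bump_poly g \<Longrightarrow> bump_poly (\<lambda>x. f x * g x)"

lemma bump_poly_GDERIV:
  assumes "bump_poly f"
  shows "\<exists>f'. (\<forall>x. GDERIV f x :> f' x) \<and> (\<forall>i. bump_poly (\<lambda>x. f' x $ i))"
  using assms
proof induction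
  case (const c)
  show ?case
    by (rule exI[of _ "\<lambda>x. 0"]) (auto intro: GDERIV_const bump_poly.const)
next
  case (coord i)
  have "GDERIV (\<lambda>x::real^'a. x $ i) x :> axis i 1" for x
    unfolding gderiv_def by (simp add: inner_axis bounded_linear_vec_nth bounded_linear_imp_has_derivative)
  then show ?case
    by (intro exI[of _ "\<lambda>x. axis i 1"]) (auto simp: axis_def intro: bump_poly.const)
next
  case (bump m)
  let ?f' = "\<lambda>x::real^'a. (bump (m + 2) (1 - x \<bullet> x) - real m * bump (m + 1) (1 - x \<bullet> x)) *\<^sub>R (-2 *\<^sub>R x)"
  have "GDERIV (\<lambda>x::real^'a. 1 - x \<bullet> x) x :> (-2 *\<^sub>R x)" for x
    unfolding gderiv_def by (auto intro!: derivative_eq_intros simp: inner_commute)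
  then have "GDERIV (\<lambda>x. bump m (1 - x \<bullet> x)) x :> ?f' x" for x :: "real^'a"
    using GDERIV_DERIV_compose[OF _ DERIV_bump] by blast
  moreover have "bump_poly (\<lambda>x. ?f' x $ i)" for i
  proof -
    have "bump_poly (\<lambda>x::real^'a. (bump (m + 2) (1 - x \<bullet> x) + (- real m) * bump (m + 1) (1 - x \<bullet> x)) * (-2 * x $ i))"
      by (intro bump_poly.intros)
    moreover have "(\<lambda>x. ?f' x $ i) = (\<lambda>x::real^'a. (bump (m + 2) (1 - x \<bullet> x) + (- real m) * bump (m + 1) (1 - x \<bullet> x)) * (-2 * x $ i))"
      by (simp add: fun_eq_iff algebra_simps)
    ultimately show ?thesis by simp
  qed
  ultimately show ?case by (intro exI[of _ ?f'] conjI allI)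
next
  case (add f g)
  then obtain f' g' where *: "\<And>x. GDERIV f x :> f' x" "\<And>i. bump_poly (\<lambda>x. f' x $ i)"
    "\<And>x. GDERIV g x :> g' x" "\<And>i. bump_poly (\<lambda>x. g' x $ i)" by blast
  then show ?case
    by (intro exI[of _ "\<lambda>x. f' x + g' x"]) (auto intro: GDERIV_add bump_poly.add)
next
  case (mult f g)
  then obtain f' g' where *: "\<And>x. GDERIV f x :> f' x" "\<And>i. bump_poly (\<lambda>x. f' x $ i)"
    "\<And>x. GDERIV g x :> g' x" "\<And>i. bump_poly (\<lambda>x. g' x $ i)" by blast
  then show ?case
    by (intro exI[of _ "\<lambda>x. f x *\<^sub>R g' x + g x *\<^sub>R f' x"])
      (auto intro!: GDERIV_mult bump_poly.add bump_poly.mult mult.hyps)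
qed

lemma differentiable_GDERIV: "GDERIV f x :> D \<Longrightarrow> f differentiable (at x)"
  unfolding gderiv_def differentiable_def by blast

lemma bump_poly_Ck: "bump_poly f \<Longrightarrow> Ck k f"
proof (induction k arbitrary: f)
  case 0
  then obtain f' where "\<And>x. GDERIV f x :> f' x" using bump_poly_GDERIV by blast
  then show ?case
    by (auto simp: continuous_on_eq_continuous_at intro!: differentiable_imp_continuous_within differentiable_GDERIV)
next
  case (Suc k)
  then obtain f' where "\<And>x. GDERIV f x :> f' x" "\<forall>i. bump_poly (\<lambda>x. f' x $ i)"
    using bump_poly_GDERIV by blast
  moreover from this have "grad f = f'" by (auto simp: grad_eq)
  ultimately show ?case using Suc.IH by (auto intro: differentiable_GDERIV)
qed

text \<open>Two changes of variables are needed: rescaling turns the bump into a mollifier, and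
  \<open>t = -1\<close> gives the test function \<open>y \<mapsto> k (x - y)\<close>. The factor
  \<open>c\<close> is part of the statement because each differentiation multiplies it by
  \<open>t\<close>.\<close>

lemma Ck_affine:
  "Ck k f \<Longrightarrow> Ck k (\<lambda>x. c * f (a + t *\<^sub>R x))"
proof (induction k arbitrary: f c)
  case 0
  then have "continuous_on UNIV f" by simp
  then show ?case
    by (auto intro!: continuous_intros continuous_on_compose2[of UNIV f])
next
  case (Suc k)
  have *: "GDERIV (\<lambda>x. c * f (a + t *\<^sub>R x)) x :> (c * t) *\<^sub>R grad f (a + t *\<^sub>R x)" for x
  proof -
    have "(f has_derivative (\<lambda>h. h \<bullet> grad f (a + t *\<^sub>R x))) (at (a + t *\<^sub>R x))"
      using Suc.prems GDERIV_grad unfolding gderiv_def by auto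
    moreover have "((\<lambda>x. a + t *\<^sub>R x) has_derivative (\<lambda>h. t *\<^sub>R h)) (at x)"
      by (auto intro!: derivative_eq_intros)
    ultimately have "((\<lambda>x. f (a + t *\<^sub>R x)) has_derivative (\<lambda>h. (t *\<^sub>R h) \<bullet> grad f (a + t *\<^sub>R x))) (at x)"
      by (rule has_derivative_compose[rotated])
    then show ?thesis unfolding gderiv_def by (auto intro!: derivative_eq_intros)
  qed
  have "grad (\<lambda>x. c * f (a + t *\<^sub>R x)) = (\<lambda>x. (c * t) *\<^sub>R grad f (a + t *\<^sub>R x))"
    using * by (auto simp: grad_eq)
  moreover have "Ck k (\<lambda>x. (c * t) * grad f (a + t *\<^sub>R x) $ i)" for i
    using Suc.prems by (intro Suc.IH) auto
  ultimately show ?case using differentiable_GDERIV[OF *] by simp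
qed

definition smooth :: "(real ^ 'n \<Rightarrow> real) \<Rightarrow> bool"
  where "smooth f \<longleftrightarrow> (\<forall>k. Ck k f)"

lemma smooth_GDERIV: "smooth f \<Longrightarrow> GDERIV f x :> grad f x"
  unfolding smooth_def by (metis Ck.simps(2) GDERIV_grad)

lemma smooth_continuous: "smooth f \<Longrightarrow> continuous_on UNIV f"
  unfolding smooth_def by (metis Ck.simps(1))

lemma smooth_grad_nth: "smooth f \<Longrightarrow> smooth (\<lambda>x. grad f x $ i)"
  unfolding smooth_def by (metis Ck.simps(2))

lemma smooth_grad_inner: "smooth f \<Longrightarrow> b \<in> Basis \<Longrightarrow> smooth (\<lambda>x. grad f x \<bullet> b)"
  by (auto simp: Basis_vec_def inner_axis smooth_grad_nth)

lemma smooth_grad_continuous: "smooth f \<Longrightarrow> continuous_on UNIV (grad f)"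
  using smooth_continuous[OF smooth_grad_inner[of f]]
  by (subst continuous_on_componentwise) auto

lemma smooth_affine: "smooth f \<Longrightarrow> smooth (\<lambda>x. c * f (a + t *\<^sub>R x))"
  unfolding smooth_def by (auto intro: Ck_affine)

lemma grad_zero_off_closed:
  fixes f :: "'a::euclidean_space \<Rightarrow> real"
  assumes "closed S" "\<And>x. x \<notin> S \<Longrightarrow> f x = 0" "x \<notin> S"
  shows "grad f x = 0"
proof -
  have "(f has_derivative (\<lambda>h. h \<bullet> 0)) (at x)"
    by (rule has_derivative_transform_within_open[of "\<lambda>x. 0" _ _ _ "- S"]) (use assms in auto)
  then show ?thesis by (auto intro: grad_eq simp: gderiv_def)
qed

definition bump0 :: "real ^ 'n \<Rightarrow> real" where "bump0 x = bump 0 (1 - x \<bullet> x)"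

lemma smooth_bump0: "smooth bump0"
  unfolding smooth_def bump0_def[abs_def] by (auto intro: bump_poly_Ck bump_poly.intros)

lemma bump0_nonneg: "bump0 x \<ge> 0"
  by (simp add: bump0_def bump_def)

lemma bump0_zero: "x \<notin> cball 0 1 \<Longrightarrow> bump0 x = 0"
  by (auto simp: bump0_def bump_def dot_square_norm abs_square_less_1)

lemma bump0_pos: "bump0 0 > 0"
  by (auto simp: bump0_def bump_def)

section \<open>Integration of compactly supported functions\<close>

lemma set_integrable_continuous:
  fixes f :: "'a::euclidean_space \<Rightarrow> 'b::{banach, second_countable_topology}"
  assumes "compact S" "continuous_on S f"
  shows "set_integrable lborel S f"
  using borel_integrable_compact[OF assms] by (simp add: set_integrable_def)

lemma LINT_eq_set_LINT:
  fixes f :: "'a::euclidean_space \<Rightarrow> 'b::{banach, second_countable_topology}"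
  assumes "\<And>x. x \<notin> S \<Longrightarrow> f x = 0"
  shows "integral\<^sup>L lborel f = (LINT x:S|lborel. f x)"
  unfolding set_lebesgue_integral_def
  by (rule Bochner_Integration.integral_cong) (use assms in \<open>auto simp: indicator_def\<close>)

lemma integrable_compact_support:
  fixes f :: "'a::euclidean_space \<Rightarrow> 'b::{banach, second_countable_topology}"
  assumes "compact S" "continuous_on S f" "\<And>x. x \<notin> S \<Longrightarrow> f x = 0"
  shows "integrable lborel f"
proof -
  have "(\<lambda>x. indicator S x *\<^sub>R f x) = f" using assms(3) by (auto simp: indicator_def)
  then show ?thesis using borel_integrable_compact[OF assms(1,2)] by simp
qed

lemma LINT_translation:
  fixes f :: "'a::euclidean_space \<Rightarrow> 'b::{banach, second_countable_topology}"
  assumes "f \<in> borel_measurable borel"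
  shows "(\<integral>x. f (a + x) \<partial>lborel) = integral\<^sup>L lborel f"
  using assms by (subst (2) lborel_distr_plus[symmetric, of a]) (auto simp: integral_distr)

lemma LINT_reflection:
  fixes f :: "'a::euclidean_space \<Rightarrow> 'b::{banach, second_countable_topology}"
  assumes "f \<in> borel_measurable borel"
  shows "(\<integral>x. f (a - x) \<partial>lborel) = integral\<^sup>L lborel f"
proof -
  have "lborel = distr lborel borel (\<lambda>x::'a. a + (-1) *\<^sub>R x)"
    by (subst lborel_affine[of "-1" a]) (auto simp: density_1)
  then have "integral\<^sup>L lborel f = integral\<^sup>L (distr lborel borel (\<lambda>x::'a. a + (-1) *\<^sub>R x)) f"
    by simp
  also have "\<dots> = (\<integral>x. f (a + (-1) *\<^sub>R x) \<partial>lborel)"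
    using assms by (subst integral_distr) auto
  finally show ?thesis by simp
qed

lemma set_LINT_mono_set:
  fixes f :: "'a::euclidean_space \<Rightarrow> real"
  assumes "compact S" "compact T" "S \<subseteq> T" "continuous_on T f" "\<And>x. x \<in> T \<Longrightarrow> f x \<ge> 0"
  shows "(LINT x:S|lborel. f x) \<le> (LINT x:T|lborel. f x)"
  unfolding set_lebesgue_integral_def
proof (rule integral_mono)
  show "integrable lborel (\<lambda>x. indicat_real S x *\<^sub>R f x)"
    using assms(1,3,4) borel_integrable_compact continuous_on_subset by blast
  show "integrable lborel (\<lambda>x. indicat_real T x *\<^sub>R f x)"
    using assms(2,4) borel_integrable_compact by blast
qed (use assms in \<open>auto simp: indicator_def\<close>)

text \<open>Difference quotients of \<open>f\<close> have integral zero by translation invariance.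
  They are bounded by the mean value theorem and share a compact support, so dominated convergence
  passes to the derivative.\<close>

lemma LINT_directional_derivative:
  fixes f :: "'a::euclidean_space \<Rightarrow> real"
  assumes der: "\<And>x. (f has_derivative f' x) (at x)"
    and cont: "continuous_on UNIV (\<lambda>x. f' x b)"
    and S: "compact S" "\<And>x. x \<notin> S \<Longrightarrow> f x = 0"
  shows "(\<integral>x. f' x b \<partial>lborel) = 0"
proof -
  have cf: "continuous_on UNIV f"
    using has_derivative_continuous[OF der] by (simp add: continuous_on_eq_continuous_at)
  have z: "f' x = (\<lambda>h. 0)" if "x \<notin> S" for x
  proof -
    have "(f has_derivative (\<lambda>h. 0)) (at x)"
      by (rule has_derivative_transform_within_open[of "\<lambda>x. 0" _ _ _ "- S"])
        (use S that compact_imp_closed in auto)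
    then show ?thesis using der has_derivative_unique by blast
  qed
  have "compact ((\<lambda>x. f' x b) ` S)"
    using S(1) cont compact_continuous_image continuous_on_subset by blast
  then obtain C where C: "C > 0" "\<And>x. x \<in> S \<Longrightarrow> \<bar>f' x b\<bar> \<le> C"
    using compact_imp_bounded bounded_pos by (metis image_eqI real_norm_def)
  then have C': "\<bar>f' x b\<bar> \<le> C" for x using z[of x] by (cases "x \<in> S") auto
  define T where "T n x = (f (x + inverse (real (Suc n)) *\<^sub>R b) - f x) * real (Suc n)" for n x
  have lin: "linear (f' x)" for x using der has_derivative_linear by blast
  have bT: "\<bar>T n x\<bar> \<le> C" for n x
  proof -
    let ?h = "inverse (real (Suc n))"
    have "((\<lambda>t. f (x + t *\<^sub>R b)) has_derivative (\<lambda>t. f' (x + s *\<^sub>R b) (t *\<^sub>R b))) (at s within {0..?h})" for s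
    proof -
      have "((\<lambda>t. x + t *\<^sub>R b) has_derivative (\<lambda>t. t *\<^sub>R b)) (at s within {0..?h})"
        by (auto intro!: derivative_eq_intros)
      then show ?thesis by (rule has_derivative_compose) (rule der)
    qed
    then have "\<exists>s\<in>{0<..<?h}. f (x + ?h *\<^sub>R b) - f (x + 0 *\<^sub>R b) = f' (x + s *\<^sub>R b) ((?h - 0) *\<^sub>R b)"
      by (intro mvt_simple) auto
    then obtain s where "f (x + ?h *\<^sub>R b) - f x = f' (x + s *\<^sub>R b) (?h *\<^sub>R b)" by auto
    also have "\<dots> = ?h * f' (x + s *\<^sub>R b) b" using lin by (simp add: linear_cmul)
    finally have "T n x = f' (x + s *\<^sub>R b) b" by (simp add: T_def field_simps)
    then show ?thesis using C' by simp
  qed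
  have "(\<lambda>n. T n x) \<longlonglongrightarrow> f' x b" for x
  proof -
    have "((\<lambda>t. (f (x + t *\<^sub>R b) - f x) / t) \<longlongrightarrow> f' x b) (at 0)"
    proof -
      have "((\<lambda>t. f (x + t *\<^sub>R b)) has_derivative (\<lambda>t. f' (x + 0 *\<^sub>R b) (t *\<^sub>R b))) (at 0)"
      proof -
        have "((\<lambda>t. x + t *\<^sub>R b) has_derivative (\<lambda>t. t *\<^sub>R b)) (at 0)"
          by (auto intro!: derivative_eq_intros)
        then show ?thesis by (rule has_derivative_compose) (rule der)
      qed
      then have "DERIV (\<lambda>t. f (x + t *\<^sub>R b)) 0 :> f' x b"
        unfolding has_field_derivative_def using lin
        by (simp add: linear_cmul) (metis (no_types, lifting) ext mult.commute)
      then show ?thesis by (simp add: DERIV_def)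
    qed
    moreover have "filterlim (\<lambda>n. inverse (real (Suc n))) (at 0) sequentially"
      unfolding filterlim_at using LIMSEQ_inverse_real_of_nat by simp
    ultimately have "(\<lambda>n. (f (x + inverse (real (Suc n)) *\<^sub>R b) - f x) / inverse (real (Suc n))) \<longlonglongrightarrow> f' x b"
      by (rule filterlim_compose)
    then show ?thesis unfolding T_def by (simp add: field_simps)
  qed
  note lim = this
  \<comment> \<open>All steps have length at most that of \<open>b\<close>, so every difference
    quotient vanishes off this enlargement of \<open>S\<close>; it carries the dominating
    function.\<close>
  define S' where "S' = {x + y |x y. x \<in> S \<and> y \<in> cball 0 (norm b)}"
  have S': "compact S'" unfolding S'_def by (rule compact_sums) (use S in auto)
  have T0: "T n x = 0" if "x \<notin> S'" for n x
  proof -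
    have "x \<notin> S" using that unfolding S'_def by force
    moreover have "x + inverse (real (Suc n)) *\<^sub>R b \<notin> S"
    proof
      assume a: "x + inverse (real (Suc n)) *\<^sub>R b \<in> S"
      have "norm (inverse (real (Suc n)) *\<^sub>R b) \<le> norm b"
        using mult_right_mono[of "inverse (real (Suc n))" 1 "norm b"] by (simp add: inverse_le_1_iff)
      then have "- (inverse (real (Suc n)) *\<^sub>R b) \<in> cball 0 (norm b)" by simp
      with a have "x \<in> S'" unfolding S'_def
        by (intro CollectI exI[of _ "x + inverse (real (Suc n)) *\<^sub>R b"] exI[of _ "- (inverse (real (Suc n)) *\<^sub>R b)"]) auto
      then show False using that by simp
    qed
    ultimately show ?thesis using S by (simp add: T_def)
  qed
  have mf: "f \<in> borel_measurable borel" using cf by (rule borel_measurable_continuous_onI)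
  have i: "integrable lborel f"
    using S continuous_on_subset[OF cf] by (intro integrable_compact_support[of S]) auto
  have cT: "continuous_on UNIV (T n)" for n
    unfolding T_def by (intro continuous_intros continuous_on_compose2[OF cf]) auto
  have T_0: "(\<integral>x. T n x \<partial>lborel) = 0" for n
  proof -
    have "(\<lambda>x. f (x + inverse (real (Suc n)) *\<^sub>R b)) = (\<lambda>x. T n x * inverse (real (Suc n)) + f x)"
      by (simp add: T_def fun_eq_iff field_simps)
    moreover have "integrable lborel (\<lambda>x. T n x * inverse (real (Suc n)) + f x)"
      using integrable_compact_support[OF S' continuous_on_subset[OF cT subset_UNIV] T0] i
      by (intro Bochner_Integration.integrable_add integrable_mult_left)
    ultimately have "integrable lborel (\<lambda>x. f (x + inverse (real (Suc n)) *\<^sub>R b))" by simp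
    then show ?thesis unfolding T_def
      using LINT_translation[OF mf, of "inverse (real (Suc n)) *\<^sub>R b"] i by (simp add: add.commute)
  qed
  have "(\<lambda>n. \<integral>x. T n x \<partial>lborel) \<longlonglongrightarrow> (\<integral>x. f' x b \<partial>lborel)"
  proof (rule integral_dominated_convergence[where w = "\<lambda>x. indicator S' x *\<^sub>R C"])
    show "integrable lborel (\<lambda>x. indicat_real S' x *\<^sub>R C)"
      using S' by (intro borel_integrable_compact) auto
    show "AE x in lborel. norm (T i x) \<le> indicator S' x *\<^sub>R C" for i
      using bT T0 by (auto simp: indicator_def)
  qed (use lim cont cT in \<open>auto intro!: borel_measurable_continuous_onI\<close>)
  then show ?thesis unfolding T_0 by (simp add: LIMSEQ_const_iff)
qed

text \<open>Divergence theorem for fields that are regular only on \<open>U\<close>. Since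
  \<open>K\<close> is compact in \<open>U\<close> and the field vanishes on \<open>U - K\<close>,
  each component cut to zero off \<open>K\<close> is differentiable on the whole space, and the
  result for one direction applies to it.\<close>

lemma LINT_divergence:
  fixes X :: "'a::euclidean_space \<Rightarrow> 'a"
  assumes UK: "open U" "compact K" "K \<subseteq> U"
    and zero: "\<And>x. x \<in> U - K \<Longrightarrow> X x = 0"
    and der: "\<And>x. x \<in> U \<Longrightarrow> (X has_derivative X' x) (at x)"
    and cont: "\<And>b. b \<in> Basis \<Longrightarrow> continuous_on U (\<lambda>x. X' x b)"
  shows "(LINT x:K|lborel. \<Sum>b\<in>Basis. X' x b \<bullet> b) = 0"
proof -
  have X'0: "X' x = (\<lambda>h. 0)" if "x \<in> U - K" for x
  proof -
    have "(X has_derivative (\<lambda>h. 0)) (at x)"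
      by (rule has_derivative_transform_within_open[of "\<lambda>x. 0" _ _ _ "U - K"])
        (use UK zero that compact_imp_closed open_Diff in auto)
    then show ?thesis using der has_derivative_unique that by blast
  qed
  have b0: "(LINT x:K|lborel. X' x b \<bullet> b) = 0" and int: "set_integrable lborel K (\<lambda>x. X' x b \<bullet> b)"
    if b: "b \<in> Basis" for b
  proof -
    define f where "f x = (if x \<in> K then X x \<bullet> b else 0)" for x
    define f' where "f' x = (if x \<in> K then (\<lambda>h. X' x h \<bullet> b) else (\<lambda>h. 0))" for x
    have "(f has_derivative f' x) (at x)" for x
    proof (cases "x \<in> K")
      case True
      then have "x \<in> U" using UK by auto
      show ?thesis
      proof (rule has_derivative_transform_within_open[of "\<lambda>x. X x \<bullet> b" _ _ _ U])
        show "((\<lambda>x. X x \<bullet> b) has_derivative f' x) (at x)"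
          using der[OF \<open>x \<in> U\<close>] True by (auto simp: f'_def intro!: derivative_eq_intros)
      qed (use UK zero \<open>x \<in> U\<close> in \<open>auto simp: f_def\<close>)
    next
      case False
      show ?thesis
        by (rule has_derivative_transform_within_open[of "\<lambda>x. 0" _ _ _ "- K"])
          (use UK compact_imp_closed False in \<open>auto simp: f_def f'_def\<close>)
    qed
    moreover have "continuous_on UNIV (\<lambda>x. f' x b)"
    proof -
      have "continuous_on U (\<lambda>x. f' x b)"
      proof (rule continuous_on_eq[of _ "\<lambda>x. X' x b \<bullet> b"])
        show "continuous_on U (\<lambda>x. X' x b \<bullet> b)" using cont[OF b] by (intro continuous_intros)
      qed (use X'0 in \<open>auto simp: f'_def\<close>)
      moreover have "continuous_on (- K) (\<lambda>x. f' x b)"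
        by (rule continuous_on_eq[of _ "\<lambda>x. 0"]) (auto simp: f'_def)
      ultimately have "continuous_on (U \<union> - K) (\<lambda>x. f' x b)"
        using UK by (intro continuous_on_open_Un) (auto simp: compact_imp_closed)
      moreover have "U \<union> - K = UNIV" using UK by auto
      ultimately show ?thesis by simp
    qed
    ultimately have "(\<integral>x. f' x b \<partial>lborel) = 0"
      by (rule LINT_directional_derivative[where S = K]) (use UK in \<open>auto simp: f_def\<close>)
    moreover have "(\<integral>x. f' x b \<partial>lborel) = (LINT x:K|lborel. X' x b \<bullet> b)"
      unfolding set_lebesgue_integral_def
      by (rule Bochner_Integration.integral_cong) (auto simp: f'_def indicator_def)
    ultimately show "(LINT x:K|lborel. X' x b \<bullet> b) = 0" by simp
    show "set_integrable lborel K (\<lambda>x. X' x b \<bullet> b)"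
      using UK cont[OF b] by (intro set_integrable_continuous continuous_intros) (auto intro: continuous_on_subset)
  qed
  have "(LINT x:K|lborel. \<Sum>b\<in>Basis. X' x b \<bullet> b) = (\<Sum>b\<in>Basis. LINT x:K|lborel. X' x b \<bullet> b)"
    using int unfolding set_lebesgue_integral_def set_integrable_def scaleR_sum_right
    by (rule Bochner_Integration.integral_sum)
  then show ?thesis using b0 by simp
qed

lemma LINT_divergence_eq:
  fixes X :: "'a::euclidean_space \<Rightarrow> 'a"
  assumes "open U" "compact K" "K \<subseteq> U"
    and "\<And>x. x \<in> U - K \<Longrightarrow> X x = 0"
    and "\<And>x. x \<in> U \<Longrightarrow> (X has_derivative X' x) (at x)"
    and cont: "\<And>b. b \<in> Basis \<Longrightarrow> continuous_on U (\<lambda>x. X' x b)"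
    and eq: "\<And>x. x \<in> K \<Longrightarrow> (\<Sum>b\<in>Basis. X' x b \<bullet> b) = f x"
  shows "set_integrable lborel K f \<and> (LINT x:K|lborel. f x) = 0"
proof
  have c: "continuous_on K f"
  proof (rule continuous_on_eq[OF _ eq])
    show "continuous_on K (\<lambda>x. \<Sum>b\<in>Basis. X' x b \<bullet> b)"
      using continuous_on_subset[OF cont assms(3)] by (intro continuous_intros)
  qed
  then show "set_integrable lborel K f" by (rule set_integrable_continuous[OF assms(2)])
  have "(LINT x:K|lborel. f x) = (LINT x:K|lborel. \<Sum>b\<in>Basis. X' x b \<bullet> b)"
    by (rule set_lebesgue_integral_cong) (use assms(2) eq in \<open>auto simp: compact_imp_closed\<close>)
  then show "(LINT x:K|lborel. f x) = 0" using LINT_divergence[OF assms(1-6)] by simp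
qed

text \<open>Cauchy-Schwarz against the constant 1, read off from the nonnegative integral of
  \<open>(V * f x - I)\<^sup>2\<close>.\<close>

lemma LINT_square_le:
  fixes f :: "'a::euclidean_space \<Rightarrow> real"
  assumes S: "compact S" "continuous_on S f" and pos: "measure lborel S > 0"
  shows "(LINT x:S|lborel. f x)\<^sup>2 \<le> measure lborel S * (LINT x:S|lborel. (f x)\<^sup>2)"
proof -
  define V I J where "V = measure lborel S" and "I = (LINT x:S|lborel. f x)"
    and "J = (LINT x:S|lborel. (f x)\<^sup>2)"
  have c: "(LINT x:S|lborel. I\<^sup>2) = V * I\<^sup>2"
    using emeasure_compact_finite[OF S(1)] by (simp add: set_integral_const V_def S compact_imp_closed)
  have "0 \<le> (LINT x:S|lborel. (V * f x - I)\<^sup>2)"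
    unfolding set_lebesgue_integral_def by (rule integral_nonneg_AE) auto
  also have "\<dots> = (LINT x:S|lborel. V\<^sup>2 * (f x)\<^sup>2 - (2 * V * I) * f x + I\<^sup>2)"
    by (simp add: power2_diff power_mult_distrib algebra_simps)
  also have "\<dots> = V\<^sup>2 * J - (2 * V * I) * I + V * I\<^sup>2"
    using S by (subst set_integral_add, (intro set_integrable_continuous continuous_intros; simp)+,
        subst set_integral_diff, (intro set_integrable_continuous continuous_intros; simp)+)
      (simp add: c, simp add: I_def J_def)
  also have "\<dots> = V * (V * J - I\<^sup>2)" by (simp add: power2_eq_square algebra_simps)
  finally show ?thesis using pos unfolding V_def[symmetric] I_def[symmetric] J_def[symmetric]
    by (simp add: zero_le_mult_iff)
qed

lemma Fubini_compact:
  fixes f :: "'a::euclidean_space \<Rightarrow> 'b::euclidean_space \<Rightarrow> real"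
  assumes "compact S" "compact T" "continuous_on (S \<times> T) (\<lambda>(x, y). f x y)"
  shows "set_integrable lborel S (\<lambda>x. LINT y:T|lborel. f x y)"
    and "(LINT x:S|lborel. LINT y:T|lborel. f x y) = (LINT y:T|lborel. LINT x:S|lborel. f x y)"
proof -
  have "integrable (lborel :: ('a \<times> 'b) measure) (\<lambda>z. indicator (S \<times> T) z *\<^sub>R (case z of (x, y) \<Rightarrow> f x y))"
    using assms by (intro borel_integrable_compact compact_Times)
  also have "(\<lambda>z. indicator (S \<times> T) z *\<^sub>R (case z of (x, y) \<Rightarrow> f x y)) =
      (\<lambda>(x, y). indicator S x *\<^sub>R (indicator T y *\<^sub>R f x y))"
    by (auto simp: indicator_def)
  finally have i: "integrable (lborel \<Otimes>\<^sub>M lborel) (\<lambda>(x, y). indicator S x *\<^sub>R (indicator T y *\<^sub>R f x y))"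
    by (simp add: lborel_prod)
  show "set_integrable lborel S (\<lambda>x. LINT y:T|lborel. f x y)"
    using lborel_pair.integrable_fst'[OF i]
    by (simp add: set_integrable_def set_lebesgue_integral_def)
  show "(LINT x:S|lborel. LINT y:T|lborel. f x y) = (LINT y:T|lborel. LINT x:S|lborel. f x y)"
    using lborel_pair.Fubini_integral[OF i]
    by (simp add: set_lebesgue_integral_def mult.left_commute flip: integral_mult_right_zero)
qed

section \<open>Convolution\<close>

lemma linear_eq_sum_Basis:
  fixes T :: "'a::euclidean_space \<Rightarrow> 'b::real_vector"
  assumes "linear T"
  shows "T x = (\<Sum>b\<in>Basis. (x \<bullet> b) *\<^sub>R T b)"
  using linear_sum[OF assms, of "\<lambda>b. (x \<bullet> b) *\<^sub>R b" Basis] linear_cmul[OF assms]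
  by (simp add: euclidean_representation)

lemma sum_Basis_linear:
  fixes T :: "'a::euclidean_space \<Rightarrow> 'a"
  assumes "linear T"
  shows "(\<Sum>b\<in>Basis. (a \<bullet> T b) * (x \<bullet> b)) = a \<bullet> T x"
  by (subst (2) linear_eq_sum_Basis[OF assms]) (simp add: inner_sum_right mult.commute)

text \<open>Strict differentiability, uniform over a compact set: the linear map is taken at
  \<open>x\<close>, while \<open>a\<close> and \<open>b\<close> are any two points near it. In this
  form it serves both to differentiate under a convolution and to compare increments of the flux
  with its linearisation at a third, frozen point.\<close>

lemma strict_derivative_compact:
  fixes f :: "'a::euclidean_space \<Rightarrow> 'b::euclidean_space"
  assumes U: "open U" "compact K" "K \<subseteq> U"
    and der: "\<And>x. x \<in> U \<Longrightarrow> (f has_derivative f' x) (at x)"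
    and cont: "\<And>b. b \<in> Basis \<Longrightarrow> continuous_on U (\<lambda>x. f' x b)"
    and "\<epsilon> > 0"
  obtains d where "d > 0" "\<And>x. x \<in> K \<Longrightarrow> ball x d \<subseteq> U"
    "\<And>x a b. x \<in> K \<Longrightarrow> a \<in> ball x d \<Longrightarrow> b \<in> ball x d \<Longrightarrow>
      norm (f a - f b - f' x (a - b)) \<le> \<epsilon> * norm (a - b)"
proof -
  obtain r where r: "r > 0" "(\<Union>x\<in>K. cball x r) \<subseteq> U"
    using compact_subset_open_imp_cball_epsilon_subset[OF U(2,1,3)] by blast
  define K' where "K' = {x + y |x y. x \<in> K \<and> y \<in> cball 0 r}"
  have K'U: "K' \<subseteq> U"
  proof
    fix z assume "z \<in> K'"
    then obtain x y where "z = x + y" "x \<in> K" "norm y \<le> r" unfolding K'_def by auto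
    then have "z \<in> cball x r" by (simp add: dist_norm)
    then show "z \<in> U" using r \<open>x \<in> K\<close> by blast
  qed
  have K': "compact K'" unfolding K'_def using compact_sums[OF U(2) compact_cball] by blast
  have inK': "z \<in> K'" if "x \<in> K" "dist x z \<le> r" for x z
    unfolding K'_def using that
    by (intro CollectI exI[of _ x] exI[of _ "z - x"]) (auto simp: dist_norm norm_minus_commute)
  \<comment> \<open>Continuity of the derivative is assumed column by column, so its operator norm
    is bounded by a sum over the basis; the division makes that sum \<epsilon>.\<close>
  define e1 where "e1 = \<epsilon> / real DIM('a)"
  have e1: "e1 > 0" using \<open>\<epsilon> > 0\<close> by (simp add: e1_def)
  define P where "P b d \<longleftrightarrow> (\<forall>x\<in>K'. \<forall>y\<in>K'. dist x y < d \<longrightarrow> norm (f' x b - f' y b) \<le> e1)" for b d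
  have "\<forall>\<^sub>F d in at_right 0. P b d" if b: "b \<in> Basis" for b
  proof -
    have "uniformly_continuous_on K' (\<lambda>x. f' x b)"
      using compact_uniformly_continuous[OF continuous_on_subset[OF cont[OF b] K'U] K'] .
    then obtain d where "d > 0" "\<And>x y. x \<in> K' \<Longrightarrow> y \<in> K' \<Longrightarrow> dist x y < d \<Longrightarrow> dist (f' x b) (f' y b) < e1"
      using e1 unfolding uniformly_continuous_on_def by (metis dist_commute)
    then show ?thesis unfolding eventually_at_right_field P_def dist_norm
      by (intro exI[of _ d]) (smt (verit))
  qed
  then have "\<forall>\<^sub>F d in at_right 0. \<forall>b\<in>Basis. P b d"
    by (intro eventually_ball_finite) auto
  moreover have "\<forall>\<^sub>F d in at_right 0. d < r \<and> d > 0"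
    using r eventually_at_right_less[of 0] eventually_at_right_real[of 0 r] by (auto elim: eventually_mono)
  ultimately have "\<forall>\<^sub>F d in at_right 0. (\<forall>b\<in>Basis. P b d) \<and> d < r \<and> d > 0"
    by (rule eventually_conj)
  then obtain d where d: "\<And>b. b \<in> Basis \<Longrightarrow> P b d" "d < r" "d > 0"
    using eventually_happens'[OF trivial_limit_at_right_real] by blast
  show ?thesis
  proof (rule that[OF \<open>d > 0\<close>])
    show "ball x d \<subseteq> U" if "x \<in> K" for x
      using r d that by (meson UN_subset_iff ball_subset_cball order.strict_implies_order subset_ball subset_trans)
    fix x a b assume x: "x \<in> K" and a: "a \<in> ball x d" and b: "b \<in> ball x d"
    have "norm (f a - f b - f' x (a - b)) \<le> norm (a - b) * \<epsilon>"
    proof (rule differentiable_bound_linearization[where S = "ball x d"])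
      fix t :: real assume "t \<in> {0..1}"
      then show "b + t *\<^sub>R (a - b) \<in> ball x d"
        using convexD_alt[OF convex_ball b a] by (simp add: algebra_simps)
    next
      fix y assume y: "y \<in> ball x d"
      then have yK: "y \<in> K'" "x \<in> K'" using inK'[OF x, of y] inK'[OF x, of x] d r by auto
      then show "(f has_derivative f' y) (at y within ball x d)"
        using der K'U has_derivative_at_withinI by blast
      have lin: "linear (f' x)" "linear (f' y)"
        using der K'U yK has_derivative_linear by blast+
      show "onorm (f' y - f' x) \<le> \<epsilon>"
      proof (rule onorm_le)
        fix k
        have s: "linear (\<lambda>k. f' y k - f' x k)" using lin by (intro linear_compose_sub)
        have "(f' y - f' x) k = (\<Sum>b\<in>Basis. (k \<bullet> b) *\<^sub>R (f' y b - f' x b))"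
          using linear_eq_sum_Basis[OF s, of k] by simp
        then have "norm ((f' y - f' x) k) \<le> (\<Sum>b\<in>Basis. norm ((k \<bullet> b) *\<^sub>R (f' y b - f' x b)))"
          by (metis norm_sum)
        also have "\<dots> \<le> (\<Sum>b\<in>(Basis::'a set). norm k * e1)"
        proof (rule sum_mono)
          fix b :: 'a assume b: "b \<in> Basis"
          have "norm (f' y b - f' x b) \<le> e1"
            using d(1)[OF b] yK y unfolding P_def by (auto simp: dist_commute)
          then show "norm ((k \<bullet> b) *\<^sub>R (f' y b - f' x b)) \<le> norm k * e1"
            using Basis_le_norm[OF b, of k] by (auto intro!: mult_mono)
        qed
        also have "\<dots> = \<epsilon> * norm k" by (simp add: e1_def)
        finally show "norm ((f' y - f' x) k) \<le> \<epsilon> * norm k" .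
      qed
    qed (use d in auto)
    then show "norm (f a - f b - f' x (a - b)) \<le> \<epsilon> * norm (a - b)" by (simp add: mult.commute)
  qed
qed

definition conv :: "('a::euclidean_space \<Rightarrow> real) \<Rightarrow> ('a \<Rightarrow> 'b::euclidean_space) \<Rightarrow> 'a \<Rightarrow> 'b"
  where "conv k f x = (\<integral>y. k (x - y) *\<^sub>R f y \<partial>lborel)"

lemma conv_integrable:
  fixes f :: "'a::euclidean_space \<Rightarrow> 'b::euclidean_space"
  assumes "continuous_on UNIV k" "\<And>z. z \<notin> cball 0 e \<Longrightarrow> k z = 0" "continuous_on UNIV f"
  shows "integrable lborel (\<lambda>y. k (x - y) *\<^sub>R f y)"
proof (rule integrable_compact_support[of "cball x e"])
  show "continuous_on (cball x e) (\<lambda>y. k (x - y) *\<^sub>R f y)"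
    by (intro continuous_intros continuous_on_compose2[OF assms(1)] continuous_on_compose2[OF assms(3)]) auto
qed (use assms(2) in \<open>auto simp: dist_norm\<close>)

lemma conv_alt:
  fixes f :: "'a::euclidean_space \<Rightarrow> 'b::euclidean_space"
  assumes "continuous_on UNIV k" "\<And>z. z \<notin> cball 0 e \<Longrightarrow> k z = 0" "continuous_on UNIV f"
  shows "conv k f x = (LINT y:cball 0 e|lborel. k y *\<^sub>R f (x - y))"
proof -
  have "continuous_on UNIV (\<lambda>y. k (x - y) *\<^sub>R f y)"
    by (intro continuous_intros continuous_on_compose2[OF assms(1)] continuous_on_compose2[OF assms(3)]) auto
  then have "(\<lambda>y. k (x - y) *\<^sub>R f y) \<in> borel_measurable borel" by (rule borel_measurable_continuous_onI)
  from LINT_reflection[OF this, of x]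
  have "conv k f x = (\<integral>y. k y *\<^sub>R f (x - y) \<partial>lborel)" by (simp add: conv_def)
  also have "\<dots> = (LINT y:cball 0 e|lborel. k y *\<^sub>R f (x - y))"
    by (rule LINT_eq_set_LINT) (use assms(2) in auto)
  finally show ?thesis .
qed

lemma conv_inner:
  fixes f :: "'a::euclidean_space \<Rightarrow> 'b::euclidean_space"
  assumes "continuous_on UNIV k" "\<And>z. z \<notin> cball 0 e \<Longrightarrow> k z = 0" "continuous_on UNIV f"
  shows "conv k f x \<bullet> b = conv k (\<lambda>y. f y \<bullet> b) x"
  unfolding conv_def using conv_integrable[OF assms, where x = x]
  by (subst integral_inner_left[symmetric]) (auto simp: algebra_simps)

text \<open>All derivatives fall on the kernel, so continuity of \<open>f\<close> is enough. Strict
  differentiability makes the remainder of \<open>k\<close> uniformly small, and it is integrated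
  against |f| over a fixed ball.\<close>

lemma conv_has_derivative:
  fixes f :: "'a::euclidean_space \<Rightarrow> 'b::euclidean_space"
  assumes der: "\<And>z. GDERIV k z :> k' z" and cont: "continuous_on UNIV k'"
    and zero: "\<And>z. z \<notin> cball 0 e \<Longrightarrow> k z = 0" and f: "continuous_on UNIV f"
  shows "(conv k f has_derivative (\<lambda>h. \<Sum>b\<in>Basis. (h \<bullet> b) *\<^sub>R conv (\<lambda>z. k' z \<bullet> b) f x)) (at x)"
    (is "(_ has_derivative ?D) _")
proof -
  have ck: "continuous_on UNIV k"
    using has_derivative_continuous[OF der[unfolded gderiv_def]] by (simp add: continuous_on_eq_continuous_at)
  have zero': "k' z = 0" if "z \<notin> cball 0 e" for z
    using grad_zero_off_closed[of "cball 0 e" k z] zero that grad_eq[OF der] by simp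
  have D: "?D h = (\<integral>y. (h \<bullet> k' (x - y)) *\<^sub>R f y \<partial>lborel)" for h
  proof -
    have i: "integrable lborel (\<lambda>y. (k' (x - y) \<bullet> b) *\<^sub>R f y)" for b
      by (rule conv_integrable[where e = e]) (use cont zero' f in \<open>auto intro: continuous_intros\<close>)
    have "(\<integral>y. (h \<bullet> k' (x - y)) *\<^sub>R f y \<partial>lborel)
        = (\<integral>y. (\<Sum>b\<in>Basis. (h \<bullet> b) *\<^sub>R ((k' (x - y) \<bullet> b) *\<^sub>R f y)) \<partial>lborel)"
      by (subst euclidean_inner) (simp add: scaleR_sum_left)
    also have "\<dots> = ?D h"
      by (subst Bochner_Integration.integral_sum) (auto intro!: integrable_scaleR_right i simp: conv_def simp del: scaleR_scaleR)
    finally show ?thesis by simp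
  qed
  \<comment> \<open>The summand 1 keeps the divisor \<open>W\<close> positive. The radius
    \<open>e + 1\<close> covers the supports of both kernels once the increment is shorter than
    1.\<close>
  define W where "W = (LINT y:cball x (e + 1)|lborel. norm (f y)) + 1"
  have cnf: "continuous_on (cball x (e + 1)) (\<lambda>y. norm (f y))"
    using f by (intro continuous_intros) (auto intro: continuous_on_subset)
  have W: "W > 0"
  proof -
    have "0 \<le> (LINT y:cball x (e + 1)|lborel. norm (f y))"
      unfolding set_lebesgue_integral_def by (rule integral_nonneg_AE) auto
    then show ?thesis by (simp add: W_def)
  qed
  show ?thesis unfolding has_derivative_at_alt
  proof (intro conjI allI impI)
    show "bounded_linear ?D"
      by (intro bounded_linear_sum bounded_linear_scaleR_const bounded_linear_inner_left)
    fix \<epsilon> :: real assume "\<epsilon> > 0"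
    obtain d where d: "d > 0" "\<And>z a b. z \<in> cball 0 (e + 1) \<Longrightarrow> a \<in> ball z d \<Longrightarrow> b \<in> ball z d \<Longrightarrow>
        norm (k a - k b - (a - b) \<bullet> k' z) \<le> \<epsilon> / W * norm (a - b)"
    proof (rule strict_derivative_compact[of UNIV "cball 0 (e + 1)" k "\<lambda>z h. h \<bullet> k' z" "\<epsilon> / W"])
      show "(k has_derivative (\<lambda>h. h \<bullet> k' z)) (at z)" for z using der unfolding gderiv_def .
      show "continuous_on UNIV (\<lambda>z. b \<bullet> k' z)" for b using cont by (intro continuous_intros)
    qed (use \<open>\<epsilon> > 0\<close> W in auto)
    show "\<exists>d>0. \<forall>y. norm (y - x) < d \<longrightarrow> norm (conv k f y - conv k f x - ?D (y - x)) \<le> \<epsilon> * norm (y - x)"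
    proof (intro exI[of _ "min d 1"] conjI allI impI)
      fix x' assume x': "norm (x' - x) < min d 1"
      define h where "h = x' - x"
      let ?g = "\<lambda>y. (k (x' - y) - k (x - y) - h \<bullet> k' (x - y)) *\<^sub>R f y"
      have i1: "integrable lborel (\<lambda>y. k (x - y) *\<^sub>R f y)" for x
        by (rule conv_integrable[OF ck zero f])
      have i2: "integrable lborel (\<lambda>y. (h \<bullet> k' (x - y)) *\<^sub>R f y)"
        by (rule conv_integrable[where e = e]) (use cont zero' f in \<open>auto intro: continuous_intros\<close>)
      have "conv k f x' - conv k f x - ?D h = (\<integral>y. ?g y \<partial>lborel)"
        unfolding D unfolding conv_def using i1 i2 by (simp add: scaleR_diff_left)
      also have "norm \<dots> \<le> (\<integral>y. norm (?g y) \<partial>lborel)"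
        by (rule integral_norm_bound)
      also have "\<dots> \<le> (\<integral>y. indicator (cball x (e + 1)) y *\<^sub>R ((\<epsilon> / W * norm h) * norm (f y)) \<partial>lborel)"
      proof (rule integral_mono)
        show "integrable lborel (\<lambda>y. norm (?g y))"
          using i1 i2 by (intro integrable_norm) (simp add: scaleR_diff_left)
        show "integrable lborel (\<lambda>y. indicator (cball x (e + 1)) y *\<^sub>R ((\<epsilon> / W * norm h) * norm (f y)))"
          by (intro borel_integrable_compact continuous_on_mult_left cnf compact_cball)
        fix y
        show "norm (?g y) \<le> indicator (cball x (e + 1)) y *\<^sub>R ((\<epsilon> / W * norm h) * norm (f y))"
        proof (cases "y \<in> cball x (e + 1)")
          case True
          then have "x - y \<in> cball 0 (e + 1)" by (simp add: dist_norm norm_minus_commute)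
          from d(2)[OF this, of "x' - y" "x - y"] x' d(1)
          have "\<bar>k (x' - y) - k (x - y) - h \<bullet> k' (x - y)\<bar> \<le> \<epsilon> / W * norm h"
            by (simp add: h_def dist_norm norm_minus_commute)
          then show ?thesis using True mult_right_mono by fastforce
        next
          case False
          have "norm (x - y) \<le> norm (x' - y) + norm (x' - x)"
            by (metis norm_minus_commute norm_triangle_sub add.commute diff_add_cancel add_diff_eq diff_diff_eq2 norm_triangle_ineq4)
          then have "k (x' - y) = 0" "k (x - y) = 0" "k' (x - y) = 0"
            using False x' by (auto intro!: zero zero' simp: dist_norm norm_minus_commute[of y])
          then show ?thesis using False by simp
        qed
      qed
      also have "\<dots> = (\<epsilon> / W * norm h) * (LINT y:cball x (e + 1)|lborel. norm (f y))"
        unfolding set_lebesgue_integral_def[symmetric] by (rule set_integral_mult_right)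
      also have "\<dots> \<le> (\<epsilon> / W * norm h) * W"
        using \<open>\<epsilon> > 0\<close> W by (intro mult_left_mono) (auto simp: W_def)
      also have "\<dots> = \<epsilon> * norm h" using W by simp
      finally show "norm (conv k f x' - conv k f x - ?D (x' - x)) \<le> \<epsilon> * norm (x' - x)"
        by (simp add: h_def)
    qed (use d in auto)
  qed
qed

section \<open>The flux and its linearisation\<close>

definition flux :: "real \<Rightarrow> 'a::real_inner \<Rightarrow> 'a"
  where "flux p \<xi> = norm \<xi> powr (p - 2) *\<^sub>R \<xi>"

text \<open>The derivative of \<open>flux\<close> away from 0, with eigenvalues |\<xi>|^(p-2) and
  (p-1) |\<xi>|^(p-2). At \<open>\<xi> = 0\<close> the conventions \<open>0 powr r = 0\<close> and
  \<open>x / 0 = 0\<close> make it the zero map, so linearity and the ellipticity bound hold for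
  every \<xi>.\<close>

definition dflux :: "real \<Rightarrow> 'a::real_inner \<Rightarrow> 'a \<Rightarrow> 'a"
  where "dflux p \<xi> \<eta> = norm \<xi> powr (p - 2) *\<^sub>R (\<eta> + ((p - 2) * (\<xi> \<bullet> \<eta>) / (\<xi> \<bullet> \<xi>)) *\<^sub>R \<xi>)"

lemma norm_powr_eq: "norm x powr r = (x \<bullet> x) powr (r / 2)"
  by (simp add: norm_eq_sqrt_inner powr_half_sqrt[symmetric] powr_powr)

lemma norm_powr_GDERIV:
  assumes "\<xi> \<noteq> 0"
  shows "GDERIV (\<lambda>\<xi>. norm \<xi> powr r) \<xi> :> (r * norm \<xi> powr (r - 2)) *\<^sub>R \<xi>"
proof -
  have z: "\<xi> \<bullet> \<xi> > 0" using assms by simp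
  have "(\<xi> \<bullet> \<xi>) powr (r / 2) = (\<xi> \<bullet> \<xi>) powr (1 + (r - 2) / 2)" by (simp add: field_simps)
  then have e: "(\<xi> \<bullet> \<xi>) powr (r / 2) = (\<xi> \<bullet> \<xi>) * norm \<xi> powr (r - 2)"
    using z by (simp only: norm_powr_eq powr_add powr_one)
  have "((\<lambda>\<xi>. (\<xi> \<bullet> \<xi>) powr (r / 2)) has_derivative
      (\<lambda>h. (\<xi> \<bullet> \<xi>) powr (r / 2) * (0 * ln (\<xi> \<bullet> \<xi>) + (\<xi> \<bullet> h + h \<bullet> \<xi>) * (r / 2) / (\<xi> \<bullet> \<xi>)))) (at \<xi>)"
    by (rule has_derivative_powr) (auto intro!: derivative_eq_intros simp: assms)
  moreover have "(\<lambda>h. (\<xi> \<bullet> \<xi>) powr (r / 2) * (0 * ln (\<xi> \<bullet> \<xi>) + (\<xi> \<bullet> h + h \<bullet> \<xi>) * (r / 2) / (\<xi> \<bullet> \<xi>))) =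
      (\<lambda>h. h \<bullet> ((r * norm \<xi> powr (r - 2)) *\<^sub>R \<xi>))"
    unfolding e using z by (simp add: inner_commute fun_eq_iff)
  ultimately show ?thesis unfolding gderiv_def norm_powr_eq by (rule has_derivative_eq_rhs)
qed

lemma flux_has_derivative:
  assumes "\<xi> \<noteq> 0"
  shows "(flux p has_derivative dflux p \<xi>) (at \<xi>)"
proof -
  have e: "norm \<xi> powr (p - 2 - 2) = norm \<xi> powr (p - 2) / (\<xi> \<bullet> \<xi>)"
    using assms powr_diff[of "norm \<xi>" "p - 2" 2] by (simp add: power2_norm_eq_inner)
  have "((\<lambda>\<xi>. norm \<xi> powr (p - 2) *\<^sub>R \<xi>) has_derivative
      (\<lambda>h. norm \<xi> powr (p - 2) *\<^sub>R h + (h \<bullet> (((p - 2) * norm \<xi> powr (p - 2 - 2)) *\<^sub>R \<xi>)) *\<^sub>R \<xi>)) (at \<xi>)"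
    using norm_powr_GDERIV[OF assms, of "p - 2", unfolded gderiv_def]
    by (rule has_derivative_scaleR) simp
  moreover have "(\<lambda>h. norm \<xi> powr (p - 2) *\<^sub>R h + (h \<bullet> (((p - 2) * norm \<xi> powr (p - 2 - 2)) *\<^sub>R \<xi>)) *\<^sub>R \<xi>) = dflux p \<xi>"
    unfolding e dflux_def by (simp add: scaleR_add_right inner_commute mult.commute mult.left_commute fun_eq_iff)
  ultimately show ?thesis unfolding flux_def[abs_def] by (rule has_derivative_eq_rhs)
qed

text \<open>Only the origin is delicate: there the norm of the flux is |\<xi>|^(p-1), which tends to
  0 because \<open>p > 1\<close>, even when p - 2 is negative.\<close>

lemma flux_continuous:
  assumes "p > 1"
  shows "continuous_on UNIV (flux p :: 'a::real_inner \<Rightarrow> 'a)"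
proof -
  have "isCont (flux p) \<xi>" for \<xi> :: 'a
  proof (cases "\<xi> = 0")
    case False
    then show ?thesis using flux_has_derivative has_derivative_continuous by blast
  next
    case True
    have "((\<lambda>\<xi>::'a. norm \<xi> powr (p - 1)) \<longlongrightarrow> 0) (at 0)"
      using assms by (intro tendsto_eq_intros | simp)+
    moreover have "norm (flux p \<eta>) = norm \<eta> powr (p - 1)" for \<eta> :: 'a
    proof (cases "\<eta> = 0")
      case False
      then have "norm \<eta> powr (p - 1) = norm \<eta> powr (p - 2) * norm \<eta>"
        using powr_add[of "norm \<eta>" "p - 2" 1] by simp
      then show ?thesis by (simp add: flux_def)
    qed (simp add: flux_def)
    ultimately have "((flux p) \<longlongrightarrow> (0::'a)) (at 0)"
      by (subst tendsto_norm_zero_iff[symmetric]) simp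
    then show ?thesis using True by (simp add: isCont_def flux_def)
  qed
  then show ?thesis by (simp add: continuous_on_eq_continuous_at)
qed

lemma dflux_continuous: "continuous_on (- {0}) (\<lambda>\<xi>. dflux p \<xi> \<eta>)"
  unfolding dflux_def by (intro continuous_intros) auto

lemma linear_dflux: "linear (dflux p \<xi>)"
  unfolding dflux_def
  by (rule linearI) (simp_all add: inner_add_right scaleR_add_right scaleR_add_left
      distrib_left add_divide_distrib mult.left_commute)

lemma dflux_elliptic:
  assumes "p > 1"
  shows "min 1 (p - 1) * norm \<xi> powr (p - 2) * (\<eta> \<bullet> \<eta>) \<le> dflux p \<xi> \<eta> \<bullet> \<eta>"
proof -
  \<comment> \<open>The squared length of the projection of \<eta> onto \<xi>, hence between 0 and
    |\<eta>|^2. The lower bound serves \<open>p \<ge> 2\<close>, the upper bound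
    \<open>p < 2\<close>.\<close>
  define t where "t = (\<xi> \<bullet> \<eta>)\<^sup>2 / (\<xi> \<bullet> \<xi>)"
  have t0: "t \<ge> 0" by (simp add: t_def)
  have t1: "t \<le> \<eta> \<bullet> \<eta>"
  proof (cases "\<xi> = 0")
    case False
    then have "\<xi> \<bullet> \<xi> > 0" by simp
    then show ?thesis using Cauchy_Schwarz_ineq[of \<xi> \<eta>] by (simp add: t_def divide_le_eq mult.commute)
  qed (simp add: t_def)
  have "min 1 (p - 1) * (\<eta> \<bullet> \<eta>) \<le> \<eta> \<bullet> \<eta> + (p - 2) * t"
  proof (cases "p \<ge> 2")
    case True
    then show ?thesis using t0 by (simp add: min_def)
  next
    case False
    then have "(p - 2) * t \<ge> (p - 2) * (\<eta> \<bullet> \<eta>)" using t1 by (intro mult_left_mono_neg) auto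
    then show ?thesis using False by (simp add: min_def algebra_simps)
  qed
  from mult_left_mono[OF this, of "norm \<xi> powr (p - 2)"] show ?thesis
    by (simp add: dflux_def t_def inner_add_left power2_eq_square mult_ac)
qed

lemma sum_Basis_inner_square: "(\<Sum>b\<in>Basis. (x \<bullet> b)\<^sup>2) = x \<bullet> (x::'a::euclidean_space)"
  using euclidean_inner[of x x] by (simp add: power2_eq_square)

text \<open>The squared Hilbert-Schmidt norm of \<open>B\<close>.\<close>

definition hs2 :: "('a::euclidean_space \<Rightarrow> 'a) \<Rightarrow> real"
  where "hs2 B = (\<Sum>b\<in>Basis. B b \<bullet> B b)"

definition tr :: "('a::euclidean_space \<Rightarrow> 'a) \<Rightarrow> real"
  where "tr B = (\<Sum>b\<in>Basis. B b \<bullet> b)"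

lemma hs2_nonneg: "hs2 B \<ge> 0"
  unfolding hs2_def by (intro sum_nonneg) auto

lemma tr_square_le: "(tr B)\<^sup>2 \<le> real DIM('a) * hs2 (B :: 'a::euclidean_space \<Rightarrow> 'a)"
proof -
  have "(tr B)\<^sup>2 \<le> real DIM('a) * (\<Sum>b\<in>Basis. (B b \<bullet> b)\<^sup>2)"
    unfolding tr_def using sum_squared_le_sum_of_squares[of "\<lambda>b. B b \<bullet> b" Basis] by (simp add: mult.commute)
  also have "(\<Sum>b\<in>Basis. (B b \<bullet> b)\<^sup>2) \<le> hs2 B"
    unfolding hs2_def
  proof (rule sum_mono)
    fix b :: 'a assume "b \<in> Basis"
    then show "(B b \<bullet> b)\<^sup>2 \<le> B b \<bullet> B b"
      using Cauchy_Schwarz_ineq[of "B b" b] by simp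
  qed
  finally show ?thesis by (simp add: mult_left_mono)
qed

lemma norm_linear_le_hs2:
  assumes "linear (B :: 'a::euclidean_space \<Rightarrow> 'a)"
  shows "norm (B x) \<le> sqrt (hs2 B) * norm x"
proof -
  have "B x = (\<Sum>b\<in>Basis. (x \<bullet> b) *\<^sub>R B b)"
    by (rule linear_eq_sum_Basis[OF assms])
  then have "norm (B x) \<le> (\<Sum>b\<in>Basis. \<bar>x \<bullet> b\<bar> * norm (B b))"
    using norm_sum[of "\<lambda>b. (x \<bullet> b) *\<^sub>R B b" Basis] by simp
  also have "\<dots> \<le> sqrt (\<Sum>b\<in>Basis. \<bar>x \<bullet> b\<bar>\<^sup>2) * sqrt (\<Sum>b\<in>Basis. (norm (B b))\<^sup>2)"
    using L2_set_mult_ineq[of "\<lambda>b. \<bar>x \<bullet> b\<bar>" "\<lambda>b. norm (B b)" Basis] by (simp add: L2_set_def)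
  also have "\<dots> = sqrt (hs2 B) * norm x"
    by (simp add: sum_Basis_inner_square hs2_def power2_norm_eq_inner norm_eq_sqrt_inner)
  finally show ?thesis .
qed

section \<open>The pointwise Bernstein inequality\<close>

text \<open>The divergence of the field \<open>z\<^sup>k lv + (p - 2) z\<^sup>k\<^sup>-\<^sup>1 (\<xi> \<bullet> lv) \<xi>\<close> for \<open>z = |\<xi>|\<^sup>2\<close>,
  where \<open>B\<close> and \<open>Dl\<close> are the derivatives of \<open>\<xi>\<close> and \<open>lv\<close>.\<close>

definition divJ :: "real \<Rightarrow> real \<Rightarrow> 'a::euclidean_space \<Rightarrow> ('a \<Rightarrow> 'a) \<Rightarrow> 'a \<Rightarrow> ('a \<Rightarrow> 'a) \<Rightarrow> real"
  where "divJ p k \<xi> B lv Dl = (let z = \<xi> \<bullet> \<xi> in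
    2 * k * z powr (k - 1) * (B \<xi> \<bullet> lv) + z powr k * tr Dl
    + (p - 2) * (2 * (k - 1) * z powr (k - 2) * (B \<xi> \<bullet> \<xi>) * (\<xi> \<bullet> lv)
      + z powr (k - 1) * (B \<xi> \<bullet> lv + \<xi> \<bullet> Dl \<xi> + (\<xi> \<bullet> lv) * tr B)))"

text \<open>Terms with a derivative of \<xi> scale like z^k |B| |lv| / |\<xi>|, terms with a
  derivative of \<open>lv\<close> like z^k m. The bound is linear in the size of \<open>B\<close>,
  so Young's inequality can later absorb it into the quadratic term.\<close>

lemma divJ_bound:
  fixes \<xi> :: "'a::euclidean_space"
  assumes "\<xi> \<noteq> 0" "linear B" "linear Dl" "\<And>h. norm (Dl h) \<le> m * norm h"
  shows "\<bar>divJ p k \<xi> B lv Dl\<bar> \<le> (\<xi> \<bullet> \<xi>) powr k *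
    ((2 * \<bar>k\<bar> + \<bar>p - 2\<bar> * (2 * \<bar>k - 1\<bar> + 1 + sqrt (DIM('a)))) * (sqrt (hs2 B) * norm lv / norm \<xi>)
      + (real DIM('a) + \<bar>p - 2\<bar>) * m)"
proof -
  define z Z n b l N where "z = \<xi> \<bullet> \<xi>" and "Z = z powr k" and "n = norm \<xi>" and "b = sqrt (hs2 B)"
    and "l = norm lv" and "N = real DIM('a)"
  have n: "n > 0" "z = n * n" "z > 0"
    using assms by (auto simp: n_def z_def power2_norm_eq_inner[symmetric] power2_eq_square)
  have Z: "Z > 0" using n by (simp add: Z_def)
  have b: "b \<ge> 0" and l: "l \<ge> 0" by (auto simp: b_def l_def hs2_nonneg)
  have Z1: "z powr (k - 1) = Z / (n * n)" using n by (simp add: Z_def powr_diff)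
  have Z2: "z powr (k - 2) = Z / (n * n * (n * n))"
    using n powr_diff[of z k 2] by (simp add: Z_def power2_eq_square)
  have nB: "norm (B \<xi>) \<le> b * n" using norm_linear_le_hs2[OF assms(2)] by (simp add: b_def n_def)
  have m1: "\<bar>B \<xi> \<bullet> lv\<bar> \<le> b * n * l"
    using Cauchy_Schwarz_ineq2[of "B \<xi>" lv] mult_right_mono[OF nB l] by (simp add: l_def)
  have m2: "\<bar>B \<xi> \<bullet> \<xi>\<bar> \<le> b * n * n"
    using order_trans[OF Cauchy_Schwarz_ineq2[of "B \<xi>" \<xi>] mult_right_mono[OF nB, of "norm \<xi>"]] by (simp add: n_def)
  have m3: "\<bar>\<xi> \<bullet> lv\<bar> \<le> n * l"
    using Cauchy_Schwarz_ineq2[of \<xi> lv] by (simp add: n_def l_def)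
  have m4: "\<bar>\<xi> \<bullet> Dl \<xi>\<bar> \<le> m * (n * n)"
    using order_trans[OF Cauchy_Schwarz_ineq2[of \<xi> "Dl \<xi>"] mult_left_mono[OF assms(4)[of \<xi>], of "norm \<xi>"]]
    by (simp add: n_def mult_ac)
  have m5: "\<bar>tr B\<bar> \<le> sqrt N * b"
    using real_sqrt_le_mono[OF tr_square_le[of B]] by (simp add: b_def N_def real_sqrt_mult)
  have m6: "\<bar>tr Dl\<bar> \<le> N * m"
  proof -
    have "\<bar>tr Dl\<bar> \<le> (\<Sum>b\<in>(Basis::'a set). \<bar>Dl b \<bullet> b\<bar>)" unfolding tr_def by (rule sum_abs)
    also have "\<dots> \<le> (\<Sum>b\<in>(Basis::'a set). m)"
    proof (rule sum_mono)
      fix b :: 'a assume "b \<in> Basis"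
      then show "\<bar>Dl b \<bullet> b\<bar> \<le> m"
        using Cauchy_Schwarz_ineq2[of "Dl b" b] assms(4)[of b] by simp
    qed
    finally show ?thesis by (simp add: N_def)
  qed
  have t1: "\<bar>2 * k * z powr (k - 1) * (B \<xi> \<bullet> lv)\<bar> \<le> Z * (2 * \<bar>k\<bar> * (b * l / n))"
  proof -
    have "\<bar>2 * k * z powr (k - 1) * (B \<xi> \<bullet> lv)\<bar> \<le> 2 * \<bar>k\<bar> * (Z / (n * n)) * (b * n * l)"
      unfolding Z1 abs_mult using m1 Z n by (intro mult_mono) auto
    also have "\<dots> = Z * (2 * \<bar>k\<bar> * (b * l / n))" using n by (simp add: field_simps)
    finally show ?thesis .
  qed
  have t2: "\<bar>Z * tr Dl\<bar> \<le> Z * (N * m)" using m6 Z by (simp add: abs_mult)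
  have t3: "\<bar>2 * (k - 1) * z powr (k - 2) * (B \<xi> \<bullet> \<xi>) * (\<xi> \<bullet> lv)\<bar> \<le> Z * (2 * \<bar>k - 1\<bar> * (b * l / n))"
  proof -
    have "\<bar>2 * (k - 1) * z powr (k - 2) * (B \<xi> \<bullet> \<xi>) * (\<xi> \<bullet> lv)\<bar>
        \<le> 2 * \<bar>k - 1\<bar> * (Z / (n * n * (n * n))) * (b * n * n) * (n * l)"
      unfolding Z2 abs_mult using m2 m3 Z n b by (intro mult_mono) auto
    also have "\<dots> = Z * (2 * \<bar>k - 1\<bar> * (b * l / n))" using n by (simp add: field_simps)
    finally show ?thesis .
  qed
  have t4: "\<bar>z powr (k - 1) * (B \<xi> \<bullet> lv + \<xi> \<bullet> Dl \<xi> + (\<xi> \<bullet> lv) * tr B)\<bar>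
      \<le> Z * ((1 + sqrt N) * (b * l / n) + m)"
  proof -
    have "\<bar>(\<xi> \<bullet> lv) * tr B\<bar> \<le> (n * l) * (sqrt N * b)"
      unfolding abs_mult using m3 m5 n l by (intro mult_mono) auto
    then have "\<bar>B \<xi> \<bullet> lv + \<xi> \<bullet> Dl \<xi> + (\<xi> \<bullet> lv) * tr B\<bar> \<le> b * n * l + m * (n * n) + (n * l) * (sqrt N * b)"
      using m1 m4 by linarith
    then have "\<bar>z powr (k - 1) * (B \<xi> \<bullet> lv + \<xi> \<bullet> Dl \<xi> + (\<xi> \<bullet> lv) * tr B)\<bar>
        \<le> (Z / (n * n)) * (b * n * l + m * (n * n) + (n * l) * (sqrt N * b))"
      unfolding Z1 abs_mult using Z n by (intro mult_mono) auto
    also have "\<dots> = Z * ((1 + sqrt N) * (b * l / n) + m)" using n by (simp add: field_simps)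
    finally show ?thesis .
  qed
  let ?t3 = "2 * (k - 1) * z powr (k - 2) * (B \<xi> \<bullet> \<xi>) * (\<xi> \<bullet> lv)"
  let ?t4 = "z powr (k - 1) * (B \<xi> \<bullet> lv + \<xi> \<bullet> Dl \<xi> + (\<xi> \<bullet> lv) * tr B)"
  have "\<bar>(p - 2) * (?t3 + ?t4)\<bar> \<le> \<bar>p - 2\<bar> * (Z * (2 * \<bar>k - 1\<bar> * (b * l / n)) + Z * ((1 + sqrt N) * (b * l / n) + m))"
    unfolding abs_mult[of "p - 2"] using t3 t4 by (intro mult_left_mono) auto
  then have "\<bar>divJ p k \<xi> B lv Dl\<bar> \<le> Z * (2 * \<bar>k\<bar> * (b * l / n)) + Z * (N * m)
      + \<bar>p - 2\<bar> * (Z * (2 * \<bar>k - 1\<bar> * (b * l / n)) + Z * ((1 + sqrt N) * (b * l / n) + m))"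
    using t1 t2 unfolding divJ_def Let_def z_def[symmetric] Z_def[symmetric] by linarith
  also have "\<dots> = Z * ((2 * \<bar>k\<bar> + \<bar>p - 2\<bar> * (2 * \<bar>k - 1\<bar> + 1 + sqrt N)) * (b * l / n) + (N + \<bar>p - 2\<bar>) * m)"
    by (simp add: algebra_simps add_divide_distrib)
  finally show ?thesis unfolding Z_def z_def n_def b_def l_def N_def .
qed

text \<open>In the application \<open>B\<close> and \<open>L\<close> are the derivatives of the mollified gradient \<open>\<xi>\<close> and of the mollified
  flux, \<open>lv\<close> is the gradient of \<open>log \<zeta>\<close> for the cut-off function \<open>\<zeta>\<close>, and \<open>\<Psi>\<close>, \<open>\<Psi>1\<close> are the values of a function of
  \<open>\<zeta> |\<xi>|\<^sup>2\<close> and of its derivative. The first three lines on the right are integrands with integral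
  zero; the remaining terms vanish if \<open>L\<close> is exactly \<open>dflux p \<xi> \<circ> B\<close> and \<open>tr L = |\<xi>|\<^sup>q\<close>.\<close>

definition bernstein_const :: "'a::euclidean_space itself \<Rightarrow> real \<Rightarrow> real \<Rightarrow> real \<Rightarrow> real \<Rightarrow> real \<Rightarrow> bool"
  where "bernstein_const (_ :: 'a itself) p q k c C \<longleftrightarrow> c > 0 \<and> C > 0 \<and> (\<forall>(\<xi>::'a) B L lv Dl m \<Psi> \<Psi>1 \<zeta> \<phi> d\<phi> J d\<Psi>.
    \<xi> \<noteq> 0 \<longrightarrow> linear B \<longrightarrow> (\<forall>x y. B x \<bullet> y = x \<bullet> B y) \<longrightarrow> linear L \<longrightarrow> linear Dl \<longrightarrow>
    (\<forall>h. norm (Dl h) \<le> m * norm h) \<longrightarrow> \<Psi> \<ge> 0 \<longrightarrow> \<Psi>1 \<ge> 0 \<longrightarrow> \<zeta> \<ge> 0 \<longrightarrow>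
    \<phi> = (\<xi> \<bullet> \<xi>) powr (k - p / 2) * \<Psi> \<longrightarrow>
    d\<Psi> = (\<Psi>1 * \<zeta>) *\<^sub>R (2 *\<^sub>R B \<xi> + (\<xi> \<bullet> \<xi>) *\<^sub>R lv) \<longrightarrow>
    d\<phi> = ((k - p / 2) * (\<xi> \<bullet> \<xi>) powr (k - p / 2 - 1) * \<Psi>) *\<^sub>R (2 *\<^sub>R B \<xi>) + (\<xi> \<bullet> \<xi>) powr (k - p / 2) *\<^sub>R d\<Psi> \<longrightarrow>
    J = (\<xi> \<bullet> \<xi>) powr k *\<^sub>R lv + ((p - 2) * (\<xi> \<bullet> \<xi>) powr (k - 1) * (\<xi> \<bullet> lv)) *\<^sub>R \<xi> \<longrightarrow>
    \<Psi> * (\<xi> \<bullet> \<xi>) powr k * (c * (\<xi> \<bullet> \<xi>) powr (q + 1 - p) - C * (lv \<bullet> lv + m))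
    \<le> (\<phi> * (\<Sum>b\<in>Basis. B b \<bullet> L b) + L \<xi> \<bullet> d\<phi> - tr L * (\<phi> * tr B + \<xi> \<bullet> d\<phi>))
      + (norm \<xi> powr q * (\<phi> * tr B + \<xi> \<bullet> d\<phi>) + \<phi> * (q * norm \<xi> powr (q - 2) * (B \<xi> \<bullet> \<xi>)))
      + (1 / 2) * (J \<bullet> d\<Psi> + \<Psi> * divJ p k \<xi> B lv Dl)
      + \<bar>\<phi> * (\<Sum>b\<in>Basis. B b \<bullet> (L b - dflux p \<xi> (B b))) + (L \<xi> - dflux p \<xi> (B \<xi>)) \<bullet> d\<phi>
          + (norm \<xi> powr q - tr L) * (\<phi> * tr B + \<xi> \<bullet> d\<phi>)\<bar>
      + C * (\<Psi> * (\<xi> \<bullet> \<xi>) powr (k + 1 - p)) * (tr (\<lambda>h. dflux p \<xi> (B h)) - norm \<xi> powr q)\<^sup>2)"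

text \<open>The third integrand completes a square: with \<open>v = 2 B \<xi> + z lv\<close>, all
  terms containing \<Psi>1 add up to a nonnegative multiple of
  \<open>dflux p \<xi> v \<bullet> v\<close>, which ellipticity makes nonnegative. What remains is
  the good term \<open>hs2 B\<close>, bounded below through the trace by a power of |\<xi>|, and
  lower-order terms absorbed by Young's inequality.\<close>

lemma bernstein_pointwise:
  fixes p q :: real
  assumes p: "p > 1" and q: "q > p - 1"
  shows "\<exists>k c C. bernstein_const TYPE('a::euclidean_space) p q k c C"
proof -
  \<comment> \<open>\<open>c0\<close> is the ellipticity constant. \<open>c2\<close> bounds the
    squared trace of \<open>dflux p \<xi> \<circ> B\<close> by \<open>hs2 B\<close>, up to the
    factor |\<xi>|^(2(p-2)). \<open>k0\<close> is what \<open>young1\<close> needs to absorb the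
    term with factor \<open>q\<close> at the price c0 / (8 c2). \<open>C3\<close> and
    \<open>C4\<close> are the constants of \<open>divJ_bound\<close>.\<close>
  define c0 c2 k0 k C3 C4 where "c0 = min 1 (p - 1)" and "c2 = 2 * real DIM('a) + 2 * (p - 2)\<^sup>2"
    and "k0 = q\<^sup>2 * c2 / c0\<^sup>2" and "k = p / 2 + k0"
    and "C3 = 2 * \<bar>k\<bar> + \<bar>p - 2\<bar> * (2 * \<bar>k - 1\<bar> + 1 + sqrt (DIM('a)))"
    and "C4 = real DIM('a) + \<bar>p - 2\<bar>"
  \<comment> \<open>One summand for each use: \<open>young2\<close> for the part of
    \<open>divJ\<close> linear in \<open>B\<close>, the bound \<open>m\<close> on the derivative of
    \<open>lv\<close>, and the squared defect \<open>e\<close> of the trace.\<close>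
  define C where "C = C3\<^sup>2 / (8 * c0) + C4 + c0 / (2 * c2)"
  have c0: "c0 > 0" using p by (simp add: c0_def)
  have c2: "c2 > 0" by (auto simp: c2_def intro!: add_pos_nonneg)
  have q0: "q > 0" using p q by simp
  have k0: "k0 > 0" using c0 c2 q0 by (simp add: k0_def)
  have C4: "C4 > 0" by (auto simp: C4_def intro!: add_pos_nonneg)
  have Cpos: "C > 0" using C4 c0 c2 by (simp add: C_def add_nonneg_pos add_pos_pos)
  show ?thesis
    unfolding bernstein_const_def
  proof (rule exI[of _ k], rule exI[of _ "c0 / (8 * c2)"], rule exI[of _ C], intro conjI allI impI)
    show "0 < c0 / (8 * c2)" using c0 c2 by simp
    show "0 < C" by (rule Cpos)
    fix \<xi> lv d\<phi> J d\<Psi> :: 'a and B L Dl :: "'a \<Rightarrow> 'a" and m \<Psi> \<Psi>1 \<zeta> \<phi> :: real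
    assume \<xi>: "\<xi> \<noteq> 0" and B: "linear B" "\<forall>x y. B x \<bullet> y = x \<bullet> B y" and L: "linear L"
      and Dl: "linear Dl" "\<forall>h. norm (Dl h) \<le> m * norm h" and \<Psi>: "\<Psi> \<ge> 0" "\<Psi>1 \<ge> 0" "\<zeta> \<ge> 0"
      and \<phi>: "\<phi> = (\<xi> \<bullet> \<xi>) powr (k - p / 2) * \<Psi>"
      and d\<Psi>: "d\<Psi> = (\<Psi>1 * \<zeta>) *\<^sub>R (2 *\<^sub>R B \<xi> + (\<xi> \<bullet> \<xi>) *\<^sub>R lv)"
      and d\<phi>: "d\<phi> = ((k - p / 2) * (\<xi> \<bullet> \<xi>) powr (k - p / 2 - 1) * \<Psi>) *\<^sub>R (2 *\<^sub>R B \<xi>) + (\<xi> \<bullet> \<xi>) powr (k - p / 2) *\<^sub>R d\<Psi>"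
      and J: "J = (\<xi> \<bullet> \<xi>) powr k *\<^sub>R lv + ((p - 2) * (\<xi> \<bullet> \<xi>) powr (k - 1) * (\<xi> \<bullet> lv)) *\<^sub>R \<xi>"
    define z Z n w y \<theta> where "z = \<xi> \<bullet> \<xi>" and "Z = z powr k" and "n = norm \<xi>"
      and "w = norm \<xi> powr (p - 2)" and "y = norm \<xi> powr (q + 1 - p)" and "\<theta> = z powr (k - p / 2)"
    define H where "H = norm \<xi> powr q"
    \<comment> \<open>\<open>e\<close> is the defect in the equation written in non-divergence form;
      it vanishes if \<xi> is the gradient of a smooth solution without critical points and
      \<open>B\<close> its derivative.\<close>
    define N2 e where "N2 = hs2 B" and "e = tr (\<lambda>h. dflux p \<xi> (B h)) - H"
    have m: "m \<ge> 0"
    proof -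
      obtain b :: 'a where "b \<in> Basis" using nonempty_Basis by blast
      moreover from this have "norm (Dl b) \<le> m" using Dl(2)[rule_format, of b] by simp
      ultimately show ?thesis using norm_ge_zero[of "Dl b"] by linarith
    qed
    have n: "n > 0" "z = n * n" "z > 0"
      using \<xi> by (auto simp: n_def z_def power2_norm_eq_inner[symmetric] power2_eq_square)
    have pos: "Z > 0" "w > 0" "y > 0" "\<theta> > 0" using n \<xi> by (auto simp: Z_def w_def y_def \<theta>_def)
    have w: "w = z powr ((p - 2) / 2)" by (simp add: w_def z_def norm_powr_eq)
    have \<theta>w: "\<theta> * w = Z / z"
    proof -
      have "\<theta> * w = z powr (k - 1)" unfolding \<theta>_def w by (simp flip: powr_add add: diff_divide_distrib)
      then show ?thesis using n by (simp add: powr_diff Z_def)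
    qed
    have \<theta>1: "z powr (k - p / 2 - 1) = \<theta> / z" using n by (simp add: \<theta>_def powr_diff)
    have Zk1: "z powr (k - 1) = Z / z" using n by (simp add: Z_def powr_diff)
    have Hq2: "norm \<xi> powr (q - 2) = y * w / n"
    proof -
      have "y * w = n powr (q - 1)" by (simp add: y_def w_def n_def flip: powr_add)
      then show ?thesis using n powr_diff[of n "q - 1" 1] by (simp add: n_def)
    qed
    have H: "H = y * w * n"
    proof -
      have "y * w = n powr (q - 1)" by (simp add: y_def w_def n_def flip: powr_add)
      then show ?thesis using n powr_add[of n "q - 1" 1] by (simp add: n_def H_def)
    qed
    have y2: "z powr (q + 1 - p) = y\<^sup>2"
      by (simp add: y_def z_def norm_powr_eq power2_eq_square flip: powr_add)
    have Zw: "z powr (k + 1 - p) = Z / z / w\<^sup>2"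
    proof -
      have "z powr (k + 1 - p) * w\<^sup>2 = z powr (k - 1)"
        unfolding w by (simp add: power2_eq_square algebra_simps flip: powr_add)
      moreover have "w\<^sup>2 \<noteq> 0" using pos by simp
      ultimately show ?thesis unfolding Zk1 by (metis nonzero_eq_divide_eq)
    qed
    have N2: "N2 \<ge> 0" by (simp add: N2_def hs2_nonneg)
    have nB: "norm (B \<xi>) \<le> sqrt N2 * n" using norm_linear_le_hs2[OF B(1)] by (simp add: N2_def n_def)
    have S: "c0 * w * N2 \<le> (\<Sum>b\<in>Basis. B b \<bullet> dflux p \<xi> (B b))"
      unfolding N2_def hs2_def sum_distrib_left
      using dflux_elliptic[OF p, of \<xi>] by (intro sum_mono) (simp add: c0_def w_def inner_commute)
    have gen: "(a + t)\<^sup>2 \<le> 2 * a\<^sup>2 + 2 * t\<^sup>2" for a t :: real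
      using zero_le_power2[of "a - t"] by (simp add: power2_sum power2_diff)
    have T: "(H + e)\<^sup>2 \<le> w\<^sup>2 * (c2 * N2)"
    proof -
      have "tr (\<lambda>h. dflux p \<xi> (B h)) = w * (tr B + (p - 2) / z * (\<Sum>b\<in>Basis. (\<xi> \<bullet> B b) * (\<xi> \<bullet> b)))"
        unfolding tr_def dflux_def w_def z_def
        by (simp add: inner_add_left sum_distrib_left sum_distrib_right sum.distrib algebra_simps)
      also have "\<dots> = w * (tr B + (p - 2) * ((B \<xi> \<bullet> \<xi>) / z))"
        unfolding sum_Basis_linear[OF B(1)] by (simp add: inner_commute)
      finally have *: "H + e = w * (tr B + (p - 2) * ((B \<xi> \<bullet> \<xi>) / z))" by (simp add: e_def)
      have "\<bar>B \<xi> \<bullet> \<xi>\<bar> \<le> sqrt N2 * n * n"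
        using order_trans[OF Cauchy_Schwarz_ineq2[of "B \<xi>" \<xi>] mult_right_mono[OF nB, of "norm \<xi>"]] by (simp add: n_def)
      then have "\<bar>(B \<xi> \<bullet> \<xi>) / z\<bar> \<le> sqrt N2" using n by (simp add: field_simps)
      then have "((B \<xi> \<bullet> \<xi>) / z)\<^sup>2 \<le> N2" using abs_le_square_iff[of "(B \<xi> \<bullet> \<xi>) / z" "sqrt N2"] N2 by simp
      then have "(p - 2)\<^sup>2 * ((B \<xi> \<bullet> \<xi>) / z)\<^sup>2 \<le> (p - 2)\<^sup>2 * N2" by (intro mult_left_mono) auto
      moreover have "(tr B)\<^sup>2 \<le> real DIM('a) * N2" using tr_square_le by (simp add: N2_def)
      moreover have "(tr B + (p - 2) * ((B \<xi> \<bullet> \<xi>) / z))\<^sup>2 \<le> 2 * (tr B)\<^sup>2 + 2 * ((p - 2)\<^sup>2 * ((B \<xi> \<bullet> \<xi>) / z)\<^sup>2)"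
        using gen[of "tr B" "(p - 2) * ((B \<xi> \<bullet> \<xi>) / z)"] unfolding power_mult_distrib .
      ultimately have "(tr B + (p - 2) * ((B \<xi> \<bullet> \<xi>) / z))\<^sup>2 \<le> c2 * N2"
        by (simp add: c2_def algebra_simps)
      then show ?thesis unfolding * power_mult_distrib by (intro mult_left_mono) auto
    qed
    \<comment> \<open>The source of the absorption term: up to the defect, |\<xi>|^q is a trace
      linear in \<open>B\<close>, so \<open>hs2 B\<close> cannot be small where |\<xi>| is
      large.\<close>
    have N2y: "(y\<^sup>2 * z / 2 - e\<^sup>2 / w\<^sup>2) / c2 \<le> N2"
    proof -
      have "H\<^sup>2 \<le> 2 * (H + e)\<^sup>2 + 2 * e\<^sup>2"
        using gen[of "H + e" "- e"] by simp
      then have "H\<^sup>2 / 2 - e\<^sup>2 \<le> w\<^sup>2 * (c2 * N2)" using T by linarith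
      then have "(H\<^sup>2 / 2 - e\<^sup>2) / w\<^sup>2 \<le> c2 * N2" using pos by (simp add: field_simps)
      moreover have "(H\<^sup>2 / 2 - e\<^sup>2) / w\<^sup>2 = y\<^sup>2 * z / 2 - e\<^sup>2 / w\<^sup>2"
        unfolding H n(2) using pos by (simp add: field_simps power2_eq_square)
      ultimately have "y\<^sup>2 * z / 2 - e\<^sup>2 / w\<^sup>2 \<le> c2 * N2" by simp
      then show ?thesis using c2 by (simp only: pos_divide_le_eq mult.commute)
    qed
    \<comment> \<open>\<open>J\<close> is the linearised flux applied to \<open>lv\<close>, up to a
      scalar factor. Half of its product with \<open>d\<Psi>\<close> therefore supplies the part of
      \<open>dflux p \<xi> v\<close> that the gradient of \<phi> alone does not give.\<close>
    have aJ: "J = \<theta> *\<^sub>R (z *\<^sub>R dflux p \<xi> lv)"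
    proof -
      have "J = Z *\<^sub>R (lv + ((p - 2) * (\<xi> \<bullet> lv) / z) *\<^sub>R \<xi>)"
        unfolding J z_def[symmetric] Zk1 Z_def[symmetric] by (simp add: scaleR_add_right mult_ac)
      moreover have "\<theta> * z * w = Z" using \<theta>w n by (simp add: field_simps)
      ultimately show ?thesis by (simp add: dflux_def w_def[symmetric] z_def[symmetric])
    qed
    define v where "v = 2 *\<^sub>R B \<xi> + z *\<^sub>R lv"
    have I: "\<theta> * (\<Psi>1 * \<zeta>) * (dflux p \<xi> v \<bullet> v) \<ge> 0"
    proof -
      have "0 \<le> c0 * w * (v \<bullet> v)" using c0 pos by simp
      also have "\<dots> \<le> dflux p \<xi> v \<bullet> v" using dflux_elliptic[OF p] by (simp add: c0_def w_def)
      finally show ?thesis using pos \<Psi> by simp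
    qed
    have dv: "dflux p \<xi> v = 2 *\<^sub>R dflux p \<xi> (B \<xi>) + z *\<^sub>R dflux p \<xi> lv"
      unfolding v_def using linear_add[OF linear_dflux] linear_cmul[OF linear_dflux] by metis
    have grad_part: "dflux p \<xi> (B \<xi>) \<bullet> d\<phi> + (1 / 2) * (J \<bullet> d\<Psi>)
        \<ge> 2 * c0 * k0 * (\<Psi> * (Z / z) * ((B \<xi> \<bullet> B \<xi>) / z))"
    proof -
      have "dflux p \<xi> (B \<xi>) \<bullet> d\<phi> + (1 / 2) * (J \<bullet> d\<Psi>)
          = 2 * k0 * (\<theta> / z) * \<Psi> * (dflux p \<xi> (B \<xi>) \<bullet> B \<xi>)
            + (1 / 2) * (\<theta> * (\<Psi>1 * \<zeta>) * (dflux p \<xi> v \<bullet> v))"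
        unfolding d\<phi> d\<Psi> aJ z_def[symmetric] \<theta>1 \<theta>_def[symmetric] v_def[symmetric] dv
        by (simp add: inner_add_left inner_add_right k_def algebra_simps)
      moreover have "2 * k0 * (\<theta> / z) * \<Psi> * (c0 * w * (B \<xi> \<bullet> B \<xi>))
          \<le> 2 * k0 * (\<theta> / z) * \<Psi> * (dflux p \<xi> (B \<xi>) \<bullet> B \<xi>)"
        using dflux_elliptic[OF p, of \<xi> "B \<xi>"] k0 pos n \<Psi>
        by (intro mult_left_mono) (auto simp: c0_def w_def)
      moreover have "2 * k0 * (\<theta> / z) * \<Psi> * (c0 * w * (B \<xi> \<bullet> B \<xi>))
          = 2 * c0 * k0 * (\<Psi> * (\<theta> * w) * ((B \<xi> \<bullet> B \<xi>) / z))" by simp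
      ultimately show ?thesis using I unfolding \<theta>w by linarith
    qed
    define \<beta> where "\<beta> = norm (B \<xi>)"
    have ham_part: "\<phi> * (q * norm \<xi> powr (q - 2) * (B \<xi> \<bullet> \<xi>)) \<ge> - (\<Psi> * (Z / z) * (q * y * \<beta>))"
    proof -
      have "- (\<beta> * n) \<le> B \<xi> \<bullet> \<xi>"
        using Cauchy_Schwarz_ineq2[of "B \<xi>" \<xi>] by (simp add: \<beta>_def n_def)
      then have "(\<theta> * \<Psi> * (q * (y * w / n))) * (- (\<beta> * n)) \<le> (\<theta> * \<Psi> * (q * (y * w / n))) * (B \<xi> \<bullet> \<xi>)"
        using pos n \<Psi> q0 by (intro mult_left_mono) auto
      moreover have "(\<theta> * \<Psi> * (q * (y * w / n))) * (- (\<beta> * n)) = - (\<Psi> * (\<theta> * w) * (q * y * \<beta>))"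
        using n by simp
      ultimately show ?thesis unfolding Hq2 \<phi> z_def[symmetric] \<theta>_def[symmetric] \<theta>w by (simp add: mult_ac)
    qed
    have trace_part: "\<phi> * (\<Sum>b\<in>Basis. B b \<bullet> dflux p \<xi> (B b)) \<ge> \<Psi> * (Z / z) * (c0 * N2)"
    proof -
      have "(\<theta> * \<Psi>) * (c0 * w * N2) \<le> (\<theta> * \<Psi>) * (\<Sum>b\<in>Basis. B b \<bullet> dflux p \<xi> (B b))"
        using S pos \<Psi> by (intro mult_left_mono) auto
      moreover have "(\<theta> * \<Psi>) * (c0 * w * N2) = \<Psi> * (\<theta> * w) * (c0 * N2)" by simp
      ultimately show ?thesis unfolding \<phi> z_def[symmetric] \<theta>_def[symmetric] \<theta>w by simp
    qed
    define l where "l = norm lv"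
    have div_part: "\<Psi> * divJ p k \<xi> B lv Dl \<ge> - (\<Psi> * Z * (C3 * (sqrt N2 * l / n) + C4 * m))"
    proof -
      have "\<bar>divJ p k \<xi> B lv Dl\<bar> \<le> Z * (C3 * (sqrt N2 * l / n) + C4 * m)"
        using divJ_bound[OF \<xi> B(1) Dl(1), of m p k lv] Dl(2)
        unfolding z_def[symmetric] Z_def[symmetric] n_def[symmetric] l_def[symmetric] N2_def[symmetric]
          C3_def[symmetric] C4_def[symmetric] by blast
      then have "\<Psi> * (- (Z * (C3 * (sqrt N2 * l / n) + C4 * m))) \<le> \<Psi> * divJ p k \<xi> B lv Dl"
        using \<Psi> by (intro mult_left_mono) auto
      then show ?thesis by simp
    qed
    \<comment> \<open>The square of \<beta> on the right is the one produced by differentiating the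
      power of z in \<phi>; it is spent completely here.\<close>
    have young1: "q * y * \<beta> \<le> 2 * c0 * k0 * (\<beta>\<^sup>2 / z) + c0 / (8 * c2) * (y\<^sup>2 * z)"
    proof -
      have "0 \<le> 2 * c0 * k0 * (\<beta> / n - q * y * n / (4 * c0 * k0))\<^sup>2" using c0 k0 by simp
      also have "\<dots> = 2 * c0 * k0 * (\<beta>\<^sup>2 / z) - q * y * \<beta> + q\<^sup>2 / (8 * c0 * k0) * (y\<^sup>2 * z)"
        using c0 k0 n by (simp add: power2_diff field_simps power2_eq_square)
      also have "q\<^sup>2 / (8 * c0 * k0) = c0 / (8 * c2)"
        using c0 c2 q0 by (simp add: k0_def field_simps power2_eq_square)
      finally show ?thesis by simp
    qed
    have young2: "(1 / 2) * (C3 * (sqrt N2 * l / n)) \<le> (1 / 2) * (c0 * N2 / z) + C3\<^sup>2 / (8 * c0) * l\<^sup>2"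
    proof -
      have "0 \<le> (1 / 2) * c0 * (sqrt N2 / n - C3 * l / (2 * c0))\<^sup>2" using c0 by simp
      also have "\<dots> = (1 / 2) * (c0 * (sqrt N2)\<^sup>2 / z) - (1 / 2) * (C3 * (sqrt N2 * l / n)) + C3\<^sup>2 / (8 * c0) * l\<^sup>2"
        using c0 n by (simp add: power2_diff field_simps power2_eq_square)
      finally show ?thesis using N2 by simp
    qed
    have core: "\<Psi> * Z * (c0 / (8 * c2) * y\<^sup>2 - C * (l\<^sup>2 + m))
      \<le> \<Psi> * (Z / z) * (c0 * N2) + 2 * c0 * k0 * (\<Psi> * (Z / z) * (\<beta>\<^sup>2 / z)) - \<Psi> * (Z / z) * (q * y * \<beta>)
        - (1 / 2) * (\<Psi> * Z * (C3 * (sqrt N2 * l / n) + C4 * m)) + C * (\<Psi> * (Z / z / w\<^sup>2)) * e\<^sup>2"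
    proof -
      have "c0 / (8 * c2) * y\<^sup>2 - C * (l\<^sup>2 + m) \<le> (1 / z) * (c0 * N2) + 2 * c0 * k0 * ((1 / z) * (\<beta>\<^sup>2 / z))
          - (1 / z) * (q * y * \<beta>) - (1 / 2) * (C3 * (sqrt N2 * l / n) + C4 * m) + C * ((1 / z) / w\<^sup>2) * e\<^sup>2"
      proof -
        have "(1 / z) * (q * y * \<beta>) \<le> (1 / z) * (2 * c0 * k0 * (\<beta>\<^sup>2 / z) + c0 / (8 * c2) * (y\<^sup>2 * z))"
          using young1 n by (intro mult_left_mono) auto
        also have "\<dots> = 2 * c0 * k0 * ((1 / z) * (\<beta>\<^sup>2 / z)) + c0 / (8 * c2) * y\<^sup>2"
          using n by (simp add: field_simps)
        finally have 1: "(1 / z) * (q * y * \<beta>) \<le> 2 * c0 * k0 * ((1 / z) * (\<beta>\<^sup>2 / z)) + c0 / (8 * c2) * y\<^sup>2" .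
        \<comment> \<open>Half of the good term c0 N2 / z yields twice c0 / (8 c2) y^2: one copy
          pays for \<open>young1\<close>, the other stays in the conclusion. The second half of the
          good term is left for \<open>young2\<close>.\<close>
        have "(c0 / (2 * z)) * ((y\<^sup>2 * z / 2 - e\<^sup>2 / w\<^sup>2) / c2) \<le> (c0 / (2 * z)) * N2"
          using N2y n c0 by (intro mult_left_mono) auto
        moreover have "(c0 / (2 * z)) * ((y\<^sup>2 * z / 2 - e\<^sup>2 / w\<^sup>2) / c2) =
            2 * (c0 / (8 * c2) * y\<^sup>2) - c0 / (2 * c2) * ((1 / z) / w\<^sup>2) * e\<^sup>2"
          using n c2 pos by (simp add: field_simps)
        moreover have "c0 / (2 * c2) * (((1 / z) / w\<^sup>2) * e\<^sup>2) \<le> C * (((1 / z) / w\<^sup>2) * e\<^sup>2)"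
          using n C4 c0 by (intro mult_right_mono) (auto simp: C_def)
        ultimately have 2: "2 * (c0 / (8 * c2) * y\<^sup>2) \<le> (1 / 2) * (c0 * N2 / z) + C * ((1 / z) / w\<^sup>2) * e\<^sup>2"
          by (simp add: field_simps)
        have 3: "C3\<^sup>2 / (8 * c0) * l\<^sup>2 \<le> C * l\<^sup>2"
          using c0 c2 C4 by (intro mult_right_mono) (auto simp: C_def)
        have 4: "(1 / 2) * (C4 * m) \<le> C * m"
        proof -
          have "C4 * m \<le> C * m" using c0 c2 m by (intro mult_right_mono) (auto simp: C_def)
          moreover have "0 \<le> C4 * m" using C4 m by simp
          ultimately show ?thesis by linarith
        qed
        have 5: "C * (l\<^sup>2 + m) = C * l\<^sup>2 + C * m" by (simp add: distrib_left)
        have 6: "(1 / z) * (c0 * N2) = (1 / 2) * (c0 * N2 / z) + (1 / 2) * (c0 * N2 / z)" by simp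
        have 7: "(1 / 2) * (C3 * (sqrt N2 * l / n) + C4 * m) = (1 / 2) * (C3 * (sqrt N2 * l / n)) + (1 / 2) * (C4 * m)"
          by (simp add: distrib_left)
        show ?thesis using 1 2 3 4 young2 unfolding 5 6 7 by linarith
      qed
      from mult_left_mono[OF this, of "\<Psi> * Z"] show ?thesis
        using \<Psi> pos by (simp add: algebra_simps)
    qed
    define err where "err = \<phi> * (\<Sum>b\<in>Basis. B b \<bullet> (L b - dflux p \<xi> (B b))) + (L \<xi> - dflux p \<xi> (B \<xi>)) \<bullet> d\<phi>
          + (norm \<xi> powr q - tr L) * (\<phi> * tr B + \<xi> \<bullet> d\<phi>)"
    have split: "(\<phi> * (\<Sum>b\<in>Basis. B b \<bullet> L b) + L \<xi> \<bullet> d\<phi> - tr L * (\<phi> * tr B + \<xi> \<bullet> d\<phi>))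
      + (norm \<xi> powr q * (\<phi> * tr B + \<xi> \<bullet> d\<phi>) + \<phi> * (q * norm \<xi> powr (q - 2) * (B \<xi> \<bullet> \<xi>)))
      = \<phi> * (\<Sum>b\<in>Basis. B b \<bullet> dflux p \<xi> (B b)) + dflux p \<xi> (B \<xi>) \<bullet> d\<phi>
        + \<phi> * (q * norm \<xi> powr (q - 2) * (B \<xi> \<bullet> \<xi>)) + err"
      unfolding err_def by (simp add: inner_diff_left inner_diff_right sum_subtractf algebra_simps)
    have \<beta>2: "B \<xi> \<bullet> B \<xi> = \<beta>\<^sup>2" by (simp add: \<beta>_def power2_norm_eq_inner)
    have l2: "lv \<bullet> lv = l\<^sup>2" by (simp add: l_def power2_norm_eq_inner)
    have combine: "S \<le> t + x + h + e1 + (1 / 2) * (j + d) + a + E"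
      if "- e1 \<le> a" "S \<le> A + G - h' - (1 / 2) * D + E" "G \<le> x + (1 / 2) * j" "- h' \<le> h" "A \<le> t" "- D \<le> d"
      for S t x h e1 j d a E A G h' D :: real
      using that by (simp add: field_simps)
    have "- err \<le> \<bar>err\<bar>" by simp
    then show "\<Psi> * (\<xi> \<bullet> \<xi>) powr k * (c0 / (8 * c2) * (\<xi> \<bullet> \<xi>) powr (q + 1 - p) - C * (lv \<bullet> lv + m))
    \<le> (\<phi> * (\<Sum>b\<in>Basis. B b \<bullet> L b) + L \<xi> \<bullet> d\<phi> - tr L * (\<phi> * tr B + \<xi> \<bullet> d\<phi>))
      + (norm \<xi> powr q * (\<phi> * tr B + \<xi> \<bullet> d\<phi>) + \<phi> * (q * norm \<xi> powr (q - 2) * (B \<xi> \<bullet> \<xi>)))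
      + (1 / 2) * (J \<bullet> d\<Psi> + \<Psi> * divJ p k \<xi> B lv Dl)
      + \<bar>\<phi> * (\<Sum>b\<in>Basis. B b \<bullet> (L b - dflux p \<xi> (B b))) + (L \<xi> - dflux p \<xi> (B \<xi>)) \<bullet> d\<phi>
          + (norm \<xi> powr q - tr L) * (\<phi> * tr B + \<xi> \<bullet> d\<phi>)\<bar>
      + C * (\<Psi> * (\<xi> \<bullet> \<xi>) powr (k + 1 - p)) * (tr (\<lambda>h. dflux p \<xi> (B h)) - norm \<xi> powr q)\<^sup>2"
      using core grad_part ham_part trace_part div_part
      unfolding split
      unfolding err_def[symmetric]
      unfolding z_def[symmetric] Zw y2 Z_def[symmetric] l2 \<beta>2 H_def[symmetric] e_def[symmetric]
      by (rule combine)
  qed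
qed

section \<open>Mollifiers\<close>

lemma LINT_scaling:
  fixes f :: "'a::euclidean_space \<Rightarrow> real"
  assumes "f \<in> borel_measurable borel" "c > 0"
  shows "integral\<^sup>L lborel f = c ^ DIM('a) * (\<integral>x. f (c *\<^sub>R x) \<partial>lborel)"
proof -
  have "integral\<^sup>L lborel f
      = integral\<^sup>L (density (distr lborel borel (\<lambda>x::'a. 0 + c *\<^sub>R x)) (\<lambda>_. \<bar>c\<bar> ^ DIM('a))) f"
    using lborel_affine[of c "0::'a"] assms by simp
  also have "\<dots> = integral\<^sup>L (distr lborel borel (\<lambda>x::'a. 0 + c *\<^sub>R x)) (\<lambda>x. \<bar>c\<bar> ^ DIM('a) *\<^sub>R f x)"
    using assms by (subst integral_density[symmetric]) auto
  also have "\<dots> = (\<integral>x. \<bar>c\<bar> ^ DIM('a) *\<^sub>R f (0 + c *\<^sub>R x) \<partial>lborel)"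
    using assms by (subst integral_distr) auto
  finally show ?thesis using assms by simp
qed

lemma set_LINT_ge_cball:
  fixes f :: "'a::euclidean_space \<Rightarrow> real"
  assumes "compact K" "continuous_on K f" "\<And>x. x \<in> K \<Longrightarrow> f x \<ge> 0"
    and "cball a r \<subseteq> K" "\<And>x. x \<in> cball a r \<Longrightarrow> f x \<ge> c"
  shows "c * measure lborel (cball a r) \<le> (LINT x:K|lborel. f x)"
proof -
  have "c * measure lborel (cball a r) = (LINT x:cball a r|lborel. c)"
    using emeasure_compact_finite[OF compact_cball, of a r] by (subst set_integral_const) auto
  also have "\<dots> \<le> (LINT x:cball a r|lborel. f x)"
    using assms(5) continuous_on_subset[OF assms(2,4)]
    by (intro set_integral_mono set_integrable_continuous) auto
  also have "\<dots> \<le> (LINT x:K|lborel. f x)"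
    using assms by (intro set_LINT_mono_set) auto
  finally show ?thesis .
qed

text \<open>No sign or mass is required, so that partial derivatives of a mollifier are kernels
  again and each statement on convolutions also holds for the differentiated ones.\<close>

definition kernel :: "real \<Rightarrow> (real ^ 'n \<Rightarrow> real) \<Rightarrow> bool"
  where "kernel e k \<longleftrightarrow> smooth k \<and> (\<forall>z. z \<notin> cball 0 e \<longrightarrow> k z = 0)"

lemma kernelD:
  assumes "kernel e k"
  shows "smooth k" "GDERIV k z :> grad k z" "continuous_on UNIV k" "continuous_on UNIV (grad k)"
    "z \<notin> cball 0 e \<Longrightarrow> k z = 0"
  using assms smooth_GDERIV[of k] smooth_continuous[of k] smooth_grad_continuous[of k]
  unfolding kernel_def by simp_all

lemma kernel_partial:
  assumes "kernel e k" "b \<in> Basis"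
  shows "kernel e (\<lambda>z. grad k z \<bullet> b)"
  using assms grad_zero_off_closed[OF closed_cball, of 0 e k] smooth_grad_inner unfolding kernel_def by auto

lemma conv_kernel_has_derivative:
  fixes f :: "real ^ 'n \<Rightarrow> 'b::euclidean_space"
  assumes "kernel e k" "continuous_on UNIV f"
  shows "(conv k f has_derivative (\<lambda>h. \<Sum>b\<in>Basis. (h \<bullet> b) *\<^sub>R conv (\<lambda>z. grad k z \<bullet> b) f x)) (at x)"
  by (rule conv_has_derivative[where e = e]) (use assms in \<open>auto intro: kernelD simp: kernelD(5)\<close>)

lemma conv_kernel_continuous:
  fixes f :: "real ^ 'n \<Rightarrow> 'b::euclidean_space"
  assumes "kernel e k" "continuous_on UNIV f"
  shows "continuous_on S (conv k f)"
  using has_derivative_continuous[OF conv_kernel_has_derivative[OF assms]]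
  by (meson continuous_at_imp_continuous_on)

text \<open>Uniform continuity with only one of the two points confined to \<open>S\<close>; the
  other one is caught by the enlargement \<open>T\<close> of \<open>S\<close> by the unit
  ball.\<close>

lemma uniformly_close_on_compact:
  fixes f :: "'a::euclidean_space \<Rightarrow> 'b::metric_space"
  assumes f: "continuous_on UNIV f" and S: "compact S" and "\<tau> > 0"
  obtains d where "d > 0" "\<And>x y. x \<in> S \<Longrightarrow> dist x y < d \<Longrightarrow> dist (f y) (f x) < \<tau>"
proof -
  define T where "T = {x + y |x y. x \<in> S \<and> y \<in> cball 0 1}"
  have "compact T" unfolding T_def using compact_sums[OF S compact_cball] by blast
  then have "uniformly_continuous_on T f"
    by (rule compact_uniformly_continuous[OF continuous_on_subset[OF f subset_UNIV]])
  then obtain d where d: "d > 0" "\<And>x y. x \<in> T \<Longrightarrow> y \<in> T \<Longrightarrow> dist y x < d \<Longrightarrow> dist (f y) (f x) < \<tau>"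
    using \<open>\<tau> > 0\<close> unfolding uniformly_continuous_on_def by metis
  have T: "y \<in> T" if "x \<in> S" "dist x y \<le> 1" for x y
    unfolding T_def using that by (intro CollectI exI[of _ x] exI[of _ "y - x"]) (auto simp: dist_norm norm_minus_commute)
  show ?thesis
  proof (rule that[of "min d 1"])
    fix x y assume "x \<in> S" "dist x y < min d 1"
    then show "dist (f y) (f x) < \<tau>" using T[of x x] T[of x y] d(2)[of x y] by (simp add: dist_commute)
  qed (use d in auto)
qed

definition bump_mass :: "'n::finite itself \<Rightarrow> real"
  where "bump_mass _ = integral\<^sup>L lborel (bump0 :: real ^ 'n \<Rightarrow> real)"

lemma bump_mass_pos: "bump_mass TYPE('n::finite) > 0"
proof -
  have c: "continuous_on UNIV (bump0 :: real ^ 'n \<Rightarrow> real)"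
    using smooth_continuous[OF smooth_bump0] .
  obtain d where d: "d > 0"
    "\<And>x y :: real ^ 'n. x \<in> {0} \<Longrightarrow> dist x y < d \<Longrightarrow> dist (bump0 y) (bump0 x) < bump0 (0 :: real ^ 'n) / 2"
    by (rule uniformly_close_on_compact[OF c, of "{0}" "bump0 (0 :: real ^ 'n) / 2"])
      (use bump0_pos[where 'a = 'n] in auto)
  define r where "r = d / 2"
  have r: "r > 0" using d by (simp add: r_def)
  have r2: "bump0 x \<ge> bump0 (0 :: real ^ 'n) / 2" if "x \<in> cball 0 r" for x :: "real ^ 'n"
  proof -
    have "dist 0 x < d" using that d(1) by (simp add: r_def)
    from d(2)[OF _ this] show ?thesis by (simp add: dist_real_def abs_if split: if_splits)
  qed
  have "0 < bump0 (0 :: real ^ 'n) / 2 * measure lborel (cball (0 :: real ^ 'n) r)"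
    using bump0_pos[where 'a = 'n] r by (intro mult_pos_pos) auto
  also have "\<dots> \<le> (LINT x:cball (0 :: real ^ 'n) (max 1 r)|lborel. bump0 x)"
    by (rule set_LINT_ge_cball) (use r r2 bump0_nonneg in \<open>auto intro: continuous_on_subset[OF c]\<close>)
  also have "\<dots> = bump_mass TYPE('n)"
    unfolding bump_mass_def by (rule LINT_eq_set_LINT[symmetric]) (auto intro!: bump0_zero)
  finally show ?thesis .
qed

text \<open>The argument is written with the summand 0 to match the shape of
  \<open>smooth_affine\<close>.\<close>

definition mollifier :: "real \<Rightarrow> real ^ 'n \<Rightarrow> real"
  where "mollifier e z = 1 / (bump_mass TYPE('n) * e ^ CARD('n)) * bump0 (0 + (1 / e) *\<^sub>R z)"

lemma mollifier_kernel: "e > 0 \<Longrightarrow> kernel e (mollifier e :: real ^ 'n \<Rightarrow> real)"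
  unfolding kernel_def mollifier_def[abs_def]
proof (intro conjI smooth_affine smooth_bump0 allI impI)
  fix z :: "real ^ 'n" assume "e > 0" "z \<notin> cball 0 e"
  then have "bump0 (0 + (1 / e) *\<^sub>R z) = 0" by (intro bump0_zero) (simp add: field_simps)
  then show "1 / (bump_mass TYPE('n) * e ^ CARD('n)) * bump0 (0 + (1 / e) *\<^sub>R z) = 0" by simp
qed

lemma mollifier_nonneg: "e > 0 \<Longrightarrow> mollifier e (z :: real ^ 'n) \<ge> 0"
  unfolding mollifier_def using bump_mass_pos[where 'n = 'n] by (intro mult_nonneg_nonneg bump0_nonneg) auto

lemma mollifier_integral: "e > 0 \<Longrightarrow> (LINT z:cball 0 e|lborel. mollifier e (z :: real ^ 'n)) = 1"
proof -
  assume e: "e > 0"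
  have c: "continuous_on UNIV (mollifier e :: real ^ 'n \<Rightarrow> real)"
    by (rule kernelD(3)[OF mollifier_kernel[OF e]])
  have "(LINT z:cball 0 e|lborel. mollifier e (z :: real ^ 'n)) = integral\<^sup>L lborel (mollifier e :: real ^ 'n \<Rightarrow> real)"
    by (rule LINT_eq_set_LINT[symmetric]) (rule kernelD(5)[OF mollifier_kernel[OF e]])
  also have "\<dots> = e ^ CARD('n) * (\<integral>x. mollifier e (e *\<^sub>R (x :: real ^ 'n)) \<partial>lborel)"
    using LINT_scaling[OF borel_measurable_continuous_onI[OF c] e] by simp
  also have "\<dots> = 1"
    using e bump_mass_pos[where 'n = 'n] unfolding mollifier_def by (simp add: bump_mass_def)
  finally show ?thesis .
qed

text \<open>The constant must not depend on \<open>e\<close>. Of the exponent,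
  \<open>CARD('n)\<close> comes from the normalisation and 1 from the chain rule.\<close>

lemma mollifier_grad_bound:
  obtains C where "C > 0" "\<And>e (z :: real ^ 'n) b. e > 0 \<Longrightarrow> b \<in> Basis \<Longrightarrow>
    \<bar>grad (mollifier e) z \<bullet> b\<bar> \<le> C / e ^ (CARD('n) + 1)"
proof -
  have "compact ((\<lambda>z :: real ^ 'n. norm (grad bump0 z)) ` cball 0 1)"
    by (intro compact_continuous_image continuous_intros continuous_on_subset[OF smooth_grad_continuous[OF smooth_bump0]]) auto
  then obtain C where C: "C > 0" "\<And>z :: real ^ 'n. z \<in> cball 0 1 \<Longrightarrow> norm (grad bump0 z) \<le> C"
    using compact_imp_bounded[of "(\<lambda>z :: real ^ 'n. norm (grad bump0 z)) ` cball 0 1"]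
    unfolding bounded_pos by auto
  have C': "norm (grad bump0 z) \<le> C" for z :: "real ^ 'n"
  proof (cases "z \<in> cball 0 1")
    case False
    then have "grad bump0 z = 0"
      by (intro grad_zero_off_closed[of "cball 0 1"] bump0_zero) auto
    then show ?thesis using C by simp
  qed (rule C)
  have m: "bump_mass TYPE('n) > 0" by (rule bump_mass_pos)
  show ?thesis
  proof (rule that[of "C / bump_mass TYPE('n)"])
    show "C / bump_mass TYPE('n) > 0" using C m by simp
    fix e :: real and z b :: "real ^ 'n" assume e: "e > 0" and b: "b \<in> Basis"
    let ?c = "1 / (bump_mass TYPE('n) * e ^ CARD('n))"
    have "((\<lambda>z. bump0 (0 + (1 / e) *\<^sub>R z)) has_derivative (\<lambda>h. ((1 / e) *\<^sub>R h) \<bullet> grad bump0 (0 + (1 / e) *\<^sub>R z))) (at z)"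
    proof (rule has_derivative_compose[of "\<lambda>z. 0 + (1 / e) *\<^sub>R z" "\<lambda>h. (1 / e) *\<^sub>R h"])
      show "((\<lambda>z. 0 + (1 / e) *\<^sub>R z) has_derivative (\<lambda>h. (1 / e) *\<^sub>R h)) (at z)"
        by (auto intro!: derivative_eq_intros)
    qed (use smooth_GDERIV[OF smooth_bump0] in \<open>simp add: gderiv_def\<close>)
    then have "GDERIV (mollifier e) z :> (?c * (1 / e)) *\<^sub>R grad bump0 (0 + (1 / e) *\<^sub>R z)"
      unfolding gderiv_def mollifier_def[abs_def]
      by (rule has_derivative_eq_rhs[OF has_derivative_mult_right]) (auto simp: fun_eq_iff)
    then have "grad (mollifier e) z = (?c * (1 / e)) *\<^sub>R grad bump0 (0 + (1 / e) *\<^sub>R z)" by (rule grad_eq)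
    then have "\<bar>grad (mollifier e) z \<bullet> b\<bar> = ?c * (1 / e) * \<bar>grad bump0 (0 + (1 / e) *\<^sub>R z) \<bullet> b\<bar>"
      using e m by (simp add: abs_mult)
    also have "\<dots> \<le> ?c * (1 / e) * C"
      using Basis_le_norm[OF b] C' e m by (intro mult_left_mono) (auto intro: order_trans)
    also have "\<dots> = C / bump_mass TYPE('n) / e ^ (CARD('n) + 1)" by simp
    finally show "\<bar>grad (mollifier e) z \<bullet> b\<bar> \<le> C / bump_mass TYPE('n) / e ^ (CARD('n) + 1)" .
  qed
qed

lemma conv_mollifier_diff:
  fixes f :: "real ^ 'n \<Rightarrow> 'b::euclidean_space"
  assumes e: "e > 0" and f: "continuous_on UNIV f"
    and d: "\<And>y. y \<in> cball 0 e \<Longrightarrow> norm (f (x - y) - a) \<le> \<tau>"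
  shows "norm (conv (mollifier e) f x - a) \<le> \<tau>"
proof -
  note k = mollifier_kernel[OF e, where 'n = 'n]
  have cm: "continuous_on (cball 0 e) (mollifier e :: real ^ 'n \<Rightarrow> real)"
    using kernelD(3)[OF k] continuous_on_subset by blast
  have cf: "continuous_on (cball 0 e) (\<lambda>y. f (x - y))"
    by (rule continuous_on_compose2[OF f]) (auto intro!: continuous_intros)
  have m1: "(LINT y:cball 0 e|lborel. mollifier e (y :: real ^ 'n) *\<^sub>R a) = a"
    using mollifier_integral[OF e, where 'n = 'n] set_integrable_continuous[OF compact_cball cm]
      integral_scaleR_left[of a lborel "\<lambda>y. indicator (cball 0 e) y *\<^sub>R mollifier e (y :: real ^ 'n)"]
    by (simp add: set_lebesgue_integral_def set_integrable_def)
  have "conv (mollifier e) f x - a = (LINT y:cball 0 e|lborel. mollifier e y *\<^sub>R f (x - y))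
      - (LINT y:cball 0 e|lborel. mollifier e (y :: real ^ 'n) *\<^sub>R a)"
    using conv_alt[OF kernelD(3,5)[OF k] f] by (simp add: m1)
  also have "\<dots> = (LINT y:cball 0 e|lborel. mollifier e y *\<^sub>R (f (x - y) - a))"
    using cm cf by (subst set_integral_diff(2)[symmetric])
      (auto intro!: set_integrable_continuous continuous_intros simp: scaleR_diff_right)
  also have "norm \<dots> \<le> (LINT y:cball 0 e|lborel. mollifier e (y :: real ^ 'n) * \<tau>)"
    unfolding set_lebesgue_integral_def
  proof (rule order_trans[OF integral_norm_bound], rule integral_mono)
    show "integrable lborel (\<lambda>y. norm (indicat_real (cball 0 e) y *\<^sub>R mollifier e y *\<^sub>R (f (x - y) - a)))"
      using cm cf by (intro integrable_norm borel_integrable_compact continuous_intros) auto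
    show "integrable lborel (\<lambda>y. indicat_real (cball 0 e) y *\<^sub>R (mollifier e (y :: real ^ 'n) * \<tau>))"
      using cm by (intro borel_integrable_compact continuous_intros) auto
    show "norm (indicat_real (cball 0 e) y *\<^sub>R mollifier e y *\<^sub>R (f (x - y) - a))
        \<le> indicat_real (cball 0 e) y *\<^sub>R (mollifier e y * \<tau>)" for y
      using d[of y] mollifier_nonneg[OF e, of y] by (auto simp: indicator_def intro: mult_left_mono)
  qed
  also have "\<dots> = \<tau>" using mollifier_integral[OF e, where 'n = 'n] by simp
  finally show ?thesis .
qed

lemma conv_mollifier_approx:
  fixes f :: "real ^ 'n \<Rightarrow> 'b::euclidean_space"
  assumes f: "continuous_on UNIV f" and S: "compact S" and "\<tau> > 0"
  obtains d where "d > 0" "\<And>e x. 0 < e \<Longrightarrow> e < d \<Longrightarrow> x \<in> S \<Longrightarrow> norm (conv (mollifier e) f x - f x) \<le> \<tau>"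
proof -
  obtain d where d: "d > 0" "\<And>x y. x \<in> S \<Longrightarrow> dist x y < d \<Longrightarrow> dist (f y) (f x) < \<tau>"
    using uniformly_close_on_compact[OF assms] by blast
  show ?thesis
  proof (rule that[OF \<open>d > 0\<close>])
    fix e x assume e: "0 < e" "e < d" "x \<in> S"
    show "norm (conv (mollifier e) f x - f x) \<le> \<tau>"
    proof (rule conv_mollifier_diff[OF e(1) f])
      fix y :: "real ^ 'n" assume "y \<in> cball 0 e"
      then have "dist x (x - y) < d" using e by (simp add: dist_norm)
      from d(2)[OF e(3) this] show "norm (f (x - y) - f x) \<le> \<tau>" by (simp add: dist_norm)
    qed
  qed
qed

section \<open>Mollified equations\<close>

text \<open>\<open>g\<close> is a continuous extension of the gradient of \<open>u\<close> from the
  ball to the whole space, so convolutions of \<open>g\<close> and of its flux are defined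
  everywhere without cut-offs. The equation is known in the ball only; a convolution inherits it at
  \<open>x\<close> as long as the support of the kernel, moved to \<open>x\<close>, stays in the
  ball.\<close>

locale hamilton_jacobi =
  fixes p q :: real and u :: "real ^ 'n \<Rightarrow> real" and g :: "real ^ 'n \<Rightarrow> real ^ 'n"
    and x0 :: "real ^ 'n" and R :: real
  assumes p1: "p > 1" and qp: "q > p - 1" and R0: "R > 0"
    and g_cont: "continuous_on UNIV g"
    and u_der: "\<And>x. x \<in> ball x0 R \<Longrightarrow> GDERIV u x :> g x"
    and weak: "\<And>\<phi> S. smooth \<phi> \<Longrightarrow> compact S \<Longrightarrow> S \<subseteq> ball x0 R \<Longrightarrow> (\<And>x. x \<notin> S \<Longrightarrow> \<phi> x = 0) \<Longrightarrow>
      (LINT x:S|lborel. flux p (g x) \<bullet> grad \<phi> x) + (LINT x:S|lborel. norm (g x) powr q * \<phi> x) = 0"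
begin

abbreviation F :: "real ^ 'n \<Rightarrow> real ^ 'n" where "F \<equiv> \<lambda>x. flux p (g x)"
abbreviation H :: "real ^ 'n \<Rightarrow> real" where "H \<equiv> \<lambda>x. norm (g x) powr q"

lemma q0: "q > 0" using p1 qp by simp

lemma F_cont: "continuous_on S F"
  using continuous_on_compose2[OF flux_continuous[OF p1] continuous_on_subset[OF g_cont subset_UNIV]] by blast

lemma H_cont: "continuous_on S H"
  using continuous_on_subset[OF g_cont subset_UNIV] q0
  by (intro continuous_on_powr' continuous_intros) auto

text \<open>This is the weak equation tested with \<open>y \<mapsto> k (x - y)\<close>.\<close>

lemma conv_flux_div:
  assumes k: "kernel e k" and x: "cball x e \<subseteq> ball x0 R"
  shows "(\<Sum>b\<in>Basis. conv (\<lambda>z. grad k z \<bullet> b) F x \<bullet> b) = conv k H x"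
proof -
  define \<phi> where "\<phi> y = 1 * k (x + (-1) *\<^sub>R y)" for y
  have sm: "smooth \<phi>" unfolding \<phi>_def[abs_def] by (intro smooth_affine kernelD(1)[OF k])
  have g\<phi>: "grad \<phi> y = - grad k (x - y)" for y
  proof -
    have "((\<lambda>y. k (x - y)) has_derivative (\<lambda>h. (- h) \<bullet> grad k (x - y))) (at y)"
    proof (rule has_derivative_compose[of "\<lambda>y. x - y" "\<lambda>h. - h"])
      show "((\<lambda>y. x - y) has_derivative (\<lambda>h. - h)) (at y)" by (auto intro!: derivative_eq_intros)
    qed (use kernelD(2)[OF k] in \<open>simp add: gderiv_def\<close>)
    then have "GDERIV \<phi> y :> - grad k (x - y)" by (simp add: gderiv_def \<phi>_def[abs_def])
    then show ?thesis by (rule grad_eq)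
  qed
  have gk0: "grad k z = 0" if "z \<notin> cball 0 e" for z
    by (rule grad_zero_off_closed[of "cball 0 e"]) (use kernelD(5)[OF k] that in auto)
  have \<phi>0: "\<phi> y = 0" if "y \<notin> cball x e" for y
    using kernelD(5)[OF k, of "x - y"] that by (simp add: \<phi>_def dist_norm norm_minus_commute)
  have c: "continuous_on UNIV (\<lambda>z. grad k z \<bullet> b)" for b
    using kernelD(4)[OF k] by (intro continuous_intros)
  have i: "integrable lborel (\<lambda>y. (grad k (x - y) \<bullet> b) *\<^sub>R F y)" for b
    by (rule conv_integrable[where e = e]) (use c gk0 F_cont in auto)
  have "(\<Sum>b\<in>Basis. conv (\<lambda>z. grad k z \<bullet> b) F x \<bullet> b)
      = (\<Sum>b\<in>Basis. \<integral>y. ((grad k (x - y) \<bullet> b) *\<^sub>R F y) \<bullet> b \<partial>lborel)"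
    unfolding conv_def by (intro sum.cong refl integral_inner_left[symmetric]) (use i in auto)
  also have "\<dots> = (\<integral>y. (\<Sum>b\<in>Basis. ((grad k (x - y) \<bullet> b) *\<^sub>R F y) \<bullet> b) \<partial>lborel)"
    by (rule Bochner_Integration.integral_sum[symmetric]) (intro integrable_inner_left i)
  also have "(\<lambda>y. \<Sum>b\<in>Basis. ((grad k (x - y) \<bullet> b) *\<^sub>R F y) \<bullet> b) = (\<lambda>y. - (F y \<bullet> grad \<phi> y))"
  proof
    fix y
    have "(\<Sum>b\<in>Basis. ((grad k (x - y) \<bullet> b) *\<^sub>R F y) \<bullet> b) = grad k (x - y) \<bullet> F y"
      by (subst euclidean_inner) (simp add: algebra_simps)
    then show "(\<Sum>b\<in>Basis. ((grad k (x - y) \<bullet> b) *\<^sub>R F y) \<bullet> b) = - (F y \<bullet> grad \<phi> y)"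
      by (simp add: g\<phi> inner_commute)
  qed
  also have "(\<integral>y. - (F y \<bullet> grad \<phi> y) \<partial>lborel) = - (LINT y:cball x e|lborel. F y \<bullet> grad \<phi> y)"
    using LINT_eq_set_LINT[of "cball x e" "\<lambda>y. F y \<bullet> grad \<phi> y"] g\<phi> gk0
    by (simp add: dist_norm)
  also have "\<dots> = (LINT y:cball x e|lborel. H y * \<phi> y)"
    using weak[OF sm compact_cball x \<phi>0] by simp
  also have "\<dots> = conv k H x"
    unfolding conv_def using LINT_eq_set_LINT[of "cball x e" "\<lambda>y. H y * \<phi> y"] \<phi>0
    by (simp add: \<phi>_def mult.commute)
  finally show ?thesis .
qed

text \<open>Needed because the test function of the Caccioppoli estimate contains \<open>u\<close>,
  which is only C^1. The equation is mollified rather than the test function: the divergence theorem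
  applies to the mollified flux times \<phi>, and flux and right-hand side converge uniformly on
  \<open>S\<close>.\<close>

lemma weak_C1:
  assumes S: "compact S" "S \<subseteq> U" "open U" "U \<subseteq> ball x0 R"
    and der: "\<And>x. x \<in> U \<Longrightarrow> GDERIV \<phi> x :> \<phi>' x"
    and cont: "continuous_on U \<phi>'" and zero: "\<And>x. x \<in> U - S \<Longrightarrow> \<phi> x = 0"
  shows "(LINT x:S|lborel. F x \<bullet> \<phi>' x + H x * \<phi> x) = 0"
proof -
  have c\<phi>: "continuous_on U \<phi>"
    by (intro continuous_at_imp_continuous_on ballI has_derivative_continuous[OF der[unfolded gderiv_def]])
  note cS = continuous_on_subset[OF cont S(2)] continuous_on_subset[OF c\<phi> S(2)]
  define I where "I = (LINT x:S|lborel. F x \<bullet> \<phi>' x + H x * \<phi> x)"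
  define W where "W = (LINT x:S|lborel. norm (\<phi>' x) + \<bar>\<phi> x\<bar>)"
  have W: "W \<ge> 0" unfolding W_def set_lebesgue_integral_def by (rule integral_nonneg_AE) auto
  obtain r where r: "r > 0" "(\<Union>x\<in>S. cball x r) \<subseteq> ball x0 R"
    using compact_subset_open_imp_cball_epsilon_subset[OF S(1) open_ball] S(2,4) by blast
  \<comment> \<open>\<open>W + 1\<close> instead of \<open>W\<close>, so that \<tau> = \<epsilon> /
    (W + 1) is an admissible choice below.\<close>
  have bound: "\<bar>I\<bar> \<le> \<tau> * (W + 1)" if \<tau>: "\<tau> > 0" for \<tau>
  proof -
    obtain d1 where d1: "d1 > 0" "\<And>e x. 0 < e \<Longrightarrow> e < d1 \<Longrightarrow> x \<in> S \<Longrightarrow> norm (conv (mollifier e) F x - F x) \<le> \<tau>"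
      using conv_mollifier_approx[OF F_cont S(1) \<tau>] by blast
    obtain d2 where d2: "d2 > 0" "\<And>e x. 0 < e \<Longrightarrow> e < d2 \<Longrightarrow> x \<in> S \<Longrightarrow> norm (conv (mollifier e) H x - H x) \<le> \<tau>"
      using conv_mollifier_approx[OF H_cont S(1) \<tau>] by blast
    define e where "e = min r (min d1 d2) / 2"
    have e: "e > 0" "e < r" "e < d1" "e < d2" using r d1 d2 by (auto simp: e_def)
    note k = mollifier_kernel[OF e(1), where 'n = 'n]
    define Fe where "Fe = conv (mollifier e) F"
    define He where "He = conv (mollifier e) H"
    define Fe' where "Fe' x h = (\<Sum>b\<in>Basis. (h \<bullet> b) *\<^sub>R conv (\<lambda>z. grad (mollifier e) z \<bullet> b) F x)" for x h
    have Fe_der: "(Fe has_derivative Fe' x) (at x)" for x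
      using conv_kernel_has_derivative[OF k F_cont] by (simp add: Fe_def Fe'_def[abs_def])
    have Fe_b: "Fe' x b = conv (\<lambda>z. grad (mollifier e) z \<bullet> b) F x" if "b \<in> Basis" for x b
    proof -
      have "Fe' x b = (\<Sum>b'\<in>Basis. (if b' = b then conv (\<lambda>z. grad (mollifier e) z \<bullet> b) F x else 0))"
        unfolding Fe'_def using that by (intro sum.cong) (auto simp: inner_Basis)
      then show ?thesis using that by simp
    qed
    have cFe: "continuous_on T Fe" for T
      unfolding Fe_def by (rule conv_kernel_continuous[OF k F_cont])
    have cHe: "continuous_on T He" for T
      unfolding He_def by (rule conv_kernel_continuous[OF k H_cont])
    have cFe': "continuous_on T (\<lambda>x. Fe' x b)" if "b \<in> Basis" for T b
      unfolding Fe_b[OF that] by (rule conv_kernel_continuous[OF kernel_partial[OF k that] F_cont])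
    let ?X' = "\<lambda>x h. \<phi> x *\<^sub>R Fe' x h + (h \<bullet> \<phi>' x) *\<^sub>R Fe x"
    have "(LINT x:S|lborel. \<Sum>b\<in>Basis. ?X' x b \<bullet> b) = 0"
    proof (rule LINT_divergence[OF S(3,1,2), where X = "\<lambda>x. \<phi> x *\<^sub>R Fe x"])
      show "((\<lambda>x. \<phi> x *\<^sub>R Fe x) has_derivative ?X' x) (at x)" if "x \<in> U" for x
        using der[OF that] Fe_der unfolding gderiv_def by (rule has_derivative_scaleR)
      show "continuous_on U (\<lambda>x. ?X' x b)" if "b \<in> Basis" for b
        using cFe' that cFe cont c\<phi> by (intro continuous_intros)
    qed (use zero in auto)
    moreover have "(\<Sum>b\<in>Basis. ?X' x b \<bullet> b) = Fe x \<bullet> \<phi>' x + He x * \<phi> x" if "x \<in> S" for x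
    proof -
      have "cball x e \<subseteq> ball x0 R"
        using subset_cball[of e r x] e(2) UN_subset_iff[THEN iffD1, OF r(2), rule_format, OF that] by simp
      from conv_flux_div[OF k this] have "(\<Sum>b\<in>Basis. Fe' x b \<bullet> b) = He x"
        by (simp add: Fe_b He_def)
      moreover have "(\<Sum>b\<in>Basis. ?X' x b \<bullet> b)
          = \<phi> x * (\<Sum>b\<in>Basis. Fe' x b \<bullet> b) + (\<Sum>b\<in>Basis. (Fe x \<bullet> b) * (\<phi>' x \<bullet> b))"
        by (simp add: inner_add_left inner_add_right sum.distrib sum_distrib_left inner_commute mult.commute)
      ultimately show ?thesis by (simp add: euclidean_inner[symmetric])
    qed
    ultimately have 0: "(LINT x:S|lborel. Fe x \<bullet> \<phi>' x + He x * \<phi> x) = 0"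
      using set_lebesgue_integral_cong[of S lborel "\<lambda>x. \<Sum>b\<in>Basis. ?X' x b \<bullet> b" "\<lambda>x. Fe x \<bullet> \<phi>' x + He x * \<phi> x"] S(1)
      by (simp add: compact_imp_closed)
    have "I = (LINT x:S|lborel. (F x \<bullet> \<phi>' x + H x * \<phi> x) - (Fe x \<bullet> \<phi>' x + He x * \<phi> x))"
    proof -
      have "set_integrable lborel S (\<lambda>x. F x \<bullet> \<phi>' x + H x * \<phi> x)"
        by (intro set_integrable_continuous S(1) continuous_on_add continuous_on_inner continuous_on_mult F_cont H_cont cS)
      moreover have "set_integrable lborel S (\<lambda>x. Fe x \<bullet> \<phi>' x + He x * \<phi> x)"
        by (intro set_integrable_continuous S(1) continuous_on_add continuous_on_inner continuous_on_mult cFe cHe cS)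
      ultimately show ?thesis using 0 by (simp add: I_def)
    qed
    also have "\<bar>\<dots>\<bar> \<le> (LINT x:S|lborel. \<tau> * (norm (\<phi>' x) + \<bar>\<phi> x\<bar>))"
    proof -
      have "norm (LINT x:S|lborel. (F x \<bullet> \<phi>' x + H x * \<phi> x) - (Fe x \<bullet> \<phi>' x + He x * \<phi> x))
          \<le> (LINT x:S|lborel. \<tau> * (norm (\<phi>' x) + \<bar>\<phi> x\<bar>))"
        unfolding set_lebesgue_integral_def
      proof (rule order_trans[OF integral_norm_bound], rule integral_mono)
        show "integrable lborel (\<lambda>x. norm (indicat_real S x *\<^sub>R ((F x \<bullet> \<phi>' x + H x * \<phi> x) - (Fe x \<bullet> \<phi>' x + He x * \<phi> x))))"
          by (intro integrable_norm borel_integrable_compact S(1) continuous_on_diff continuous_on_add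
              continuous_on_inner continuous_on_mult F_cont H_cont cFe cHe cS)
        show "integrable lborel (\<lambda>x. indicat_real S x *\<^sub>R (\<tau> * (norm (\<phi>' x) + \<bar>\<phi> x\<bar>)))"
          using S(1) cS by (intro borel_integrable_compact continuous_intros)
        show "norm (indicat_real S x *\<^sub>R ((F x \<bullet> \<phi>' x + H x * \<phi> x) - (Fe x \<bullet> \<phi>' x + He x * \<phi> x)))
          \<le> indicat_real S x *\<^sub>R (\<tau> * (norm (\<phi>' x) + \<bar>\<phi> x\<bar>))" for x
        proof (cases "x \<in> S")
          case True
          have "\<bar>(F x - Fe x) \<bullet> \<phi>' x\<bar> \<le> \<tau> * norm (\<phi>' x)"
            using order_trans[OF Cauchy_Schwarz_ineq2[of "F x - Fe x" "\<phi>' x"]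
                mult_right_mono[of "norm (F x - Fe x)" \<tau> "norm (\<phi>' x)"]] d1(2)[OF e(1,3) True]
            by (simp add: Fe_def norm_minus_commute)
          moreover have "\<bar>(H x - He x) * \<phi> x\<bar> \<le> \<tau> * \<bar>\<phi> x\<bar>"
            using d2(2)[OF e(1,4) True] unfolding He_def abs_mult by (intro mult_right_mono) (auto simp: abs_minus_commute)
          moreover have "(F x \<bullet> \<phi>' x + H x * \<phi> x) - (Fe x \<bullet> \<phi>' x + He x * \<phi> x) = (F x - Fe x) \<bullet> \<phi>' x + (H x - He x) * \<phi> x"
            by (simp add: inner_diff_left algebra_simps)
          ultimately have "\<bar>(F x \<bullet> \<phi>' x + H x * \<phi> x) - (Fe x \<bullet> \<phi>' x + He x * \<phi> x)\<bar> \<le> \<tau> * norm (\<phi>' x) + \<tau> * \<bar>\<phi> x\<bar>"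
            by linarith
          then show ?thesis using True by (simp only: indicator_simps scaleR_one real_norm_def distrib_left)
        qed simp
      qed
      then show ?thesis by simp
    qed
    also have "\<dots> = \<tau> * W" unfolding W_def by (rule set_integral_mult_right)
    also have "\<dots> \<le> \<tau> * (W + 1)" using \<tau> by simp
    finally show ?thesis .
  qed
  have "\<bar>I\<bar> \<le> \<epsilon>" if "\<epsilon> > 0" for \<epsilon>
    using bound[of "\<epsilon> / (W + 1)"] W that by simp
  then have "\<bar>I\<bar> \<le> 0" by (rule field_le_epsilon) simp
  then show ?thesis by (simp add: I_def)
qed

end

section \<open>Square-integrable difference quotients of the gradient\<close>

text \<open>The reason why truncations and cut-offs appear squared: the positive part itself is not
  differentiable at 0, its square is C^1.\<close>

lemma DERIV_pos_part_square: "DERIV (\<lambda>t. (max 0 t)\<^sup>2) t :> 2 * max 0 (t::real)"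
proof -
  consider "t > 0" | "t < 0" | "t = 0" by linarith
  then show ?thesis
  proof cases
    case 1
    have "DERIV (\<lambda>t. t\<^sup>2) t :> 2 * max 0 t" using 1 by (auto intro!: derivative_eq_intros)
    then show ?thesis
      by (rule has_field_derivative_transform_within_open[where S = "{0<..}"]) (use 1 in auto)
  next
    case 2
    have "DERIV (\<lambda>t. 0) t :> 2 * max 0 t" using 2 by auto
    then show ?thesis
      by (rule has_field_derivative_transform_within_open[where S = "{..<0}"]) (use 2 in auto)
  next
    case 3
    have "((\<lambda>h::real. max 0 h) \<longlongrightarrow> 0) (at 0)"
      using tendsto_max[OF tendsto_const[of 0] tendsto_ident_at[of "0::real" UNIV]] by simp
    then have "((\<lambda>h::real. ((max 0 (0 + h))\<^sup>2 - (max 0 0)\<^sup>2) / h) \<longlongrightarrow> 0) (at 0)"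
      by (rule Lim_transform_eventually) (auto simp: eventually_at_filter max_def power2_eq_square)
    then show ?thesis using 3 by (simp add: DERIV_def)
  qed
qed

lemma set_LINT_cball_translation:
  fixes f :: "'a::euclidean_space \<Rightarrow> real"
  assumes "continuous_on (cball (a + h) r) f"
  shows "(LINT x:cball (a + h) r|lborel. f x) = (LINT x:cball a r|lborel. f (x + h))"
proof -
  have "integrable lborel (\<lambda>x. indicator (cball (a + h) r) x *\<^sub>R f x)"
    using assms by (intro borel_integrable_compact) auto
  then have "(\<lambda>x. indicator (cball (a + h) r) x *\<^sub>R f x) \<in> borel_measurable borel"
    using borel_measurable_integrable by simp
  from LINT_translation[OF this, of h]
  have "(LINT x:cball (a + h) r|lborel. f x) = (\<integral>x. indicator (cball (a + h) r) (h + x) *\<^sub>R f (h + x) \<partial>lborel)"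
    by (simp add: set_lebesgue_integral_def)
  also have "\<dots> = (LINT x:cball a r|lborel. f (x + h))"
    unfolding set_lebesgue_integral_def
    by (rule Bochner_Integration.integral_cong) (auto simp: indicator_def dist_norm add.commute)
  finally show ?thesis .
qed

context hamilton_jacobi
begin

lemma u_cont: "continuous_on (ball x0 R) u"
  using has_derivative_continuous[OF u_der[unfolded gderiv_def]]
  by (meson continuous_at_imp_continuous_on)

text \<open>The equation is tested with \<phi> and with its translate by \<open>h\<close>, the shift
  is moved to the coefficients, and the results are subtracted. The support has radius 2r, its open
  neighbourhood radius 3r, and a shift by at most r stays within radius 4r.\<close>

lemma difference_weak:
  assumes S: "cball x1 (4 * r) \<subseteq> ball x0 R" "norm h \<le> r" "r > 0"
    and der: "\<And>x. x \<in> ball x1 (3 * r) \<Longrightarrow> GDERIV \<phi> x :> \<phi>' x"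
    and cont: "continuous_on (ball x1 (3 * r)) \<phi>'"
    and zero: "\<And>x. x \<in> ball x1 (3 * r) - cball x1 (2 * r) \<Longrightarrow> \<phi> x = 0"
  shows "(LINT x:cball x1 (2 * r)|lborel. (F (x + h) - F x) \<bullet> \<phi>' x + (H (x + h) - H x) * \<phi> x) = 0"
proof -
  let ?S = "cball x1 (2 * r)" and ?U = "ball x1 (3 * r)"
  have SU: "?S \<subseteq> ?U" using S by auto
  have U: "?U \<subseteq> ball x0 R"
  proof
    fix y assume "y \<in> ?U"
    then have "y \<in> cball x1 (4 * r)" using S(3) by simp
    then show "y \<in> ball x0 R" using S(1) by blast
  qed
  have c\<phi>: "continuous_on ?U \<phi>"
    using has_derivative_continuous[OF der[unfolded gderiv_def]] by (meson continuous_at_imp_continuous_on)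
  note cS = continuous_on_subset[OF cont SU] continuous_on_subset[OF c\<phi> SU]
  have 1: "(LINT x:?S|lborel. F x \<bullet> \<phi>' x + H x * \<phi> x) = 0"
    by (rule weak_C1[OF compact_cball SU open_ball U der cont zero])
  have "(LINT x:cball (x1 + h) (2 * r)|lborel. F x \<bullet> \<phi>' (x - h) + H x * \<phi> (x - h)) = 0"
  proof (rule weak_C1[OF compact_cball _ open_ball])
    show "cball (x1 + h) (2 * r) \<subseteq> ball (x1 + h) (3 * r)" using S by auto
    show "ball (x1 + h) (3 * r) \<subseteq> ball x0 R"
    proof -
      have "ball (x1 + h) (3 * r) \<subseteq> cball x1 (4 * r)"
      proof
        fix y assume "y \<in> ball (x1 + h) (3 * r)"
        then have "dist x1 y \<le> 3 * r + norm h"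
          using dist_triangle[of x1 y "x1 + h"] by (simp add: dist_norm)
        then show "y \<in> cball x1 (4 * r)" using S by simp
      qed
      then show ?thesis using S by blast
    qed
    have sh: "x - h \<in> ?U" if "x \<in> ball (x1 + h) (3 * r)" for x
      using that by (simp add: dist_norm algebra_simps)
    show "GDERIV (\<lambda>x. \<phi> (x - h)) x :> \<phi>' (x - h)" if "x \<in> ball (x1 + h) (3 * r)" for x
      unfolding gderiv_def
    proof (rule has_derivative_compose[of "\<lambda>x. x - h" "\<lambda>k. k"])
      show "((\<lambda>x. x - h) has_derivative (\<lambda>k. k)) (at x)" by (auto intro!: derivative_eq_intros)
    qed (use der[OF sh[OF that]] in \<open>simp add: gderiv_def\<close>)
    show "continuous_on (ball (x1 + h) (3 * r)) (\<lambda>x. \<phi>' (x - h))"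
      by (rule continuous_on_compose2[OF cont]) (use sh in \<open>auto intro!: continuous_intros\<close>)
    show "\<phi> (x - h) = 0" if "x \<in> ball (x1 + h) (3 * r) - cball (x1 + h) (2 * r)" for x
      using that by (intro zero) (simp add: dist_norm algebra_simps)
  qed
  then have 2: "(LINT x:?S|lborel. F (x + h) \<bullet> \<phi>' x + H (x + h) * \<phi> x) = 0"
  proof (subst (asm) set_LINT_cball_translation)
    have "continuous_on (cball (x1 + h) (2 * r)) (\<lambda>x. \<phi>' (x - h))" "continuous_on (cball (x1 + h) (2 * r)) (\<lambda>x. \<phi> (x - h))"
      by (rule continuous_on_compose2[OF cS(1)] continuous_on_compose2[OF cS(2)],
          auto intro!: continuous_intros simp: dist_norm algebra_simps)+
    then show "continuous_on (cball (x1 + h) (2 * r)) (\<lambda>x. F x \<bullet> \<phi>' (x - h) + H x * \<phi> (x - h))"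
      by (intro continuous_on_add continuous_on_inner continuous_on_mult F_cont H_cont)
  qed simp
  have cFh: "continuous_on ?S (\<lambda>x. F (x + h))"
    by (rule continuous_on_compose2[OF F_cont[of UNIV]]) (auto intro!: continuous_intros)
  have cHh: "continuous_on ?S (\<lambda>x. H (x + h))"
    by (rule continuous_on_compose2[OF H_cont[of UNIV]]) (auto intro!: continuous_intros)
  have i: "set_integrable lborel ?S (\<lambda>x. F x \<bullet> \<phi>' x + H x * \<phi> x)"
    "set_integrable lborel ?S (\<lambda>x. F (x + h) \<bullet> \<phi>' x + H (x + h) * \<phi> x)"
    by (intro set_integrable_continuous compact_cball continuous_on_add continuous_on_inner continuous_on_mult F_cont H_cont cS cFh cHh)+
  have "(LINT x:?S|lborel. (F (x + h) \<bullet> \<phi>' x + H (x + h) * \<phi> x) - (F x \<bullet> \<phi>' x + H x * \<phi> x)) = 0"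
    using i 1 2 by simp
  then show ?thesis by (simp add: inner_diff_left algebra_simps)
qed

text \<open>Test function: \<open>X\<^sup>2 (u (x + h) - u x)\<close> with the cut-off \<open>X x = max 0 (4 r\<^sup>2 - |x - x\<^sub>1|\<^sup>2)\<close>.\<close>

lemma caccioppoli:
  assumes x1: "x1 \<in> ball x0 R" "g x1 \<noteq> 0"
  obtains r C where "r > 0" "C \<ge> 0" 
    "\<And>h. norm h \<le> r \<Longrightarrow> (LINT x:cball x1 r|lborel. (norm (g (x + h) - g x))\<^sup>2) \<le> C * (norm h)\<^sup>2"
proof -
  define \<xi>0 where "\<xi>0 = g x1"
  define c where "c = min 1 (p - 1) * norm \<xi>0 powr (p - 2)"
  have c: "c > 0" using p1 x1 by (auto simp: c_def \<xi>0_def)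
  \<comment> \<open>The error c / 4 leaves 3 c / 4 of the ellipticity in \<open>A_lower\<close>;
    Young's inequality in \<open>a4\<close> takes another quarter, so c / 2 survives.\<close>
  obtain \<delta>1 where \<delta>1: "\<delta>1 > 0" "\<And>a b. a \<in> ball \<xi>0 \<delta>1 \<Longrightarrow> b \<in> ball \<xi>0 \<delta>1 \<Longrightarrow>
      norm (flux p a - flux p b - dflux p \<xi>0 (a - b)) \<le> c / 4 * norm (a - b)"
  proof (rule strict_derivative_compact[of "- {0}" "{\<xi>0}" "flux p" "dflux p" "c / 4"])
    show "(flux p has_derivative dflux p x) (at x)" if "x \<in> - {0}" for x :: "real^'n"
      using that flux_has_derivative by simp
    show "continuous_on (- {0}) (\<lambda>x. dflux p x b)" for b :: "real ^ 'n" by (rule dflux_continuous)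
  qed (use c x1 in \<open>auto simp: \<xi>0_def\<close>)
  let ?H' = "\<lambda>x h. h \<bullet> ((q * norm x powr (q - 2)) *\<^sub>R x) :: real"
  obtain \<delta>2 where \<delta>2: "\<delta>2 > 0" "\<And>a b. a \<in> ball \<xi>0 \<delta>2 \<Longrightarrow> b \<in> ball \<xi>0 \<delta>2 \<Longrightarrow>
      norm (norm a powr q - norm b powr q - ?H' \<xi>0 (a - b)) \<le> 1 * norm (a - b)"
  proof (rule strict_derivative_compact[of "- {0}" "{\<xi>0}" "\<lambda>x. norm x powr q" ?H' 1])
    show "((\<lambda>x. norm x powr q) has_derivative ?H' x) (at x)" if "x \<in> - {0}" for x :: "real^'n"
      using norm_powr_GDERIV[of x q] that by (simp add: gderiv_def)
    show "continuous_on (- {0}) (\<lambda>x. ?H' x b)" for b :: "real ^ 'n"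
      by (intro continuous_intros) auto
  qed (use x1 in \<open>auto simp: \<xi>0_def\<close>)
  obtain B where B: "B > 0" "\<And>y. norm (dflux p \<xi>0 y) \<le> B * norm y"
    using linear_bounded_pos[OF linear_dflux] by blast
  define LA where "LA = B + c / 4"
  define LH where "LH = norm ((q * norm \<xi>0 powr (q - 2)) *\<^sub>R \<xi>0) + 1"
  have LA: "LA > 0" using B c by (simp add: LA_def)
  have LH: "LH > 0" by (simp add: LH_def add_nonneg_pos)
  define \<delta> where "\<delta> = min \<delta>1 \<delta>2"
  have \<delta>: "\<delta> > 0" using \<delta>1 \<delta>2 by (simp add: \<delta>_def)
  have A_lower: "(flux p a - flux p b) \<bullet> (a - b) \<ge> 3 * c / 4 * (norm (a - b))\<^sup>2"
    and A_upper: "norm (flux p a - flux p b) \<le> LA * norm (a - b)"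
    and H_upper: "\<bar>norm a powr q - norm b powr q\<bar> \<le> LH * norm (a - b)"
    if "a \<in> ball \<xi>0 \<delta>" "b \<in> ball \<xi>0 \<delta>" for a b
  proof -
    have s: "norm (flux p a - flux p b - dflux p \<xi>0 (a - b)) \<le> c / 4 * norm (a - b)"
      using that by (intro \<delta>1) (auto simp: \<delta>_def)
    have "\<bar>(flux p a - flux p b - dflux p \<xi>0 (a - b)) \<bullet> (a - b)\<bar> \<le> c / 4 * norm (a - b) * norm (a - b)"
      using order_trans[OF Cauchy_Schwarz_ineq2 mult_right_mono[OF s norm_ge_zero]] .
    moreover have "c * ((a - b) \<bullet> (a - b)) \<le> dflux p \<xi>0 (a - b) \<bullet> (a - b)"
      using dflux_elliptic[OF p1] by (simp add: c_def)
    moreover have "(flux p a - flux p b) \<bullet> (a - b)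
        = (flux p a - flux p b - dflux p \<xi>0 (a - b)) \<bullet> (a - b) + dflux p \<xi>0 (a - b) \<bullet> (a - b)"
      by (simp add: inner_diff_left)
    ultimately show "(flux p a - flux p b) \<bullet> (a - b) \<ge> 3 * c / 4 * (norm (a - b))\<^sup>2"
      by (simp add: power2_norm_eq_inner[symmetric] power2_eq_square)
    show "norm (flux p a - flux p b) \<le> LA * norm (a - b)"
      using s B(2)[of "a - b"] norm_triangle_sub[of "flux p a - flux p b" "dflux p \<xi>0 (a - b)"]
      by (simp add: LA_def algebra_simps)
    have "norm (norm a powr q - norm b powr q - ?H' \<xi>0 (a - b)) \<le> 1 * norm (a - b)"
      using that by (intro \<delta>2) (auto simp: \<delta>_def)
    moreover have "\<bar>?H' \<xi>0 (a - b)\<bar> \<le> norm (a - b) * norm ((q * norm \<xi>0 powr (q - 2)) *\<^sub>R \<xi>0)"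
      by (rule Cauchy_Schwarz_ineq2)
    ultimately show "\<bar>norm a powr q - norm b powr q\<bar> \<le> LH * norm (a - b)"
      unfolding LH_def distrib_right mult.commute[of "norm ((q * norm \<xi>0 powr (q - 2)) *\<^sub>R \<xi>0)"]
      unfolding real_norm_def by linarith
  qed
  obtain d where d: "d > 0" "\<And>x y. x \<in> {x1} \<Longrightarrow> dist x y < d \<Longrightarrow> dist (g y) (g x) < \<delta>"
    by (rule uniformly_close_on_compact[OF g_cont _ \<delta>, of "{x1}"]) auto
  \<comment> \<open>Dividing by 5 keeps the ball of radius 4r strictly inside the given ball and
    inside the region where \<open>g\<close> is \<delta>-close to \<xi>0.\<close>
  define r where "r = min d (R - dist x0 x1) / 5"
  have r: "r > 0" "4 * r < d" "4 * r < R - dist x0 x1"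
  proof -
    show "r > 0" using d x1 by (simp add: r_def)
    moreover have "5 * r \<le> d" "5 * r \<le> R - dist x0 x1" by (simp_all add: r_def)
    ultimately show "4 * r < d" "4 * r < R - dist x0 x1" by linarith+
  qed
  have B4: "cball x1 (4 * r) \<subseteq> ball x0 R"
  proof
    fix y assume "y \<in> cball x1 (4 * r)"
    then show "y \<in> ball x0 R" using r dist_triangle[of x0 y x1] by simp
  qed
  have g4: "g y \<in> ball \<xi>0 \<delta>" if "y \<in> cball x1 (4 * r)" for y
    using d(2)[of x1 y] that r by (simp add: \<xi>0_def dist_commute)
  define G where "G = norm \<xi>0 + \<delta>"
  have G: "G > 0" using \<delta> by (simp add: G_def add_nonneg_pos)
  have gG: "norm (g y) \<le> G" if "y \<in> cball x1 (4 * r)" for y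
    using g4[OF that] norm_triangle_sub[of "g y" \<xi>0] by (simp add: G_def dist_norm norm_minus_commute)
  \<comment> \<open>The coefficient of X |\<omega>| |w|: the first summand stems from the gradient
    of the cut-off, the second from the difference of the right-hand sides.\<close>
  define K where "K = 8 * r * LA + 4 * r\<^sup>2 * LH"
  let ?S = "cball x1 (2 * r)"
  define C where "C = (K\<^sup>2 / c * G\<^sup>2) * measure lborel ?S / (c / 2 * (9 * r ^ 4))"
  show ?thesis
  proof (rule that[OF \<open>r > 0\<close>, of C])
    show "C \<ge> 0" using c r by (simp add: C_def)
    fix h :: "real ^ 'n" assume h: "norm h \<le> r"
    define w where "w x = u (x + h) - u x" for x
    define \<omega> where "\<omega> x = g (x + h) - g x" for x
    define X where "X x = max 0 (4 * r\<^sup>2 - (x - x1) \<bullet> (x - x1))" for x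
    define \<phi> where "\<phi> x = (X x)\<^sup>2 * w x" for x
    define \<phi>' where "\<phi>' x = (X x)\<^sup>2 *\<^sub>R \<omega> x + w x *\<^sub>R ((2 * X x) *\<^sub>R (- 2 *\<^sub>R (x - x1)))" for x
    have xh: "x + h \<in> cball x1 (4 * r)" if "x \<in> ball x1 (3 * r)" for x
      using that h dist_triangle[of x1 "x + h" x] by (simp add: dist_norm)
    have x4: "x \<in> cball x1 (4 * r)" if "x \<in> ball x1 (3 * r)" for x using that r by simp
    have w_der: "GDERIV w x :> \<omega> x" if "x \<in> ball x1 (3 * r)" for x
    proof -
      have "((\<lambda>x. u (x + h)) has_derivative (\<lambda>k. k \<bullet> g (x + h))) (at x)"
      proof (rule has_derivative_compose[of "\<lambda>x. x + h" "\<lambda>k. k"])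
        show "((\<lambda>x. x + h) has_derivative (\<lambda>k. k)) (at x)" by (auto intro!: derivative_eq_intros)
      qed (use u_der xh[OF that] B4 in \<open>auto simp: gderiv_def\<close>)
      then have "GDERIV (\<lambda>x. u (x + h)) x :> g (x + h)" by (simp add: gderiv_def)
      from GDERIV_diff[OF this u_der] show ?thesis
        using x4[OF that] B4 by (auto simp: w_def[abs_def] \<omega>_def)
    qed
    have X2_der: "GDERIV (\<lambda>x. (X x)\<^sup>2) x :> (2 * X x) *\<^sub>R (- 2 *\<^sub>R (x - x1))" for x
    proof -
      have "GDERIV (\<lambda>x. 4 * r\<^sup>2 - (x - x1) \<bullet> (x - x1)) x :> - 2 *\<^sub>R (x - x1)"
        unfolding gderiv_def by (auto intro!: derivative_eq_intros simp: inner_commute)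
      from GDERIV_DERIV_compose[OF this DERIV_pos_part_square] show ?thesis
        by (simp add: X_def)
    qed
    have \<phi>_der: "GDERIV \<phi> x :> \<phi>' x" if "x \<in> ball x1 (3 * r)" for x
      using GDERIV_mult[OF X2_der w_der[OF that]] by (simp add: \<phi>_def[abs_def] \<phi>'_def)
    have c\<omega>: "continuous_on T \<omega>" for T
      unfolding \<omega>_def by (intro continuous_intros continuous_on_compose2[OF g_cont]) auto
    have cX: "continuous_on T X" for T
      unfolding X_def by (intro continuous_intros)
    have cw: "continuous_on (ball x1 (3 * r)) w"
      using has_derivative_continuous[OF w_der[unfolded gderiv_def]] by (meson continuous_at_imp_continuous_on)
    have c\<phi>': "continuous_on (ball x1 (3 * r)) \<phi>'"
      unfolding \<phi>'_def by (intro continuous_intros c\<omega> cX cw)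
    have X0: "X x = 0" if "x \<notin> ?S" for x
    proof -
      have "2 * r < norm (x - x1)" using that by (simp add: dist_norm norm_minus_commute)
      then have "(2 * r)\<^sup>2 < (norm (x - x1))\<^sup>2" using r by (intro power_strict_mono) auto
      then show ?thesis by (simp add: X_def power2_norm_eq_inner power_mult_distrib)
    qed
    have eq: "(LINT x:?S|lborel. (F (x + h) - F x) \<bullet> \<phi>' x + (H (x + h) - H x) * \<phi> x) = 0"
      by (rule difference_weak[OF B4 h \<open>r > 0\<close> \<phi>_der c\<phi>']) (use X0 in \<open>auto simp: \<phi>_def\<close>)
    have SU: "?S \<subseteq> ball x1 (3 * r)" using r by auto
    \<comment> \<open>This is the source of the factor |h|^2 in the conclusion: the undifferentiated
      difference of \<open>u\<close> is of order |h| because the gradient is bounded.\<close>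
    have wb: "\<bar>w x\<bar> \<le> G * norm h" if "x \<in> ?S" for x
    proof -
      have "norm (u (x + h) - u x) \<le> G * norm (x + h - x)"
      proof (rule differentiable_bound[of "cball x1 (4 * r)" u "\<lambda>y k. k \<bullet> g y"])
        show "(u has_derivative (\<lambda>k. k \<bullet> g y)) (at y within cball x1 (4 * r))" if "y \<in> cball x1 (4 * r)" for y
        proof (rule has_derivative_at_withinI)
          have "y \<in> ball x0 R" using that B4 by blast
          then show "(u has_derivative (\<lambda>k. k \<bullet> g y)) (at y)" using u_der unfolding gderiv_def by blast
        qed
        show "onorm (\<lambda>k. k \<bullet> g y) \<le> G" if "y \<in> cball x1 (4 * r)" for y
        proof (rule onorm_le)
          fix k
          show "norm (k \<bullet> g y) \<le> G * norm k"
            using order_trans[OF Cauchy_Schwarz_ineq2[of k "g y"] mult_left_mono[OF gG[OF that], of "norm k"]]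
            by (simp add: mult.commute)
        qed
      qed (use that SU x4 xh in auto)
      then show ?thesis by (simp add: w_def)
    qed
    have pw: "(c / 2) * ((X x)\<^sup>2 * (norm (\<omega> x))\<^sup>2) - K\<^sup>2 / c * (G * norm h)\<^sup>2
        \<le> (F (x + h) - F x) \<bullet> \<phi>' x + (H (x + h) - H x) * \<phi> x" if x: "x \<in> ?S" for x
    proof -
      have xU: "x \<in> ball x1 (3 * r)" using x SU by blast
      define \<nu> where "\<nu> = norm (\<omega> x)"
      have gg: "g (x + h) \<in> ball \<xi>0 \<delta>" "g x \<in> ball \<xi>0 \<delta>" using g4 xh[OF xU] x4[OF xU] by auto
      have Xp: "X x \<ge> 0" "X x \<le> 4 * r\<^sup>2" by (auto simp: X_def)
      have \<nu>0: "\<nu> \<ge> 0" by (simp add: \<nu>_def)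
      have nx: "norm (x - x1) \<le> 2 * r" using x by (simp add: dist_norm norm_minus_commute)
      have a1: "(F (x + h) - F x) \<bullet> ((X x)\<^sup>2 *\<^sub>R \<omega> x) \<ge> 3 * c / 4 * ((X x)\<^sup>2 * \<nu>\<^sup>2)"
        using mult_left_mono[OF A_lower[OF gg], of "(X x)\<^sup>2"] by (simp add: \<omega>_def \<nu>_def mult_ac)
      have a2: "\<bar>(F (x + h) - F x) \<bullet> (w x *\<^sub>R ((2 * X x) *\<^sub>R (- 2 *\<^sub>R (x - x1))))\<bar> \<le> 8 * r * LA * (X x * \<nu> * \<bar>w x\<bar>)"
      proof -
        have "\<bar>(F (x + h) - F x) \<bullet> (x - x1)\<bar> \<le> (LA * \<nu>) * (2 * r)"
        proof (rule order_trans[OF Cauchy_Schwarz_ineq2], rule mult_mono)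
          show "norm (F (x + h) - F x) \<le> LA * \<nu>" using A_upper[OF gg] by (simp add: \<omega>_def \<nu>_def)
          show "0 \<le> LA * \<nu>" using LA \<nu>0 by simp
        qed (use nx in auto)
        then have "(4 * X x * \<bar>w x\<bar>) * \<bar>(F (x + h) - F x) \<bullet> (x - x1)\<bar> \<le> (4 * X x * \<bar>w x\<bar>) * ((LA * \<nu>) * (2 * r))"
          using Xp by (intro mult_left_mono) auto
        moreover have "\<bar>(F (x + h) - F x) \<bullet> (w x *\<^sub>R ((2 * X x) *\<^sub>R (- 2 *\<^sub>R (x - x1))))\<bar>
            = (4 * X x * \<bar>w x\<bar>) * \<bar>(F (x + h) - F x) \<bullet> (x - x1)\<bar>"
          using Xp by (simp add: abs_mult)
        ultimately show ?thesis by (simp add: mult_ac)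
      qed
      have a3: "\<bar>(H (x + h) - H x) * \<phi> x\<bar> \<le> 4 * r\<^sup>2 * LH * (X x * \<nu> * \<bar>w x\<bar>)"
      proof -
        have "\<bar>H (x + h) - H x\<bar> * (X x * X x * \<bar>w x\<bar>) \<le> (LH * \<nu>) * (4 * r\<^sup>2 * X x * \<bar>w x\<bar>)"
        proof (rule mult_mono)
          show "\<bar>H (x + h) - H x\<bar> \<le> LH * \<nu>" using H_upper[OF gg] by (simp add: \<omega>_def \<nu>_def)
          show "X x * X x * \<bar>w x\<bar> \<le> 4 * r\<^sup>2 * X x * \<bar>w x\<bar>"
            using Xp by (intro mult_right_mono) auto
          show "0 \<le> LH * \<nu>" using LH \<nu>0 by simp
        qed (use Xp in simp)
        then show ?thesis using Xp by (simp add: \<phi>_def abs_mult power2_eq_square mult_ac)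
      qed
      have a4: "K * (X x * \<nu> * \<bar>w x\<bar>) \<le> c / 4 * ((X x)\<^sup>2 * \<nu>\<^sup>2) + K\<^sup>2 / c * (w x)\<^sup>2"
      proof -
        have "0 \<le> c / 4 * (X x * \<nu> - 2 * K / c * \<bar>w x\<bar>)\<^sup>2" using c by simp
        also have "\<dots> = c / 4 * ((X x)\<^sup>2 * \<nu>\<^sup>2) - K * (X x * \<nu> * \<bar>w x\<bar>) + K\<^sup>2 / c * \<bar>w x\<bar>\<^sup>2"
          using c by (simp add: power2_diff field_simps power2_eq_square)
        finally show ?thesis by simp
      qed
      have a5: "K\<^sup>2 / c * (w x)\<^sup>2 \<le> K\<^sup>2 / c * (G * norm h)\<^sup>2"
      proof (rule mult_left_mono)
        have "\<bar>w x\<bar> \<le> \<bar>G * norm h\<bar>" using wb[OF x] by linarith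
        then show "(w x)\<^sup>2 \<le> (G * norm h)\<^sup>2" by (rule abs_le_square_iff[THEN iffD1])
      qed (use c in simp)
      have "K * (X x * \<nu> * \<bar>w x\<bar>) = 8 * r * LA * (X x * \<nu> * \<bar>w x\<bar>) + 4 * r\<^sup>2 * LH * (X x * \<nu> * \<bar>w x\<bar>)"
        by (simp add: K_def distrib_right)
      then show ?thesis
        using a1 a2 a3 a4 a5 unfolding \<phi>'_def inner_add_right \<nu>_def[symmetric] by linarith
    qed
    have cwS: "continuous_on ?S w" using cw SU continuous_on_subset by blast
    have cFh: "continuous_on ?S (\<lambda>x. F (x + h))"
      by (rule continuous_on_compose2[OF F_cont[of UNIV]]) (auto intro!: continuous_intros)
    have cHh: "continuous_on ?S (\<lambda>x. H (x + h))"
      by (rule continuous_on_compose2[OF H_cont[of UNIV]]) (auto intro!: continuous_intros)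
    have c1: "continuous_on T (\<lambda>x. (X x)\<^sup>2 * (norm (\<omega> x))\<^sup>2)" for T by (intro continuous_intros cX c\<omega>)
    have c2: "continuous_on ?S (\<lambda>x. (F (x + h) - F x) \<bullet> \<phi>' x + (H (x + h) - H x) * \<phi> x)"
      unfolding \<phi>_def by (intro continuous_on_add continuous_on_inner continuous_on_diff continuous_on_mult cFh cHh F_cont H_cont
          continuous_on_power cX cwS continuous_on_subset[OF c\<phi>' SU])
    have "(LINT x:?S|lborel. (c / 2) * ((X x)\<^sup>2 * (norm (\<omega> x))\<^sup>2) - K\<^sup>2 / c * (G * norm h)\<^sup>2)
        \<le> (LINT x:?S|lborel. (F (x + h) - F x) \<bullet> \<phi>' x + (H (x + h) - H x) * \<phi> x)"
    proof (rule set_integral_mono)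
      show "set_integrable lborel ?S (\<lambda>x. (c / 2) * ((X x)\<^sup>2 * (norm (\<omega> x))\<^sup>2) - K\<^sup>2 / c * (G * norm h)\<^sup>2)"
        by (intro set_integrable_continuous compact_cball continuous_on_diff continuous_on_mult_left continuous_on_const c1)
      show "set_integrable lborel ?S (\<lambda>x. (F (x + h) - F x) \<bullet> \<phi>' x + (H (x + h) - H x) * \<phi> x)"
        by (intro set_integrable_continuous compact_cball c2)
    qed (rule pw)
    moreover have "(LINT x:?S|lborel. (c / 2) * ((X x)\<^sup>2 * (norm (\<omega> x))\<^sup>2) - K\<^sup>2 / c * (G * norm h)\<^sup>2)
        = (c / 2) * (LINT x:?S|lborel. (X x)\<^sup>2 * (norm (\<omega> x))\<^sup>2) - K\<^sup>2 / c * (G * norm h)\<^sup>2 * measure lborel ?S"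
    proof (subst set_integral_diff(2))
      show "set_integrable lborel ?S (\<lambda>x. (c / 2) * ((X x)\<^sup>2 * (norm (\<omega> x))\<^sup>2))"
        by (intro set_integrable_continuous compact_cball continuous_on_mult_left c1)
      show "set_integrable lborel ?S (\<lambda>x. K\<^sup>2 / c * (G * norm h)\<^sup>2)"
        by (intro set_integrable_continuous compact_cball continuous_on_const)
    qed (use emeasure_compact_finite[OF compact_cball, of x1 "2 * r"] in \<open>subst set_integral_const; auto\<close>)
    ultimately have m1: "(c / 2) * (LINT x:?S|lborel. (X x)\<^sup>2 * (norm (\<omega> x))\<^sup>2) \<le> K\<^sup>2 / c * (G * norm h)\<^sup>2 * measure lborel ?S"
      using eq by linarith
    have "9 * r ^ 4 * (LINT x:cball x1 r|lborel. (norm (\<omega> x))\<^sup>2) = (LINT x:cball x1 r|lborel. 9 * r ^ 4 * (norm (\<omega> x))\<^sup>2)"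
      by (rule set_integral_mult_right[symmetric])
    also have "\<dots> \<le> (LINT x:cball x1 r|lborel. (X x)\<^sup>2 * (norm (\<omega> x))\<^sup>2)"
    proof (rule set_integral_mono)
      show "set_integrable lborel (cball x1 r) (\<lambda>x. 9 * r ^ 4 * (norm (\<omega> x))\<^sup>2)"
        by (intro set_integrable_continuous compact_cball continuous_intros c\<omega>)
      show "set_integrable lborel (cball x1 r) (\<lambda>x. (X x)\<^sup>2 * (norm (\<omega> x))\<^sup>2)"
        by (intro set_integrable_continuous compact_cball c1)
      \<comment> \<open>On the smaller ball the cut-off is at least 3 r^2, whence the factor 9
        r^4.\<close>
      fix x assume "x \<in> cball x1 r"
      then have "(norm (x - x1))\<^sup>2 \<le> r\<^sup>2" by (intro power_mono) (auto simp: dist_norm norm_minus_commute)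
      then have "3 * r\<^sup>2 \<le> X x" by (simp add: X_def power2_norm_eq_inner)
      then have "(3 * r\<^sup>2)\<^sup>2 \<le> (X x)\<^sup>2" by (intro power_mono) auto
      moreover have "(3 * r\<^sup>2)\<^sup>2 = 9 * r ^ 4" by (simp add: power_mult_distrib flip: power_mult)
      ultimately show "9 * r ^ 4 * (norm (\<omega> x))\<^sup>2 \<le> (X x)\<^sup>2 * (norm (\<omega> x))\<^sup>2"
        by (intro mult_right_mono) auto
    qed
    also have "\<dots> \<le> (LINT x:?S|lborel. (X x)\<^sup>2 * (norm (\<omega> x))\<^sup>2)"
      using r c1 by (intro set_LINT_mono_set) auto
    finally have m2: "9 * r ^ 4 * (LINT x:cball x1 r|lborel. (norm (\<omega> x))\<^sup>2) \<le> (LINT x:?S|lborel. (X x)\<^sup>2 * (norm (\<omega> x))\<^sup>2)" .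
    have "(c / 2 * (9 * r ^ 4)) * (LINT x:cball x1 r|lborel. (norm (\<omega> x))\<^sup>2) \<le> K\<^sup>2 / c * (G * norm h)\<^sup>2 * measure lborel ?S"
      using order_trans[OF mult_left_mono[OF m2, of "c / 2"] m1] c by (simp add: mult.assoc)
    moreover have "c / 2 * (9 * r ^ 4) > 0" using c r by simp
    ultimately have "(LINT x:cball x1 r|lborel. (norm (\<omega> x))\<^sup>2)
        \<le> K\<^sup>2 / c * (G * norm h)\<^sup>2 * measure lborel ?S / (c / 2 * (9 * r ^ 4))"
      by (simp only: pos_le_divide_eq mult.commute)
    also have "\<dots> = C * (norm h)\<^sup>2" by (simp add: C_def power_mult_distrib)
    finally show "(LINT x:cball x1 r|lborel. (norm (g (x + h) - g x))\<^sup>2) \<le> C * (norm h)\<^sup>2"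
      by (simp add: \<omega>_def)
  qed
qed

end

section \<open>The mollified gradient\<close>

lemma set_LINT_le_finite_cover:
  fixes f :: "'a::euclidean_space \<Rightarrow> real"
  assumes "finite D" "compact K" "continuous_on UNIV f" "\<And>x. f x \<ge> 0" "K \<subseteq> (\<Union>d\<in>D. cball d (r d))"
  shows "(LINT x:K|lborel. f x) \<le> (\<Sum>d\<in>D. LINT x:cball d (r d)|lborel. f x)"
proof -
  have i: "integrable lborel (\<lambda>x. indicat_real S x *\<^sub>R f x)" if "compact S" for S
    using that continuous_on_subset[OF assms(3) subset_UNIV] by (rule borel_integrable_compact)
  have "(LINT x:K|lborel. f x) \<le> (\<integral>x. (\<Sum>d\<in>D. indicat_real (cball d (r d)) x *\<^sub>R f x) \<partial>lborel)"
    unfolding set_lebesgue_integral_def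
  proof (rule integral_mono)
    show "integrable lborel (\<lambda>x. \<Sum>d\<in>D. indicat_real (cball d (r d)) x *\<^sub>R f x)"
      by (intro Bochner_Integration.integrable_sum i compact_cball)
    fix x
    show "indicat_real K x *\<^sub>R f x \<le> (\<Sum>d\<in>D. indicat_real (cball d (r d)) x *\<^sub>R f x)"
    proof (cases "x \<in> K")
      case True
      then obtain d where "d \<in> D" "x \<in> cball d (r d)" using assms(5) by blast
      then have "f x = indicat_real (cball d (r d)) x *\<^sub>R f x" by simp
      also have "\<dots> \<le> (\<Sum>d\<in>D. indicat_real (cball d (r d)) x *\<^sub>R f x)"
        using assms(1,4) \<open>d \<in> D\<close> by (intro member_le_sum[of d D "\<lambda>d. indicat_real (cball d (r d)) x *\<^sub>R f x"]) auto
      finally show ?thesis using True by simp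
    next
      case False
      then show ?thesis using assms(4) by (simp add: sum_nonneg)
    qed
  qed (rule i[OF assms(2)])
  also have "\<dots> = (\<Sum>d\<in>D. LINT x:cball d (r d)|lborel. f x)"
    unfolding set_lebesgue_integral_def by (intro Bochner_Integration.integral_sum i compact_cball)
  finally show ?thesis .
qed

lemma symmetric_on_Basis:
  fixes B :: "'a::euclidean_space \<Rightarrow> 'a"
  assumes "linear B" "\<And>b c. b \<in> Basis \<Longrightarrow> c \<in> Basis \<Longrightarrow> B b \<bullet> c = B c \<bullet> b"
  shows "B x \<bullet> y = x \<bullet> B y"
proof -
  have e: "B x = (\<Sum>b\<in>Basis. (x \<bullet> b) *\<^sub>R B b)" for x
    by (rule linear_eq_sum_Basis[OF assms(1)])
  have "B x \<bullet> y = (\<Sum>b\<in>Basis. (x \<bullet> b) * (\<Sum>c\<in>Basis. (y \<bullet> c) * (B b \<bullet> c)))"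
    by (subst e) (simp add: inner_sum_left euclidean_inner[of "B _" y] mult.commute)
  also have "\<dots> = (\<Sum>c\<in>Basis. \<Sum>b\<in>Basis. (x \<bullet> b) * ((y \<bullet> c) * (B c \<bullet> b)))"
    unfolding sum_distrib_left by (subst sum.swap) (auto intro!: sum.cong simp: assms(2))
  also have "\<dots> = (\<Sum>c\<in>Basis. (y \<bullet> c) * (\<Sum>b\<in>Basis. (x \<bullet> b) * (B c \<bullet> b)))"
    unfolding sum_distrib_left by (intro sum.cong refl) (simp add: mult.left_commute)
  also have "\<dots> = x \<bullet> B y"
    by (subst (2) e) (simp add: inner_sum_right euclidean_inner[of x "B _"])
  finally show ?thesis .
qed

lemma radial_bump_GDERIV:
  "GDERIV (\<lambda>z::real ^ 'n. c * bump m (1 - (t *\<^sub>R z) \<bullet> (t *\<^sub>R z))) z :>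
    (c * (- 2 * t\<^sup>2) * (bump (m + 2) (1 - (t *\<^sub>R z) \<bullet> (t *\<^sub>R z)) - real m * bump (m + 1) (1 - (t *\<^sub>R z) \<bullet> (t *\<^sub>R z)))) *\<^sub>R z"
proof -
  have "GDERIV (\<lambda>z::real ^ 'n. 1 - (t *\<^sub>R z) \<bullet> (t *\<^sub>R z)) z :> (- 2 * t\<^sup>2) *\<^sub>R z"
    unfolding gderiv_def by (auto intro!: derivative_eq_intros simp: inner_commute power2_eq_square fun_eq_iff)
  from GDERIV_DERIV_compose[OF this DERIV_bump]
  have "((\<lambda>z::real ^ 'n. bump m (1 - (t *\<^sub>R z) \<bullet> (t *\<^sub>R z))) has_derivative
      (\<lambda>h. h \<bullet> ((bump (m + 2) (1 - (t *\<^sub>R z) \<bullet> (t *\<^sub>R z)) - real m * bump (m + 1) (1 - (t *\<^sub>R z) \<bullet> (t *\<^sub>R z))) *\<^sub>R (- 2 * t\<^sup>2) *\<^sub>R z))) (at z)"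
    unfolding gderiv_def .
  from has_derivative_mult_right[OF this, of c] show ?thesis
    unfolding gderiv_def by (rule has_derivative_eq_rhs) (simp add: fun_eq_iff)
qed

text \<open>The mollifier is radial: its gradient is a radial function times z, so one more
  differentiation gives a multiple of the identity plus a multiple of the tensor square of z, and
  this is symmetric by inspection.\<close>

lemma mollifier_hessian_symmetric:
  fixes z :: "real ^ 'n"
  shows "grad (\<lambda>z. grad (mollifier e) z \<bullet> b) z \<bullet> c = grad (\<lambda>z. grad (mollifier e) z \<bullet> c) z \<bullet> b"
proof -
  define k where "k = 1 / (bump_mass TYPE('n) * e ^ CARD('n))"
  define t where "t = 1 / e"
  define k1 where "k1 = k * (- 2 * t\<^sup>2)"
  define k2 where "k2 z = k1 * (- 2 * t\<^sup>2) * (bump (2 + 2) (1 - (t *\<^sub>R z) \<bullet> (t *\<^sub>R z)) - real 2 * bump (2 + 1) (1 - (t *\<^sub>R z) \<bullet> (t *\<^sub>R z)))" for z :: "real ^ 'n"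
  let ?k = "\<lambda>z::real ^ 'n. k1 * bump 2 (1 - (t *\<^sub>R z) \<bullet> (t *\<^sub>R z))"
  have "mollifier e = (\<lambda>z::real ^ 'n. k * bump 0 (1 - (t *\<^sub>R z) \<bullet> (t *\<^sub>R z)))"
    by (simp add: mollifier_def k_def t_def bump0_def fun_eq_iff)
  then have "grad (mollifier e) z = ?k z *\<^sub>R z" for z :: "real ^ 'n"
    using grad_eq[OF radial_bump_GDERIV[of k 0 t z]] by (simp add: k1_def numeral_2_eq_2)
  then have m: "(\<lambda>z. grad (mollifier e) z \<bullet> b) = (\<lambda>z. ?k z * (z \<bullet> b))" for b :: "real ^ 'n" by simp
  have "GDERIV (\<lambda>z. ?k z * (z \<bullet> b)) z :> ?k z *\<^sub>R b + (z \<bullet> b) *\<^sub>R (k2 z *\<^sub>R z)" for b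
  proof (rule GDERIV_mult)
    show "GDERIV ?k z :> k2 z *\<^sub>R z" unfolding k2_def by (rule radial_bump_GDERIV)
    show "GDERIV (\<lambda>z. z \<bullet> b) z :> b" unfolding gderiv_def by (auto intro!: derivative_eq_intros)
  qed
  then have g: "grad (\<lambda>z. ?k z * (z \<bullet> b)) z = ?k z *\<^sub>R b + (z \<bullet> b) *\<^sub>R (k2 z *\<^sub>R z)" for b by (rule grad_eq)
  show ?thesis unfolding m unfolding g by (simp add: inner_add_left inner_add_right inner_commute mult_ac)
qed

context hamilton_jacobi
begin

lemma difference_L2_compact:
  assumes K: "compact K" "K \<subseteq> ball x0 R" "\<And>x. x \<in> K \<Longrightarrow> g x \<noteq> 0"
  obtains r C where "r > 0" "C \<ge> 0"
    "\<And>h. norm h \<le> r \<Longrightarrow> (LINT x:K|lborel. (norm (g (x + h) - g x))\<^sup>2) \<le> C * (norm h)\<^sup>2"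
proof -
  have "\<forall>x\<in>K. \<exists>rC. fst rC > 0 \<and> snd rC \<ge> 0 \<and>
      (\<forall>h. norm h \<le> fst rC \<longrightarrow> (LINT y:cball x (fst rC)|lborel. (norm (g (y + h) - g y))\<^sup>2) \<le> snd rC * (norm h)\<^sup>2)"
  proof
    fix x assume "x \<in> K"
    then obtain r C where "r > 0" "C \<ge> 0"
      "\<And>h. norm h \<le> r \<Longrightarrow> (LINT y:cball x r|lborel. (norm (g (y + h) - g y))\<^sup>2) \<le> C * (norm h)\<^sup>2"
      using caccioppoli[of x] K by blast
    then show "\<exists>rC. fst rC > 0 \<and> snd rC \<ge> 0 \<and>
      (\<forall>h. norm h \<le> fst rC \<longrightarrow> (LINT y:cball x (fst rC)|lborel. (norm (g (y + h) - g y))\<^sup>2) \<le> snd rC * (norm h)\<^sup>2)"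
      by (intro exI[of _ "(r, C)"]) simp
  qed
  then obtain rC where rC: "\<forall>x\<in>K. fst (rC x) > 0 \<and> snd (rC x) \<ge> 0 \<and>
      (\<forall>h. norm h \<le> fst (rC x) \<longrightarrow> (LINT y:cball x (fst (rC x))|lborel. (norm (g (y + h) - g y))\<^sup>2) \<le> snd (rC x) * (norm h)\<^sup>2)"
    by (rule bchoice[THEN exE])
  define r where "r x = fst (rC x)" for x
  define C where "C x = snd (rC x)" for x
  have r: "r x > 0" "C x \<ge> 0" 
      "norm h \<le> r x \<Longrightarrow> (LINT y:cball x (r x)|lborel. (norm (g (y + h) - g y))\<^sup>2) \<le> C x * (norm h)\<^sup>2" if "x \<in> K" for x h
    using rC that unfolding r_def C_def by blast+
  have "K \<subseteq> (\<Union>x\<in>K. ball x (r x))" using r(1) by force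
  then obtain D where D: "D \<subseteq> K" "finite D" "K \<subseteq> (\<Union>x\<in>D. ball x (r x))"
    using compactE_image[OF K(1), of K "\<lambda>x. ball x (r x)"] by auto
  show ?thesis
  \<comment> \<open>The element 1 keeps the minimum defined if the cover is empty. The estimate
    needs the smallest radius of the cover and the sum of its constants.\<close>
  proof (rule that[of "Min (insert 1 (r ` D))" "\<Sum>x\<in>D. C x"])
    show "Min (insert 1 (r ` D)) > 0" using D r(1) by (subst Min_gr_iff) auto
    show "(\<Sum>x\<in>D. C x) \<ge> 0" using D r(2) by (intro sum_nonneg) auto
    fix h :: "real ^ 'n" assume "norm h \<le> Min (insert 1 (r ` D))"
    then have h: "norm h \<le> r x" if "x \<in> D" for x using D that by simp
    have c: "continuous_on UNIV (\<lambda>x. (norm (g (x + h) - g x))\<^sup>2)"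
      by (intro continuous_intros continuous_on_compose2[OF g_cont]) auto
    have "K \<subseteq> (\<Union>x\<in>D. cball x (r x))" using D(3) ball_subset_cball by blast
    then have "(LINT x:K|lborel. (norm (g (x + h) - g x))\<^sup>2)
        \<le> (\<Sum>d\<in>D. LINT x:cball d (r d)|lborel. (norm (g (x + h) - g x))\<^sup>2)"
      by (intro set_LINT_le_finite_cover D K c) auto
    also have "\<dots> \<le> (\<Sum>d\<in>D. C d * (norm h)\<^sup>2)"
      using D h by (intro sum_mono r(3)) auto
    finally show "(LINT x:K|lborel. (norm (g (x + h) - g x))\<^sup>2) \<le> (\<Sum>x\<in>D. C x) * (norm h)\<^sup>2"
      by (simp add: sum_distrib_right)
  qed
qed

text \<open>Mean-square oscillation of \<open>g\<close> at scale \<open>e\<close>. The exponent is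
  the scaling under which an L^2 bound on difference quotients gives a bound on the integral of
  \<open>Q\<close> independent of \<open>e\<close>: the volume of the ball accounts for
  \<open>CARD('n)\<close> and the squared increment for 2.\<close>

definition Q :: "real \<Rightarrow> real ^ 'n \<Rightarrow> real"
  where "Q e x = (LINT y:cball 0 e|lborel. (norm (g (x - y) - g x))\<^sup>2) / e ^ (CARD('n) + 2)"

lemma Q_nonneg: "e > 0 \<Longrightarrow> Q e x \<ge> 0"
  unfolding Q_def set_lebesgue_integral_def by (intro divide_nonneg_nonneg integral_nonneg_AE) auto

lemma Q_bound:
  assumes K: "compact K" "K \<subseteq> ball x0 R" "\<And>x. x \<in> K \<Longrightarrow> g x \<noteq> 0"
  obtains d C where "d > 0" "\<And>e. 0 < e \<Longrightarrow> set_integrable lborel K (Q e)"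
    "\<And>e. 0 < e \<Longrightarrow> e < d \<Longrightarrow> (LINT x:K|lborel. Q e x) \<le> C"
proof -
  obtain r C where r: "r > 0" "C \<ge> 0"
    "\<And>h. norm h \<le> r \<Longrightarrow> (LINT x:K|lborel. (norm (g (x + h) - g x))\<^sup>2) \<le> C * (norm h)\<^sup>2"
    using difference_L2_compact[OF K] by blast
  let ?f = "\<lambda>x y. (norm (g (x - y) - g x))\<^sup>2"
  have cf: "continuous_on (K \<times> cball 0 e) (\<lambda>(x, y). ?f x y)" for e
    unfolding case_prod_beta by (intro continuous_intros continuous_on_compose2[OF g_cont]) auto
  note fub = Fubini_compact[OF K(1) compact_cball cf]
  show ?thesis
  proof (rule that[OF \<open>r > 0\<close>])
    show "set_integrable lborel K (Q e)" if "0 < e" for e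
      unfolding Q_def by (intro set_integrable_divide fub(1))
    fix e :: real assume e: "0 < e" "e < r"
    have "(LINT x:K|lborel. Q e x) = (LINT x:K|lborel. LINT y:cball 0 e|lborel. ?f x y) / e ^ (CARD('n) + 2)"
      unfolding Q_def by simp
    also have "(LINT x:K|lborel. LINT y:cball 0 e|lborel. ?f x y) = (LINT y:cball 0 e|lborel. LINT x:K|lborel. ?f x y)"
      by (rule fub(2))
    also have "\<dots> \<le> (LINT y:cball (0::real^'n) e|lborel. C * e\<^sup>2)"
    proof (rule set_integral_mono)
      have "continuous_on (cball 0 e \<times> K) (\<lambda>(y, x). ?f x y)"
        unfolding case_prod_beta by (intro continuous_intros continuous_on_compose2[OF g_cont]) auto
      then show "set_integrable lborel (cball 0 e) (\<lambda>y. LINT x:K|lborel. ?f x y)"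
        by (intro Fubini_compact(1) K compact_cball)
      show "set_integrable lborel (cball (0::real^'n) e) (\<lambda>y. C * e\<^sup>2)"
        by (intro set_integrable_continuous compact_cball continuous_on_const)
      fix y :: "real ^ 'n" assume y: "y \<in> cball 0 e"
      have "(LINT x:K|lborel. ?f x y) \<le> C * (norm (- y))\<^sup>2"
        using r(3)[of "- y"] y e by simp
      also have "\<dots> \<le> C * e\<^sup>2" using y r(2) by (intro mult_left_mono power_mono) auto
      finally show "(LINT x:K|lborel. ?f x y) \<le> C * e\<^sup>2" .
    qed
    also have "\<dots> = C * e\<^sup>2 * measure lborel (cball (0::real^'n) e)"
      using emeasure_compact_finite[OF compact_cball, of "0::real^'n" e] by (subst set_integral_const) auto
    also have "\<dots> = C * unit_ball_vol CARD('n) * e ^ (CARD('n) + 2)"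
      using e by (simp add: content_cball power_add power2_eq_square)
    finally show "(LINT x:K|lborel. Q e x) \<le> C * unit_ball_vol CARD('n)"
      using e by (simp add: divide_right_mono)
  qed
qed

text \<open>The derivative of the mollifier has integral zero, so \<open>f x\<close> may be
  subtracted, and Cauchy-Schwarz turns the remaining oscillation into \<open>Q\<close>. The factor
  \<tau> is there for two applications: \<open>f = g\<close> with \<tau> = 1, and \<open>f\<close>
  the flux of \<open>g\<close> minus its linearisation, where \<tau> is small.\<close>

lemma conv_partial_bound:
  obtains C where "C > 0" "\<And>(f :: real ^ 'n \<Rightarrow> real ^ 'n) e b \<tau> x. e > 0 \<Longrightarrow> b \<in> Basis \<Longrightarrow> \<tau> \<ge> 0 \<Longrightarrow> continuous_on UNIV f \<Longrightarrow>
      \<forall>y\<in>cball 0 e. norm (f (x - y) - f x) \<le> \<tau> * norm (g (x - y) - g x) \<Longrightarrow>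
      (norm (conv (\<lambda>z. grad (mollifier e) z \<bullet> b) f x))\<^sup>2 \<le> C * \<tau>\<^sup>2 * Q e x"
proof -
  obtain C where C: "C > 0" "\<And>e (z :: real ^ 'n) b. e > 0 \<Longrightarrow> b \<in> Basis \<Longrightarrow>
    \<bar>grad (mollifier e) z \<bullet> b\<bar> \<le> C / e ^ (CARD('n) + 1)" using mollifier_grad_bound by blast
  show ?thesis
  proof (rule that[of "C\<^sup>2 * unit_ball_vol CARD('n)"])
    show "C\<^sup>2 * unit_ball_vol CARD('n) > 0" using C by simp
    fix f :: "real ^ 'n \<Rightarrow> real ^ 'n" and e b \<tau> x
    assume e: "e > 0" and b: "(b :: real ^ 'n) \<in> Basis" and \<tau>: "\<tau> \<ge> 0" and f: "continuous_on UNIV f"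
      and fg: "\<forall>y\<in>cball 0 e. norm (f (x - y) - f x) \<le> \<tau> * norm (g (x - y) - g x)"
    note k = kernel_partial[OF mollifier_kernel[OF e] b]
    let ?k = "\<lambda>z. grad (mollifier e) z \<bullet> b"
    have ck: "continuous_on T ?k" for T using kernelD(3)[OF k] continuous_on_subset by blast
    have cf: "continuous_on (cball 0 e) (\<lambda>y. f (x - y))"
      by (rule continuous_on_compose2[OF f]) (auto intro!: continuous_intros)
    have cg: "continuous_on (cball 0 e) (\<lambda>y. norm (g (x - y) - g x))"
      by (intro continuous_intros continuous_on_compose2[OF g_cont]) auto
    have "(\<integral>z. ?k z \<partial>lborel) = 0"
      unfolding inner_commute[of _ b]
    proof (rule LINT_directional_derivative[of "mollifier e" "\<lambda>z h. h \<bullet> grad (mollifier e) z" b "cball 0 e"])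
      show "(mollifier e has_derivative (\<lambda>h. h \<bullet> grad (mollifier e) z)) (at z)" for z :: "real ^ 'n"
        using kernelD(2)[OF mollifier_kernel[OF e]] unfolding gderiv_def .
      show "continuous_on UNIV (\<lambda>z. b \<bullet> grad (mollifier e) z)"
        using ck[of UNIV] by (simp add: inner_commute)
    qed (use kernelD(5)[OF mollifier_kernel[OF e]] in auto)
    then have k0: "(LINT z:cball 0 e|lborel. ?k z) = 0"
      using LINT_eq_set_LINT[of "cball 0 e" ?k] kernelD(5)[OF k] by simp
    have kc: "(LINT y:cball 0 e|lborel. ?k y *\<^sub>R f x) = 0"
      using integral_scaleR_left[of "f x" lborel "\<lambda>y. indicator (cball 0 e) y *\<^sub>R ?k y"]
        set_integrable_continuous[OF compact_cball ck, of 0 e] k0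
      by (simp add: set_lebesgue_integral_def set_integrable_def)
    define J where "J = (LINT y:cball 0 e|lborel. norm (g (x - y) - g x))"
    have "conv ?k f x = (LINT y:cball 0 e|lborel. ?k y *\<^sub>R f (x - y)) - (LINT y:cball 0 e|lborel. ?k y *\<^sub>R f x)"
      using conv_alt[OF kernelD(3,5)[OF k] f] kc by simp
    also have "\<dots> = (LINT y:cball 0 e|lborel. ?k y *\<^sub>R f (x - y) - ?k y *\<^sub>R f x)"
      by (intro set_integral_diff(2)[symmetric] set_integrable_continuous compact_cball continuous_on_scaleR ck cf continuous_on_const)
    also have "norm \<dots> \<le> (LINT y:cball 0 e|lborel. (C / e ^ (CARD('n) + 1) * \<tau>) * norm (g (x - y) - g x))"
      unfolding set_lebesgue_integral_def
    proof (rule order_trans[OF integral_norm_bound], rule integral_mono)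
      show "integrable lborel (\<lambda>y. norm (indicat_real (cball 0 e) y *\<^sub>R (?k y *\<^sub>R f (x - y) - ?k y *\<^sub>R f x)))"
        by (intro integrable_norm borel_integrable_compact compact_cball continuous_on_diff continuous_on_scaleR ck cf continuous_on_const)
      show "integrable lborel (\<lambda>y. indicat_real (cball 0 e) y *\<^sub>R ((C / e ^ (CARD('n) + 1) * \<tau>) * norm (g (x - y) - g x)))"
        by (intro borel_integrable_compact compact_cball continuous_on_mult_left cg)
      fix y :: "real ^ 'n"
      show "norm (indicat_real (cball 0 e) y *\<^sub>R (?k y *\<^sub>R f (x - y) - ?k y *\<^sub>R f x))
          \<le> indicat_real (cball 0 e) y *\<^sub>R ((C / e ^ (CARD('n) + 1) * \<tau>) * norm (g (x - y) - g x))"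
      proof (cases "y \<in> cball 0 e")
        case True
        have "norm (?k y *\<^sub>R (f (x - y) - f x)) \<le> (C / e ^ (CARD('n) + 1)) * (\<tau> * norm (g (x - y) - g x))"
          unfolding norm_scaleR by (rule mult_mono) (use C(2)[OF e b] fg[rule_format, OF True] C(1) e in auto)
        then show ?thesis using True by (simp add: scaleR_diff_right mult.assoc)
      qed simp
    qed
    also have "\<dots> = C / e ^ (CARD('n) + 1) * \<tau> * J" unfolding J_def by (rule set_integral_mult_right)
    finally have "(norm (conv ?k f x))\<^sup>2 \<le> (C / e ^ (CARD('n) + 1) * \<tau> * J)\<^sup>2"
      by (intro power_mono) auto
    also have "\<dots> = (C / e ^ (CARD('n) + 1) * \<tau>)\<^sup>2 * J\<^sup>2" by (rule power_mult_distrib)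
    also have "\<dots> \<le> (C / e ^ (CARD('n) + 1) * \<tau>)\<^sup>2 * (measure lborel (cball (0::real^'n) e) * (LINT y:cball 0 e|lborel. (norm (g (x - y) - g x))\<^sup>2))"
      unfolding J_def by (intro mult_left_mono LINT_square_le compact_cball cg) (use e in auto)
    \<comment> \<open>With n the dimension, the squared kernel bound gives e^(-2n-2) and the volume
      e^n; together they give the normalisation of \<open>Q\<close>.\<close>
    also have "\<dots> = C\<^sup>2 * unit_ball_vol CARD('n) * \<tau>\<^sup>2 * Q e x"
    proof -
      define w where "w = e ^ CARD('n)"
      define I where "I = (LINT y:cball 0 e|lborel. (norm (g (x - y) - g x))\<^sup>2)"
      have "w > 0" using e by (simp add: w_def)
      then show ?thesis using e unfolding Q_def power_add I_def[symmetric]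
        by (simp add: content_cball w_def[symmetric] field_simps power2_eq_square)
    qed
    finally show "(norm (conv ?k f x))\<^sup>2 \<le> C\<^sup>2 * unit_ball_vol CARD('n) * \<tau>\<^sup>2 * Q e x" .
  qed
qed

text \<open>The derivative of the mollification of \<open>f\<close>, written with the derivatives on
  the kernel so that it makes sense for merely continuous \<open>f\<close>.\<close>

definition D :: "real \<Rightarrow> (real ^ 'n \<Rightarrow> real ^ 'n) \<Rightarrow> real ^ 'n \<Rightarrow> real ^ 'n \<Rightarrow> real ^ 'n"
  where "D e f x h = (\<Sum>b\<in>Basis. (h \<bullet> b) *\<^sub>R conv (\<lambda>z. grad (mollifier e) z \<bullet> b) f x)"

lemma D_Basis: "b \<in> Basis \<Longrightarrow> D e f x b = conv (\<lambda>z. grad (mollifier e) z \<bullet> b) f x"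
proof -
  assume b: "b \<in> Basis"
  have "D e f x b = (\<Sum>b'\<in>Basis. (if b' = b then conv (\<lambda>z. grad (mollifier e) z \<bullet> b) f x else 0))"
    unfolding D_def using b by (intro sum.cong) (auto simp: inner_Basis)
  then show ?thesis using b by simp
qed

lemma linear_D: "linear (D e f x)"
  unfolding D_def by (intro linearI) (simp_all add: inner_add_left scaleR_add_left sum.distrib scaleR_sum_right)

lemma D_has_derivative:
  "e > 0 \<Longrightarrow> continuous_on UNIV f \<Longrightarrow> (conv (mollifier e) f has_derivative D e f x) (at x)"
  using conv_kernel_has_derivative[OF mollifier_kernel] by (simp add: D_def[abs_def])

lemma D_continuous: "e > 0 \<Longrightarrow> continuous_on UNIV f \<Longrightarrow> b \<in> Basis \<Longrightarrow> continuous_on T (\<lambda>x. D e f x b)"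
  by (simp add: D_Basis conv_kernel_continuous[OF kernel_partial[OF mollifier_kernel]])

text \<open>No derivative of \<open>g\<close> is available; integrating by parts, both sides become integrals of \<open>u\<close> against
  a second derivative of the mollifier.\<close>

lemma D_symmetric:
  assumes e: "e > 0" and x: "cball x e \<subseteq> ball x0 R"
  shows "D e g x h \<bullet> k = h \<bullet> D e g x k"
proof (rule symmetric_on_Basis[OF linear_D])
  have *: "D e g x c \<bullet> b = (LINT y:cball x e|lborel. u y * (grad (\<lambda>z. grad (mollifier e) z \<bullet> c) (x - y) \<bullet> b))"
    if c: "c \<in> Basis" and b: "b \<in> Basis" for b c
  proof -
    note k = kernel_partial[OF mollifier_kernel[OF e] c]
    let ?k = "\<lambda>z. grad (mollifier e) z \<bullet> c"
    let ?f' = "\<lambda>y. ?k (x - y) *\<^sub>R g y + u y *\<^sub>R (- grad ?k (x - y))"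
    have kx: "GDERIV (\<lambda>y. ?k (x - y)) y :> - grad ?k (x - y)" for y
    proof -
      have "((\<lambda>y. ?k (x - y)) has_derivative (\<lambda>h. (- h) \<bullet> grad ?k (x - y))) (at y)"
      proof (rule has_derivative_compose[of "\<lambda>y. x - y" "\<lambda>h. - h"])
        show "((\<lambda>y. x - y) has_derivative (\<lambda>h. - h)) (at y)" by (auto intro!: derivative_eq_intros)
      qed (use kernelD(2)[OF k] in \<open>simp add: gderiv_def\<close>)
      then show ?thesis by (simp add: gderiv_def)
    qed
    have ck: "continuous_on T (\<lambda>y. ?k (x - y))" for T
      by (rule continuous_on_compose2[OF kernelD(3)[OF k]]) (auto intro!: continuous_intros)
    have cgk: "continuous_on T (\<lambda>y. grad ?k (x - y))" for T
      by (rule continuous_on_compose2[OF kernelD(4)[OF k]]) (auto intro!: continuous_intros)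
    have cg: "continuous_on T g" for T using continuous_on_subset[OF g_cont subset_UNIV] .
    have cf': "continuous_on (ball x0 R) ?f'"
      by (intro continuous_on_add continuous_on_scaleR continuous_on_minus ck cgk cg u_cont)
    have "(LINT y:cball x e|lborel. \<Sum>b'\<in>Basis. ((b' \<bullet> ?f' y) *\<^sub>R b) \<bullet> b') = 0"
    proof (rule LINT_divergence[OF open_ball compact_cball x, where X = "\<lambda>y. (?k (x - y) * u y) *\<^sub>R b"])
      show "(?k (x - y) * u y) *\<^sub>R b = 0" if "y \<in> ball x0 R - cball x e" for y
        using kernelD(5)[OF k, of "x - y"] that by (auto simp: dist_norm norm_minus_commute)
      show "((\<lambda>y. (?k (x - y) * u y) *\<^sub>R b) has_derivative (\<lambda>h. (h \<bullet> ?f' y) *\<^sub>R b)) (at y)" if "y \<in> ball x0 R" for y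
        using GDERIV_mult[OF kx u_der[OF that]] unfolding gderiv_def by (rule has_derivative_scaleR_left)
      show "continuous_on (ball x0 R) (\<lambda>y. (b' \<bullet> ?f' y) *\<^sub>R b)" for b' :: "real ^ 'n"
        by (intro continuous_on_scaleR continuous_on_inner continuous_on_const cf')
    qed
    moreover have "(\<Sum>b'\<in>Basis. ((b' \<bullet> ?f' y) *\<^sub>R b) \<bullet> b') = ?k (x - y) * (g y \<bullet> b) - u y * (grad ?k (x - y) \<bullet> b)" for y
    proof -
      have "(\<Sum>b'\<in>Basis. ((b' \<bullet> ?f' y) *\<^sub>R b) \<bullet> b') = ?f' y \<bullet> b"
        by (subst euclidean_inner) (simp add: inner_commute)
      then show ?thesis by (simp add: inner_add_left inner_diff_left)
    qed
    ultimately have "(LINT y:cball x e|lborel. ?k (x - y) * (g y \<bullet> b) - u y * (grad ?k (x - y) \<bullet> b)) = 0" by simp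
    moreover have "set_integrable lborel (cball x e) (\<lambda>y. ?k (x - y) * (g y \<bullet> b))"
      by (intro set_integrable_continuous compact_cball continuous_on_mult continuous_on_inner ck cg continuous_on_const)
    moreover have "set_integrable lborel (cball x e) (\<lambda>y. u y * (grad ?k (x - y) \<bullet> b))"
      by (intro set_integrable_continuous compact_cball continuous_on_mult continuous_on_inner continuous_on_subset[OF u_cont x] cgk continuous_on_const)
    ultimately have "(LINT y:cball x e|lborel. ?k (x - y) * (g y \<bullet> b)) = (LINT y:cball x e|lborel. u y * (grad ?k (x - y) \<bullet> b))"
      by simp
    moreover have "D e g x c \<bullet> b = (LINT y:cball x e|lborel. ?k (x - y) * (g y \<bullet> b))"
    proof -
      have "D e g x c \<bullet> b = conv ?k (\<lambda>y. g y \<bullet> b) x"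
        unfolding D_Basis[OF c] by (rule conv_inner[OF kernelD(3,5)[OF k] g_cont])
      also have "\<dots> = (LINT y:cball x e|lborel. ?k (x - y) * (g y \<bullet> b))"
        unfolding conv_def real_scaleR_def
        by (rule LINT_eq_set_LINT) (use kernelD(5)[OF k] in \<open>simp add: dist_norm\<close>)
      finally show ?thesis .
    qed
    ultimately show ?thesis by simp
  qed
  fix b c :: "real ^ 'n" assume "b \<in> Basis" "c \<in> Basis"
  then show "D e g x b \<bullet> c = D e g x c \<bullet> b"
    unfolding *[OF \<open>b \<in> Basis\<close> \<open>c \<in> Basis\<close>] *[OF \<open>c \<in> Basis\<close> \<open>b \<in> Basis\<close>]
    by (simp only: mollifier_hessian_symmetric[of e b _ c])
qed

end

section \<open>Integral identities\<close>

lemma has_derivative_continuous_on_open: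
  assumes "\<And>x. x \<in> U \<Longrightarrow> (f has_derivative f' x) (at x)"
  shows "continuous_on U f"
  by (intro continuous_at_imp_continuous_on ballI has_derivative_continuous[OF assms])

text \<open>The integrand is the divergence of |\<xi>|^q \<phi> \<xi>. Added to the Bochner
  identity, it leaves only the small difference |\<xi>|^q - tr L in front of
  \<open>\<phi> tr B + \<xi> \<bullet> \<phi>'\<close>.\<close>

lemma hamiltonian_divergence:
  fixes \<xi> :: "'a::euclidean_space \<Rightarrow> 'a"
  assumes UK: "open U" "compact K" "K \<subseteq> U"
    and \<xi>: "\<And>x. x \<in> U \<Longrightarrow> (\<xi> has_derivative B x) (at x)" "\<And>x. x \<in> U \<Longrightarrow> \<xi> x \<noteq> 0"
      "\<And>b. b \<in> Basis \<Longrightarrow> continuous_on U (\<lambda>x. B x b)"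
    and \<phi>: "\<And>x. x \<in> U \<Longrightarrow> GDERIV \<phi> x :> \<phi>' x" "continuous_on U \<phi>'" "\<And>x. x \<in> U - K \<Longrightarrow> \<phi> x = 0"
  shows "set_integrable lborel K (\<lambda>x. norm (\<xi> x) powr q * (\<phi> x * tr (B x) + \<xi> x \<bullet> \<phi>' x)
    + \<phi> x * (q * norm (\<xi> x) powr (q - 2) * (B x (\<xi> x) \<bullet> \<xi> x)))
    \<and> (LINT x:K|lborel. norm (\<xi> x) powr q * (\<phi> x * tr (B x) + \<xi> x \<bullet> \<phi>' x)
    + \<phi> x * (q * norm (\<xi> x) powr (q - 2) * (B x (\<xi> x) \<bullet> \<xi> x))) = 0"
proof -
  have c\<xi>: "continuous_on U \<xi>" using has_derivative_continuous_on_open[OF \<xi>(1)] .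
  have c\<phi>: "continuous_on U \<phi>" using has_derivative_continuous_on_open[OF \<phi>(1)[unfolded gderiv_def]] .
  have lin: "linear (B x)" if "x \<in> U" for x using \<xi>(1)[OF that] has_derivative_linear by blast
  let ?N = "\<lambda>x. norm (\<xi> x) powr q"
  let ?N' = "\<lambda>x h. B x h \<bullet> ((q * norm (\<xi> x) powr (q - 2)) *\<^sub>R \<xi> x)"
  let ?X' = "\<lambda>x h. (?N x * \<phi> x) *\<^sub>R B x h + (?N x * (h \<bullet> \<phi>' x) + ?N' x h * \<phi> x) *\<^sub>R \<xi> x"
  show ?thesis
  proof (rule LINT_divergence_eq[OF UK, where X = "\<lambda>x. (?N x * \<phi> x) *\<^sub>R \<xi> x"])
    show "((\<lambda>x. (?N x * \<phi> x) *\<^sub>R \<xi> x) has_derivative ?X' x) (at x)" if x: "x \<in> U" for x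
    proof (rule has_derivative_scaleR[OF has_derivative_mult \<xi>(1)[OF x]])
      show "(?N has_derivative ?N' x) (at x)"
        using has_derivative_compose[OF \<xi>(1)[OF x] norm_powr_GDERIV[OF \<xi>(2)[OF x], unfolded gderiv_def]] .
      show "(\<phi> has_derivative (\<lambda>h. h \<bullet> \<phi>' x)) (at x)" using \<phi>(1)[OF x] unfolding gderiv_def .
    qed
    show "continuous_on U (\<lambda>x. ?X' x b)" if b: "b \<in> Basis" for b
      using \<xi>(2) by (intro continuous_intros c\<xi> c\<phi> \<xi>(3)[OF b] \<phi>(2)) auto
    show "(\<Sum>b\<in>Basis. ?X' x b \<bullet> b) = ?N x * (\<phi> x * tr (B x) + \<xi> x \<bullet> \<phi>' x)
    + \<phi> x * (q * norm (\<xi> x) powr (q - 2) * (B x (\<xi> x) \<bullet> \<xi> x))" if x: "x \<in> K" for x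
  proof -
    have "(\<Sum>b\<in>Basis. ?X' x b \<bullet> b) = ?N x * \<phi> x * tr (B x) + ?N x * (\<Sum>b\<in>Basis. (\<xi> x \<bullet> b) * (\<phi>' x \<bullet> b))
        + \<phi> x * (q * norm (\<xi> x) powr (q - 2)) * (\<Sum>b\<in>Basis. (\<xi> x \<bullet> B x b) * (\<xi> x \<bullet> b))"
      unfolding tr_def sum_distrib_left sum.distrib[symmetric]
      by (intro sum.cong refl) (simp add: inner_add_left inner_commute algebra_simps)
    also have "(\<Sum>b\<in>Basis. (\<xi> x \<bullet> b) * (\<phi>' x \<bullet> b)) = \<xi> x \<bullet> \<phi>' x"
      by (rule euclidean_inner[symmetric])
    also have "(\<Sum>b\<in>Basis. (\<xi> x \<bullet> B x b) * (\<xi> x \<bullet> b)) = \<xi> x \<bullet> B x (\<xi> x)"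
      using x UK(3) by (intro sum_Basis_linear lin) auto
    finally show ?thesis by (simp add: inner_commute algebra_simps)
  qed
  qed (use \<phi>(3) in auto)
qed

text \<open>The integrand is the divergence of \<phi> J. Symmetry of \<open>B\<close> allows both
  cross terms with \<open>lv\<close> to be written as \<open>B \<xi> \<bullet> lv\<close>.\<close>

lemma J_divergence:
  fixes \<xi> lv :: "'a::euclidean_space \<Rightarrow> 'a" and p k :: real
  assumes UK: "open U" "compact K" "K \<subseteq> U"
    and \<xi>: "\<And>x. x \<in> U \<Longrightarrow> (\<xi> has_derivative B x) (at x)" "\<And>x. x \<in> U \<Longrightarrow> \<xi> x \<noteq> 0"
      "\<And>b. b \<in> Basis \<Longrightarrow> continuous_on U (\<lambda>x. B x b)"
      "\<And>x h k. x \<in> U \<Longrightarrow> B x h \<bullet> k = h \<bullet> B x k"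
    and l: "\<And>x. x \<in> U \<Longrightarrow> (lv has_derivative Dl x) (at x)" "\<And>b. b \<in> Basis \<Longrightarrow> continuous_on U (\<lambda>x. Dl x b)"
    and \<phi>: "\<And>x. x \<in> U \<Longrightarrow> GDERIV \<phi> x :> \<phi>' x" "continuous_on U \<phi>'" "\<And>x. x \<in> U - K \<Longrightarrow> \<phi> x = 0"
  defines "J \<equiv> \<lambda>x. (\<xi> x \<bullet> \<xi> x) powr k *\<^sub>R lv x + ((p - 2) * (\<xi> x \<bullet> \<xi> x) powr (k - 1) * (\<xi> x \<bullet> lv x)) *\<^sub>R \<xi> x"
  shows "set_integrable lborel K (\<lambda>x. J x \<bullet> \<phi>' x + \<phi> x * divJ p k (\<xi> x) (B x) (lv x) (Dl x))
    \<and> (LINT x:K|lborel. J x \<bullet> \<phi>' x + \<phi> x * divJ p k (\<xi> x) (B x) (lv x) (Dl x)) = 0"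
proof -
  have c\<xi>: "continuous_on U \<xi>" using has_derivative_continuous_on_open[OF \<xi>(1)] .
  have cl: "continuous_on U lv" using has_derivative_continuous_on_open[OF l(1)] .
  have c\<phi>: "continuous_on U \<phi>" using has_derivative_continuous_on_open[OF \<phi>(1)[unfolded gderiv_def]] .
  have lin: "linear (B x)" if "x \<in> U" for x using \<xi>(1)[OF that] has_derivative_linear by blast
  have linD: "linear (Dl x)" if "x \<in> U" for x using l(1)[OF that] has_derivative_linear by blast
  let ?z = "\<lambda>x. \<xi> x \<bullet> \<xi> x"
  define P where "P r x h = r * ?z x powr (r - 1) * (2 * (\<xi> x \<bullet> B x h))" for r x h
  have P: "((\<lambda>x. ?z x powr r) has_derivative P r x) (at x)" if x: "x \<in> U" for r x
  proof -
    have z: "?z x > 0" using \<xi>(2)[OF x] by simp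
    have "((\<lambda>x. ?z x powr r) has_derivative
        (\<lambda>h. ?z x powr r * (0 * ln (?z x) + (\<xi> x \<bullet> B x h + B x h \<bullet> \<xi> x) * r / ?z x))) (at x)"
      by (rule has_derivative_powr[OF has_derivative_inner[OF \<xi>(1)[OF x] \<xi>(1)[OF x]] has_derivative_const z]) simp
    then show ?thesis
      by (rule has_derivative_eq_rhs) (use z in \<open>simp add: P_def fun_eq_iff powr_diff inner_commute\<close>)
  qed
  let ?q = "\<lambda>x. (p - 2) * (?z x powr (k - 1) * (\<xi> x \<bullet> lv x))"
  let ?q' = "\<lambda>x h. (p - 2) * (?z x powr (k - 1) * (\<xi> x \<bullet> Dl x h + B x h \<bullet> lv x) + P (k - 1) x h * (\<xi> x \<bullet> lv x))"
  let ?J' = "\<lambda>x h. (?z x powr k *\<^sub>R Dl x h + P k x h *\<^sub>R lv x) + (?q x *\<^sub>R B x h + ?q' x h *\<^sub>R \<xi> x)"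
  let ?X' = "\<lambda>x h. \<phi> x *\<^sub>R ?J' x h + (h \<bullet> \<phi>' x) *\<^sub>R J x"
  have J: "(J has_derivative ?J' x) (at x)" if x: "x \<in> U" for x
  proof -
    have "((\<lambda>x. ?z x powr k *\<^sub>R lv x + ?q x *\<^sub>R \<xi> x) has_derivative ?J' x) (at x)"
      by (intro has_derivative_add has_derivative_scaleR has_derivative_mult has_derivative_mult_right
          has_derivative_inner P l(1) \<xi>(1) x)
    then show ?thesis unfolding J_def by (simp add: mult.assoc)
  qed
  have cP: "continuous_on U (\<lambda>x. P r x b)" if "b \<in> Basis" for r b
    unfolding P_def using \<xi>(2) by (intro continuous_intros c\<xi> \<xi>(3)[OF that]) auto
  show ?thesis
  proof (rule LINT_divergence_eq[OF UK, where X = "\<lambda>x. \<phi> x *\<^sub>R J x"])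
    show "((\<lambda>x. \<phi> x *\<^sub>R J x) has_derivative ?X' x) (at x)" if x: "x \<in> U" for x
      using \<phi>(1)[OF x] J[OF x] unfolding gderiv_def by (rule has_derivative_scaleR)
    show "continuous_on U (\<lambda>x. ?X' x b)" if b: "b \<in> Basis" for b
      using \<xi>(2) has_derivative_continuous_on_open[OF J]
      by (intro continuous_intros c\<xi> c\<phi> cl cP \<xi>(3)[OF b] l(2)[OF b] \<phi>(2) b) auto
    show "(\<Sum>b\<in>Basis. ?X' x b \<bullet> b) = J x \<bullet> \<phi>' x + \<phi> x * divJ p k (\<xi> x) (B x) (lv x) (Dl x)" if x: "x \<in> K" for x
  proof -
    have xU: "x \<in> U" using x UK(3) by blast
    let ?z0 = "?z x powr k" and ?z1 = "?z x powr (k - 1)" and ?z2 = "?z x powr (k - 1 - 1)"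
    let ?s = "\<xi> x \<bullet> lv x"
    have s1: "(\<Sum>b\<in>Basis. (\<xi> x \<bullet> B x b) * (lv x \<bullet> b)) = B x (\<xi> x) \<bullet> lv x"
      using sum_Basis_linear[OF lin[OF xU], of "\<xi> x" "lv x"] \<xi>(4)[OF xU] by simp
    have s2: "(\<Sum>b\<in>Basis. (\<xi> x \<bullet> B x b) * (\<xi> x \<bullet> b)) = B x (\<xi> x) \<bullet> \<xi> x"
      using sum_Basis_linear[OF lin[OF xU], of "\<xi> x" "\<xi> x"] by (simp add: inner_commute)
    have s3: "(\<Sum>b\<in>Basis. (lv x \<bullet> B x b) * (\<xi> x \<bullet> b)) = B x (\<xi> x) \<bullet> lv x"
      using sum_Basis_linear[OF lin[OF xU], of "lv x" "\<xi> x"] by (simp add: inner_commute)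
    have s4: "(\<Sum>b\<in>Basis. (\<xi> x \<bullet> Dl x b) * (\<xi> x \<bullet> b)) = \<xi> x \<bullet> Dl x (\<xi> x)"
      using sum_Basis_linear[OF linD[OF xU], of "\<xi> x" "\<xi> x"] .
    have s5: "(\<Sum>b\<in>Basis. (J x \<bullet> b) * (\<phi>' x \<bullet> b)) = J x \<bullet> \<phi>' x" by (simp add: euclidean_inner[symmetric])
    have "(\<Sum>b\<in>Basis. ?X' x b \<bullet> b) =
        \<phi> x * (?z0 * tr (Dl x) + (2 * k * ?z1) * (\<Sum>b\<in>Basis. (\<xi> x \<bullet> B x b) * (lv x \<bullet> b))
          + ((p - 2) * ?z1 * ?s) * tr (B x)
          + ((p - 2) * ?z1) * (\<Sum>b\<in>Basis. (\<xi> x \<bullet> Dl x b) * (\<xi> x \<bullet> b))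
          + ((p - 2) * ?z1) * (\<Sum>b\<in>Basis. (lv x \<bullet> B x b) * (\<xi> x \<bullet> b))
          + ((p - 2) * (2 * (k - 1)) * ?z2 * ?s) * (\<Sum>b\<in>Basis. (\<xi> x \<bullet> B x b) * (\<xi> x \<bullet> b)))
        + (\<Sum>b\<in>Basis. (J x \<bullet> b) * (\<phi>' x \<bullet> b))"
      unfolding tr_def sum_distrib_left sum.distrib[symmetric] P_def
      by (intro sum.cong refl) (simp add: inner_add_left inner_commute algebra_simps)
    also have "\<dots> = J x \<bullet> \<phi>' x + \<phi> x * divJ p k (\<xi> x) (B x) (lv x) (Dl x)"
      unfolding s1 s2 s3 s4 s5 divJ_def Let_def by (simp add: algebra_simps)
    finally show ?thesis .
  qed
  qed (use \<phi>(3) in auto)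
qed

context hamilton_jacobi
begin

lemma tr_D_flux:
  assumes "e > 0" "cball x e \<subseteq> ball x0 R"
  shows "tr (D e F x) = conv (mollifier e) H x"
  unfolding tr_def using conv_flux_div[OF mollifier_kernel[OF assms(1)] assms(2)] by (simp add: D_Basis)

text \<open>On \<open>K\<close> the integrand is the divergence of \<phi> (L \<xi> - (tr L) \<xi>).
  Differentiating the first part pairs \<xi> with the gradient of the divergence of the mollified
  flux, the second pairs it with the gradient of \<open>tr L\<close>; these agree and cancel, so no
  second derivative of the flux remains.\<close>

lemma bochner_identity:
  assumes e: "e > 0" and UK: "open U" "compact K" "K \<subseteq> U" "\<And>x. x \<in> U \<Longrightarrow> cball x e \<subseteq> ball x0 R"
    and \<phi>: "\<And>x. x \<in> U \<Longrightarrow> GDERIV \<phi> x :> \<phi>' x" "continuous_on U \<phi>'" "\<And>x. x \<in> U - K \<Longrightarrow> \<phi> x = 0"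
  defines "\<xi> \<equiv> conv (mollifier e) g" and "B \<equiv> D e g" and "L \<equiv> D e F"
  shows "set_integrable lborel K (\<lambda>x. \<phi> x * (\<Sum>b\<in>Basis. B x b \<bullet> L x b) + L x (\<xi> x) \<bullet> \<phi>' x
    - tr (L x) * (\<phi> x * tr (B x) + \<xi> x \<bullet> \<phi>' x))
    \<and> (LINT x:K|lborel. \<phi> x * (\<Sum>b\<in>Basis. B x b \<bullet> L x b) + L x (\<xi> x) \<bullet> \<phi>' x
    - tr (L x) * (\<phi> x * tr (B x) + \<xi> x \<bullet> \<phi>' x)) = 0"
proof -
  define k where "k b = (\<lambda>z::real^'n. grad (mollifier e) z \<bullet> b)" for b
  have kk: "kernel e (k b)" if "b \<in> Basis" for b
    unfolding k_def by (rule kernel_partial[OF mollifier_kernel[OF e] that])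
  define Y where "Y b = conv (k b) F" for b
  define Y' where "Y' b x h = (\<Sum>c\<in>Basis. (h \<bullet> c) *\<^sub>R conv (\<lambda>z. grad (k b) z \<bullet> c) F x)" for b x h
  define He where "He = conv (mollifier e) H"
  define He' where "He' x h = (\<Sum>c\<in>Basis. (h \<bullet> c) *\<^sub>R conv (k c) H x)" for x h
  have Y_der: "(Y b has_derivative Y' b x) (at x)" if "b \<in> Basis" for b x
    using conv_kernel_has_derivative[OF kk[OF that] F_cont] by (simp add: Y_def Y'_def[abs_def])
  have He_der: "(He has_derivative He' x) (at x)" for x
    using conv_kernel_has_derivative[OF mollifier_kernel[OF e] H_cont] by (simp add: He_def He'_def[abs_def] k_def)
  have \<xi>_der: "(\<xi> has_derivative B x) (at x)" for x
    unfolding \<xi>_def B_def by (rule D_has_derivative[OF e g_cont])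
  have c\<xi>: "continuous_on T \<xi>" for T
    unfolding \<xi>_def by (rule conv_kernel_continuous[OF mollifier_kernel[OF e] g_cont])
  have cHe: "continuous_on T He" for T
    unfolding He_def by (rule conv_kernel_continuous[OF mollifier_kernel[OF e] H_cont])
  have cY: "continuous_on T (Y b)" if "b \<in> Basis" for T b
    unfolding Y_def by (rule conv_kernel_continuous[OF kk[OF that] F_cont])
  have cY': "continuous_on T (\<lambda>x. Y' b x h)" if "b \<in> Basis" for T b h
    unfolding Y'_def by (intro continuous_intros conv_kernel_continuous[OF kernel_partial[OF kk[OF that]] F_cont])
  have cHe': "continuous_on T (\<lambda>x. He' x h)" for T h
    unfolding He'_def by (intro continuous_intros conv_kernel_continuous[OF kk H_cont])
  have cB: "continuous_on T (\<lambda>x. B x b)" if "b \<in> Basis" for T b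
    unfolding B_def by (rule D_continuous[OF e g_cont that])
  have c\<phi>: "continuous_on U \<phi>" using has_derivative_continuous_on_open[OF \<phi>(1)[unfolded gderiv_def]] .
  have Y'_b: "Y' b x c = conv (\<lambda>z. grad (k b) z \<bullet> c) F x" if "c \<in> Basis" for b x c
  proof -
    have "Y' b x c = (\<Sum>c'\<in>Basis. (if c' = c then conv (\<lambda>z. grad (k b) z \<bullet> c) F x else 0))"
      unfolding Y'_def using that by (intro sum.cong) (auto simp: inner_Basis)
    then show ?thesis using that by simp
  qed
  have He'_b: "He' x c = conv (k c) H x" if "c \<in> Basis" for x c
  proof -
    have "He' x c = (\<Sum>c'\<in>Basis. (if c' = c then conv (k c) H x else 0))"
      unfolding He'_def using that by (intro sum.cong) (auto simp: inner_Basis)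
    then show ?thesis using that by simp
  qed
  have LY: "L x b = Y b x" if "b \<in> Basis" for x b
    using that by (simp add: L_def D_Basis Y_def k_def)
  have L\<xi>: "L x (\<xi> x) = (\<Sum>b\<in>Basis. (\<xi> x \<bullet> b) *\<^sub>R Y b x)" for x
    by (simp add: L_def D_def Y_def k_def)
  let ?V = "\<lambda>x. \<Sum>b\<in>Basis. (\<xi> x \<bullet> b) *\<^sub>R Y b x"
  let ?V' = "\<lambda>x h. \<Sum>b\<in>Basis. (\<xi> x \<bullet> b) *\<^sub>R Y' b x h + (B x h \<bullet> b) *\<^sub>R Y b x"
  let ?X' = "\<lambda>x h. (\<phi> x *\<^sub>R ?V' x h + (h \<bullet> \<phi>' x) *\<^sub>R ?V x)
    - ((\<phi> x * He x) *\<^sub>R B x h + (\<phi> x * He' x h + (h \<bullet> \<phi>' x) * He x) *\<^sub>R \<xi> x)"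
  show ?thesis
  proof (rule LINT_divergence_eq[OF UK(1-3), where X = "\<lambda>x. \<phi> x *\<^sub>R ?V x - (\<phi> x * He x) *\<^sub>R \<xi> x"])
    show "((\<lambda>x. \<phi> x *\<^sub>R ?V x - (\<phi> x * He x) *\<^sub>R \<xi> x) has_derivative ?X' x) (at x)" if x: "x \<in> U" for x
      by (intro has_derivative_diff has_derivative_scaleR has_derivative_sum has_derivative_mult
          \<phi>(1)[OF x, unfolded gderiv_def] Y_der He_der \<xi>_der has_derivative_inner_left)
    show "continuous_on U (\<lambda>x. ?X' x b)" if b: "b \<in> Basis" for b
      by (intro continuous_intros c\<xi> c\<phi> cHe cHe' cY cY' cB[OF b] \<phi>(2))
    show "(\<Sum>b\<in>Basis. ?X' x b \<bullet> b) = \<phi> x * (\<Sum>b\<in>Basis. B x b \<bullet> L x b) + L x (\<xi> x) \<bullet> \<phi>' x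
    - tr (L x) * (\<phi> x * tr (B x) + \<xi> x \<bullet> \<phi>' x)" if x: "x \<in> K" for x
  proof -
    have cb: "cball x e \<subseteq> ball x0 R" using x UK by blast
    have trL: "tr (L x) = He x" unfolding L_def He_def by (rule tr_D_flux[OF e cb])
    \<comment> \<open>Symmetry of \<open>B\<close> turns the trace of the composition into a sum
      over matching columns of \<open>B\<close> and \<open>L\<close>.\<close>
    have v1: "(\<Sum>c\<in>Basis. \<Sum>b\<in>Basis. (B x c \<bullet> b) * (Y b x \<bullet> c)) = (\<Sum>b\<in>Basis. B x b \<bullet> L x b)"
    proof -
      have "(\<Sum>c\<in>Basis. \<Sum>b\<in>Basis. (B x c \<bullet> b) * (Y b x \<bullet> c)) = (\<Sum>b\<in>Basis. \<Sum>c\<in>Basis. (B x b \<bullet> c) * (Y b x \<bullet> c))"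
        using D_symmetric[OF e cb] by (subst sum.swap) (simp add: B_def inner_commute)
      then show ?thesis by (simp add: LY euclidean_inner[symmetric])
    qed
    \<comment> \<open>The cancellation: \<open>conv_flux_div\<close> applied to the differentiated
      kernel \<open>k b\<close> says that the b-th derivative of the mollified flux has as its
      divergence the b-th derivative of \<open>He\<close>.\<close>
    have v2: "(\<Sum>c\<in>Basis. \<Sum>b\<in>Basis. (\<xi> x \<bullet> b) * (Y' b x c \<bullet> c)) = (\<Sum>b\<in>Basis. (\<xi> x \<bullet> b) * conv (k b) H x)"
    proof -
      have "(\<Sum>c\<in>Basis. \<Sum>b\<in>Basis. (\<xi> x \<bullet> b) * (Y' b x c \<bullet> c)) = (\<Sum>b\<in>Basis. (\<xi> x \<bullet> b) * (\<Sum>c\<in>Basis. Y' b x c \<bullet> c))"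
        unfolding sum_distrib_left by (rule sum.swap)
      also have "\<dots> = (\<Sum>b\<in>Basis. (\<xi> x \<bullet> b) * conv (k b) H x)"
        using conv_flux_div[OF kk cb] by (intro sum.cong refl) (simp add: Y'_b)
      finally show ?thesis .
    qed
    have v3: "(\<Sum>c\<in>Basis. (?V x \<bullet> c) * (\<phi>' x \<bullet> c)) = L x (\<xi> x) \<bullet> \<phi>' x"
      unfolding L\<xi> by (rule euclidean_inner[symmetric])
    have v4: "(\<Sum>c\<in>Basis. (\<xi> x \<bullet> c) * (\<phi>' x \<bullet> c)) = \<xi> x \<bullet> \<phi>' x"
      by (rule euclidean_inner[symmetric])
    have "(\<Sum>c\<in>Basis. ?X' x c \<bullet> c)
      = \<phi> x * (\<Sum>c\<in>Basis. \<Sum>b\<in>Basis. (\<xi> x \<bullet> b) * (Y' b x c \<bullet> c))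
        + \<phi> x * (\<Sum>c\<in>Basis. \<Sum>b\<in>Basis. (B x c \<bullet> b) * (Y b x \<bullet> c))
        + (\<Sum>c\<in>Basis. (?V x \<bullet> c) * (\<phi>' x \<bullet> c))
        - (\<phi> x * He x) * (\<Sum>c\<in>Basis. B x c \<bullet> c) - \<phi> x * (\<Sum>c\<in>Basis. (\<xi> x \<bullet> c) * He' x c)
        - He x * (\<Sum>c\<in>Basis. (\<xi> x \<bullet> c) * (\<phi>' x \<bullet> c))"
    proof -
      have "?X' x c \<bullet> c = \<phi> x * (\<Sum>b\<in>Basis. (\<xi> x \<bullet> b) * (Y' b x c \<bullet> c)) + \<phi> x * (\<Sum>b\<in>Basis. (B x c \<bullet> b) * (Y b x \<bullet> c))
          + (?V x \<bullet> c) * (\<phi>' x \<bullet> c) - (\<phi> x * He x) * (B x c \<bullet> c) - \<phi> x * ((\<xi> x \<bullet> c) * He' x c)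
          - He x * ((\<xi> x \<bullet> c) * (\<phi>' x \<bullet> c))" for c
        by (simp add: inner_diff_left inner_add_left inner_sum_left sum.distrib algebra_simps inner_commute[of c])
      then show ?thesis by (simp only: sum.distrib sum_subtractf sum_distrib_left)
    qed
    also have "(\<Sum>c\<in>Basis. (\<xi> x \<bullet> c) * He' x c) = (\<Sum>b\<in>Basis. (\<xi> x \<bullet> b) * conv (k b) H x)"
      by (simp add: He'_b)
    finally show ?thesis unfolding v1 v2 v3 v4 trL tr_def[of "B x"] by (simp add: algebra_simps)
  qed
  qed (use \<phi>(3) in auto)
qed

end

section \<open>Convergence of the mollified equation\<close>

text \<open>\<open>T\<close> stands for \<open>dflux p \<xi>\<close>, \<open>h\<close> for |\<xi>|^q
  and \<open>Z\<close> for the weight of the squared defect. Each term is at most quadratic in the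
  derivatives and carries a factor \<tau>; \<open>S \<ge> 1\<close> and
  \<open>\<tau> \<le> 1\<close> bring lower powers of S and higher powers of \<tau> to the common
  form \<tau> S^2.\<close>

lemma error_bound:
  fixes \<xi> d\<phi> :: "'a::euclidean_space" and B L T :: "'a \<Rightarrow> 'a" and \<phi> h S \<tau> A Z :: real
  assumes lin: "linear B" "linear L" "linear T" and \<tau>: "0 \<le> \<tau>" "\<tau> \<le> 1" and S: "S \<ge> 1"
    and B: "\<And>b. b \<in> Basis \<Longrightarrow> norm (B b) \<le> S"
    and E: "\<And>b. b \<in> Basis \<Longrightarrow> norm (L b - T (B b)) \<le> \<tau> * S"
    and A: "\<bar>\<phi>\<bar> \<le> A" "norm \<xi> \<le> A" "norm d\<phi> \<le> A * S" "0 \<le> Z" "Z \<le> A"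
    and h: "\<bar>h - tr L\<bar> \<le> \<tau>"
  defines "N \<equiv> real DIM('a)"
  shows "\<bar>\<phi> * (\<Sum>b\<in>Basis. B b \<bullet> (L b - T (B b))) + (L \<xi> - T (B \<xi>)) \<bullet> d\<phi> + (h - tr L) * (\<phi> * tr B + \<xi> \<bullet> d\<phi>)\<bar>
      + Z * (tr (\<lambda>h. T (B h)) - h)\<^sup>2 \<le> (2 * A * N + N * A\<^sup>2 + A\<^sup>2 + A * (N + 1)\<^sup>2) * \<tau> * S\<^sup>2"
proof -
  define E' where "E' x = L x - T (B x)" for x
  have A0: "A \<ge> 0" using A(1) by linarith
  have N0: "N \<ge> 1" by (simp add: N_def DIM_positive Suc_leI)
  have S0: "S \<ge> 0" using S by simp
  have SS: "S \<le> S\<^sup>2" using S by (simp add: power2_eq_square)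
  have t1: "\<bar>\<phi> * (\<Sum>b\<in>Basis. B b \<bullet> E' b)\<bar> \<le> A * N * \<tau> * S\<^sup>2"
  proof -
    have "\<bar>\<Sum>b\<in>Basis. B b \<bullet> E' b\<bar> \<le> (\<Sum>b\<in>(Basis::'a set). S * (\<tau> * S))"
    proof (rule order_trans[OF sum_abs], rule sum_mono)
      fix b :: 'a assume b: "b \<in> Basis"
      show "\<bar>B b \<bullet> E' b\<bar> \<le> S * (\<tau> * S)"
        by (rule order_trans[OF Cauchy_Schwarz_ineq2], rule mult_mono)
          (use B[OF b] E[OF b] S0 in \<open>auto simp: E'_def\<close>)
    qed
    then have "\<bar>\<Sum>b\<in>Basis. B b \<bullet> E' b\<bar> \<le> N * (S * (\<tau> * S))" by (simp add: N_def)
    then have "\<bar>\<phi>\<bar> * \<bar>\<Sum>b\<in>Basis. B b \<bullet> E' b\<bar> \<le> A * (N * (S * (\<tau> * S)))"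
      using A(1) A0 by (intro mult_mono) auto
    then show ?thesis by (simp add: abs_mult power2_eq_square mult_ac)
  qed
  have t2: "\<bar>E' \<xi> \<bullet> d\<phi>\<bar> \<le> N * A\<^sup>2 * \<tau> * S\<^sup>2"
  proof -
    have lE: "linear E'" unfolding E'_def
      using lin by (intro linear_compose_sub) (auto intro: linear_compose[unfolded o_def])
    have "E' \<xi> = (\<Sum>b\<in>Basis. (\<xi> \<bullet> b) *\<^sub>R E' b)"
      by (rule linear_eq_sum_Basis[OF lE])
    then have "norm (E' \<xi>) \<le> (\<Sum>b\<in>(Basis::'a set). norm ((\<xi> \<bullet> b) *\<^sub>R E' b))"
      using norm_sum[of "\<lambda>b. (\<xi> \<bullet> b) *\<^sub>R E' b" Basis] by simp
    also have "\<dots> \<le> (\<Sum>b\<in>(Basis::'a set). A * (\<tau> * S))"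
    proof (rule sum_mono)
      fix b :: 'a assume b: "b \<in> Basis"
      have "\<bar>\<xi> \<bullet> b\<bar> \<le> A" using Basis_le_norm[OF b, of \<xi>] A(2) by simp
      then show "norm ((\<xi> \<bullet> b) *\<^sub>R E' b) \<le> A * (\<tau> * S)"
        unfolding norm_scaleR using E[OF b] A0 by (intro mult_mono) (auto simp: E'_def)
    qed
    finally have "norm (E' \<xi>) \<le> N * (A * (\<tau> * S))" by (simp add: N_def)
    then have "norm (E' \<xi>) * norm d\<phi> \<le> (N * (A * (\<tau> * S))) * (A * S)"
      using A(3) N0 A0 \<tau> S0 by (intro mult_mono) auto
    then show ?thesis using order_trans[OF Cauchy_Schwarz_ineq2[of "E' \<xi>" d\<phi>]]
      by (simp add: power2_eq_square mult_ac)
  qed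
  have trb: "\<bar>tr V\<bar> \<le> N * a" if "\<And>b. b \<in> Basis \<Longrightarrow> norm (V b) \<le> a" for V :: "'a \<Rightarrow> 'a" and a
  proof -
    have "\<bar>tr V\<bar> \<le> (\<Sum>b\<in>(Basis::'a set). a)"
      unfolding tr_def
    proof (rule order_trans[OF sum_abs], rule sum_mono)
      fix b :: 'a assume b: "b \<in> Basis"
      show "\<bar>V b \<bullet> b\<bar> \<le> a"
        using Basis_le_norm[OF b, of "V b"] that[OF b] by simp
    qed
    then show ?thesis by (simp add: N_def)
  qed
  have t3: "\<bar>(h - tr L) * (\<phi> * tr B + \<xi> \<bullet> d\<phi>)\<bar> \<le> (A * N + A\<^sup>2) * \<tau> * S\<^sup>2"
  proof -
    have "\<bar>\<phi> * tr B\<bar> \<le> A * (N * S)" unfolding abs_mult using A(1) A0 trb[OF B] by (intro mult_mono) auto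
    moreover have "\<bar>\<xi> \<bullet> d\<phi>\<bar> \<le> A * (A * S)"
      using A0 by (intro order_trans[OF Cauchy_Schwarz_ineq2 mult_mono] A(2,3)) auto
    ultimately have "\<bar>\<phi> * tr B + \<xi> \<bullet> d\<phi>\<bar> \<le> (A * N + A\<^sup>2) * S"
      by (simp add: power2_eq_square algebra_simps)
    also have "\<dots> \<le> (A * N + A\<^sup>2) * S\<^sup>2" using SS A0 N0 by (intro mult_left_mono) auto
    finally have "\<bar>h - tr L\<bar> * \<bar>\<phi> * tr B + \<xi> \<bullet> d\<phi>\<bar> \<le> \<tau> * ((A * N + A\<^sup>2) * S\<^sup>2)"
      using h \<tau> by (intro mult_mono) auto
    then show ?thesis by (simp add: abs_mult mult_ac)
  qed
  have t4: "Z * (tr (\<lambda>h. T (B h)) - h)\<^sup>2 \<le> A * (N + 1)\<^sup>2 * \<tau> * S\<^sup>2"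
  proof -
    have "tr (\<lambda>h. T (B h)) = tr L - tr E'" by (simp add: tr_def E'_def inner_diff_left sum_subtractf)
    moreover have "\<bar>tr E'\<bar> \<le> N * (\<tau> * S)" by (rule trb) (simp add: E'_def E)
    moreover have "\<tau> \<le> \<tau> * S" using \<tau> S by (simp add: mult_le_cancel_left1)
    ultimately have "\<bar>tr (\<lambda>h. T (B h)) - h\<bar> \<le> (N + 1) * (\<tau> * S)"
      using h by (simp add: distrib_right)
    then have "\<bar>tr (\<lambda>h. T (B h)) - h\<bar>\<^sup>2 \<le> ((N + 1) * (\<tau> * S))\<^sup>2" by (intro power_mono) auto
    also have "\<dots> = (N + 1)\<^sup>2 * (\<tau> * \<tau>) * S\<^sup>2" by (simp add: power_mult_distrib power2_eq_square)
    also have "\<dots> \<le> (N + 1)\<^sup>2 * (\<tau> * 1) * S\<^sup>2" using \<tau> by (intro mult_right_mono mult_left_mono) auto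
    finally have "Z * (tr (\<lambda>h. T (B h)) - h)\<^sup>2 \<le> A * ((N + 1)\<^sup>2 * (\<tau> * 1) * S\<^sup>2)"
      using A(4,5) A0 by (intro mult_mono) auto
    then show ?thesis by (simp add: mult_ac)
  qed
  have "(2 * A * N + N * A\<^sup>2 + A\<^sup>2 + A * (N + 1)\<^sup>2) * \<tau> * S\<^sup>2
      = A * N * \<tau> * S\<^sup>2 + N * A\<^sup>2 * \<tau> * S\<^sup>2 + (A * N + A\<^sup>2) * \<tau> * S\<^sup>2 + A * (N + 1)\<^sup>2 * \<tau> * S\<^sup>2"
    by (simp add: algebra_simps)
  then show ?thesis using t1 t2 t3 t4 unfolding E'_def[symmetric] by linarith
qed

text \<open>The exponents that occur later may have either sign, hence both end points.\<close>

lemma powr_between: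
  fixes z a b r :: real
  assumes "0 < a" "a \<le> z" "z \<le> b"
  shows "z powr r \<le> a powr r + b powr r" "min (a powr r) (b powr r) \<le> z powr r"
proof -
  have "a powr r \<ge> 0" "b powr r \<ge> 0" by auto
  moreover have "(a powr r \<le> z powr r \<and> z powr r \<le> b powr r) \<or> (b powr r \<le> z powr r \<and> z powr r \<le> a powr r)"
  proof (cases "r \<ge> 0")
    case True then show ?thesis using assms by (intro disjI1 conjI powr_mono2) auto
  next
    case False then show ?thesis using assms by (intro disjI2 conjI powr_mono2') auto
  qed
  ultimately show "z powr r \<le> a powr r + b powr r" "min (a powr r) (b powr r) \<le> z powr r" by linarith+
qed

context hamilton_jacobi
begin

text \<open>The order of quantifiers is the point: \<open>I\<close> is fixed before \<tau>, so the
  relative error can be made small while the square integral of \<open>S\<close> stays bounded,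
  although \<open>S\<close> changes with \<open>e\<close>.\<close>

lemma approximation:
  assumes K: "compact K" "K \<subseteq> ball x0 R" and l: "lo > 0" "\<And>x. x \<in> K \<Longrightarrow> 2 * lo \<le> (norm (g x))\<^sup>2"
    and G: "\<And>x. x \<in> cball x0 R \<Longrightarrow> norm (g x) \<le> G"
  obtains I where "\<And>\<tau> r. 0 < \<tau> \<Longrightarrow> \<tau> \<le> 1 \<Longrightarrow> \<tau> * (2 * G + 1) \<le> lo \<Longrightarrow> 0 < r \<Longrightarrow>
    \<exists>e S. 0 < e \<and> e < r \<and> set_integrable lborel K (\<lambda>x. (S x)\<^sup>2) \<and> (LINT x:K|lborel. (S x)\<^sup>2) \<le> I \<and>
      (\<forall>x\<in>cball x0 R. norm (conv (mollifier e) g x - g x) \<le> \<tau>) \<and>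
      (\<forall>x\<in>K. S x \<ge> 1 \<and> (\<forall>b\<in>Basis. norm (D e g x b) \<le> S x \<and>
          norm (D e F x b - dflux p (conv (mollifier e) g x) (D e g x b)) \<le> \<tau> * S x) \<and>
        \<bar>norm (conv (mollifier e) g x) powr q - tr (D e F x)\<bar> \<le> \<tau>)"
proof -
  have Kg: "g x \<noteq> 0" if "x \<in> K" for x using l(1) l(2)[OF that] by auto
  obtain dQ IQ where Q: "dQ > 0" "\<And>e. 0 < e \<Longrightarrow> set_integrable lborel K (Q e)"
    "\<And>e. 0 < e \<Longrightarrow> e < dQ \<Longrightarrow> (LINT x:K|lborel. Q e x) \<le> IQ"
    by (rule Q_bound[OF K Kg], assumption, rule that)
  obtain C0 where C0: "C0 > 0" "\<And>(f :: real ^ 'n \<Rightarrow> real ^ 'n) e b \<tau> x. e > 0 \<Longrightarrow> b \<in> Basis \<Longrightarrow> \<tau> \<ge> 0 \<Longrightarrow> continuous_on UNIV f \<Longrightarrow>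
      \<forall>y\<in>cball 0 e. norm (f (x - y) - f x) \<le> \<tau> * norm (g (x - y) - g x) \<Longrightarrow>
      (norm (conv (\<lambda>z. grad (mollifier e) z \<bullet> b) f x))\<^sup>2 \<le> C0 * \<tau>\<^sup>2 * Q e x"
    by (rule conv_partial_bound, rule that)
  obtain r1 where r1: "r1 > 0" "(\<Union>x\<in>K. cball x r1) \<subseteq> ball x0 R"
    using compact_subset_open_imp_cball_epsilon_subset[OF K(1) open_ball K(2)] by blast
  define I where "I = measure lborel K + C0 * IQ"
  show ?thesis
  proof (rule that[of I])
    fix \<tau> r :: real
    assume \<tau>: "0 < \<tau>" "\<tau> \<le> 1" "\<tau> * (2 * G + 1) \<le> lo" and r: "0 < r"
    \<comment> \<open>A compact set away from 0 that contains all values of the mollified gradient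
      on \<open>K\<close>. The flux is C^1 near it, so one \<delta> serves for linearising at every
      such value.\<close>
    define K\<xi> where "K\<xi> = {\<eta> :: real ^ 'n. lo \<le> (norm \<eta>)\<^sup>2 \<and> norm \<eta> \<le> G + 1}"
    have G0: "G \<ge> 0" using order_trans[OF norm_ge_zero G[of x0]] R0 by simp
    have "K\<xi> = cball 0 (G + 1) \<inter> {\<eta>. lo \<le> (norm \<eta>)\<^sup>2}" by (auto simp: K\<xi>_def)
    moreover have "closed {\<eta> :: real ^ 'n. lo \<le> (norm \<eta>)\<^sup>2}"
      by (intro closed_Collect_le continuous_intros)
    ultimately have K\<xi>: "compact K\<xi>" by (simp add: compact_Int_closed)
    have K\<xi>0: "K\<xi> \<subseteq> - {0}" using l by (auto simp: K\<xi>_def)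
    obtain \<delta> where \<delta>: "\<delta> > 0" "\<And>\<eta> a b. \<eta> \<in> K\<xi> \<Longrightarrow> a \<in> ball \<eta> \<delta> \<Longrightarrow> b \<in> ball \<eta> \<delta> \<Longrightarrow>
      norm (flux p a - flux p b - dflux p \<eta> (a - b)) \<le> \<tau> * norm (a - b)"
    proof (rule strict_derivative_compact[of "- {0}" K\<xi> "flux p" "dflux p" \<tau>])
      show "(flux p has_derivative dflux p x) (at x)" if "x \<in> - {0}" for x :: "real^'n"
        using that flux_has_derivative by simp
      show "continuous_on (- {0}) (\<lambda>x. dflux p x b)" for b :: "real ^ 'n" by (rule dflux_continuous)
    qed (use \<tau> K\<xi> K\<xi>0 in auto)
    have cH: "continuous_on UNIV (\<lambda>\<eta>::real^'n. norm \<eta> powr q)"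
      using q0 by (intro continuous_on_powr' continuous_intros) auto
    obtain \<delta>2 where \<delta>2: "\<delta>2 > 0" "\<And>a b :: real^'n. a \<in> cball 0 G \<Longrightarrow> dist a b < \<delta>2 \<Longrightarrow> dist (norm b powr q) (norm a powr q) < \<tau> / 2"
      by (rule uniformly_close_on_compact[OF cH compact_cball, of "\<tau> / 2" 0 G], use \<tau> in simp, rule that)
    define \<tau>' where "\<tau>' = min \<tau> (min (\<delta> / 2) (\<delta>2 / 2))"
    have \<tau>': "\<tau>' > 0" "\<tau>' \<le> \<tau>" "\<tau>' \<le> \<delta> / 2" "\<tau>' < \<delta>2" using \<tau> \<delta> \<delta>2 by (auto simp: \<tau>'_def)
    obtain d1 where d1: "d1 > 0" "\<And>e x. 0 < e \<Longrightarrow> e < d1 \<Longrightarrow> x \<in> cball x0 R \<Longrightarrow> norm (conv (mollifier e) g x - g x) \<le> \<tau>'"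
      by (rule conv_mollifier_approx[OF g_cont compact_cball \<tau>'(1)], rule that)
    obtain d2 where d2: "d2 > 0" "\<And>x y. x \<in> K \<Longrightarrow> dist x y < d2 \<Longrightarrow> dist (g y) (g x) < \<delta> / 2"
      by (rule uniformly_close_on_compact[OF g_cont K(1), of "\<delta> / 2"], use \<delta> in simp, rule that)
    obtain d3 where d3: "d3 > 0" "\<And>e x. 0 < e \<Longrightarrow> e < d3 \<Longrightarrow> x \<in> K \<Longrightarrow> norm (conv (mollifier e) H x - H x) \<le> \<tau> / 2"
      by (rule conv_mollifier_approx[OF H_cont K(1), of "\<tau> / 2"], use \<tau> in simp, rule that)
    define e where "e = Min {r, dQ, r1, d1, d2, d3} / 2"
    have e: "e > 0" "e < r" "e < dQ" "e < r1" "e < d1" "e < d2" "e < d3"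
    proof -
      have "Min {r, dQ, r1, d1, d2, d3} > 0" using r Q(1) r1 d1 d2 d3 by simp
      moreover have "Min {r, dQ, r1, d1, d2, d3} \<le> r" "Min {r, dQ, r1, d1, d2, d3} \<le> dQ" "Min {r, dQ, r1, d1, d2, d3} \<le> r1"
        "Min {r, dQ, r1, d1, d2, d3} \<le> d1" "Min {r, dQ, r1, d1, d2, d3} \<le> d2" "Min {r, dQ, r1, d1, d2, d3} \<le> d3"
        by (simp_all only: Min_le finite.intros insertI1 insertI2)
      ultimately show "e > 0" "e < r" "e < dQ" "e < r1" "e < d1" "e < d2" "e < d3" unfolding e_def by linarith+
    qed
    \<comment> \<open>\<open>C0 * Q e\<close> bounds the squared derivatives of the mollified
      gradient; the summand 1 only secures \<open>S \<ge> 1\<close>.\<close>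
    define S where "S x = sqrt (1 + C0 * Q e x)" for x
    have S2: "(S x)\<^sup>2 = 1 + C0 * Q e x" and S1: "S x \<ge> 1" for x
      using Q_nonneg[OF e(1), of x] C0(1) by (auto simp: S_def)
    have i1: "set_integrable lborel K (\<lambda>x. 1 :: real)" using K(1) by (intro set_integrable_continuous continuous_on_const)
    have i2: "set_integrable lborel K (\<lambda>x. C0 * Q e x)" by (intro set_integrable_mult_right Q(2)[OF e(1)])
    show "\<exists>e S. 0 < e \<and> e < r \<and> set_integrable lborel K (\<lambda>x. (S x)\<^sup>2) \<and> (LINT x:K|lborel. (S x)\<^sup>2) \<le> I \<and>
      (\<forall>x\<in>cball x0 R. norm (conv (mollifier e) g x - g x) \<le> \<tau>) \<and>
      (\<forall>x\<in>K. S x \<ge> 1 \<and> (\<forall>b\<in>Basis. norm (D e g x b) \<le> S x \<and>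
          norm (D e F x b - dflux p (conv (mollifier e) g x) (D e g x b)) \<le> \<tau> * S x) \<and>
        \<bar>norm (conv (mollifier e) g x) powr q - tr (D e F x)\<bar> \<le> \<tau>)"
    proof (rule exI[of _ e], rule exI[of _ S], intro conjI ballI)
      show "0 < e" "e < r" by (fact e)+
      show "set_integrable lborel K (\<lambda>x. (S x)\<^sup>2)" unfolding S2 by (rule set_integral_add(1)[OF i1 i2])
      have "(LINT x:K|lborel. (S x)\<^sup>2) = measure lborel K + C0 * (LINT x:K|lborel. Q e x)"
        unfolding S2 using i1 i2 emeasure_compact_finite[OF K(1)] K(1)
        by (simp add: set_integral_const compact_imp_closed)
      also have "\<dots> \<le> I" unfolding I_def using Q(3)[OF e(1,3)] C0(1) by (simp add: mult_left_mono)
      finally show "(LINT x:K|lborel. (S x)\<^sup>2) \<le> I" .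
      show "norm (conv (mollifier e) g x - g x) \<le> \<tau>" if "x \<in> cball x0 R" for x
        using d1(2)[OF e(1,5) that] \<tau>' by linarith
    next
      fix x assume x: "x \<in> K"
      define \<xi> where "\<xi> = conv (mollifier e) g x"
      have xR: "x \<in> cball x0 R" using x K(2) by (auto simp: less_imp_le)
      have xg: "norm (\<xi> - g x) \<le> \<tau>'" unfolding \<xi>_def by (rule d1(2)[OF e(1,5) xR])
      have gG: "norm (g x) \<le> G" by (rule G[OF xR])
      show "S x \<ge> 1" by (rule S1)
      have xe: "cball x e \<subseteq> ball x0 R"
        using subset_cball[of e r1 x] e(4) UN_subset_iff[THEN iffD1, OF r1(2), rule_format, OF x] by simp
      have \<xi>K: "\<xi> \<in> K\<xi>"
      proof -
        have a: "\<bar>norm \<xi> - norm (g x)\<bar> \<le> \<tau>" using norm_triangle_ineq3[of \<xi> "g x"] xg \<tau>' by linarith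
        then have b: "norm \<xi> \<le> G + 1" using gG \<tau> by linarith
        \<comment> \<open>The third condition on \<tau> spends one of the two copies of
          \<open>lo\<close> that are available for |g|^2.\<close>
        have "(norm (g x))\<^sup>2 - (norm \<xi>)\<^sup>2 = (norm (g x) - norm \<xi>) * (norm (g x) + norm \<xi>)"
          by (simp add: power2_eq_square algebra_simps)
        also have "\<dots> \<le> \<bar>norm (g x) - norm \<xi>\<bar> * (norm (g x) + norm \<xi>)" by (intro mult_right_mono) auto
        also have "\<dots> \<le> \<tau> * (2 * G + 1)" using a b gG \<tau> by (intro mult_mono) auto
        finally have "lo \<le> (norm \<xi>)\<^sup>2" using l(2)[OF x] \<tau>(3) by linarith
        then show ?thesis using b by (simp add: K\<xi>_def)
      qed
      show "\<bar>norm (conv (mollifier e) g x) powr q - tr (D e F x)\<bar> \<le> \<tau>"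
      proof -
        have "dist (norm \<xi> powr q) (norm (g x) powr q) < \<tau> / 2"
          using gG xg \<tau>'(4) by (intro \<delta>2(2)) (auto simp: dist_norm norm_minus_commute)
        moreover have "\<bar>conv (mollifier e) H x - H x\<bar> \<le> \<tau> / 2" using d3(2)[OF e(1,7) x] by simp
        ultimately show ?thesis unfolding tr_D_flux[OF e(1) xe] \<xi>_def[symmetric] dist_real_def by linarith
      qed
      fix b :: "real ^ 'n" assume b: "b \<in> Basis"
      let ?k = "\<lambda>z. grad (mollifier e) z \<bullet> b"
      note k = kernel_partial[OF mollifier_kernel[OF e(1)] b]
      have "(norm (D e g x b))\<^sup>2 \<le> C0 * 1\<^sup>2 * Q e x"
        unfolding D_Basis[OF b] by (rule C0(2)[OF e(1) b _ g_cont]) simp_all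
      then have "(norm (D e g x b))\<^sup>2 \<le> 1 + C0 * Q e x" by simp
      then show "norm (D e g x b) \<le> S x" unfolding S_def by (rule real_le_rsqrt)
      \<comment> \<open>\<xi> is frozen at the mollified value at \<open>x\<close>. The
        linearisation then commutes with the convolution, and the error is the differentiated kernel
        convolved with \<open>?f\<close>, whose oscillation near \<open>x\<close> is at most \<tau>
        times that of \<open>g\<close>.\<close>
      let ?f = "\<lambda>y. F y - dflux p \<xi> (g y)"
      have bl: "bounded_linear (dflux p \<xi>)" using linear_dflux linear_conv_bounded_linear by blast
      have cdg: "continuous_on UNIV (\<lambda>y. dflux p \<xi> (g y))"
        using g_cont bounded_linear.continuous_on[OF bl] by blast
      have "D e F x b - dflux p \<xi> (D e g x b) = conv ?k ?f x"
      proof -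
        have ig: "integrable lborel (\<lambda>y. ?k (x - y) *\<^sub>R g y)"
          by (rule conv_integrable[OF kernelD(3,5)[OF k] g_cont])
        have iF: "integrable lborel (\<lambda>y. ?k (x - y) *\<^sub>R F y)"
          by (rule conv_integrable[OF kernelD(3,5)[OF k] F_cont])
        have "dflux p \<xi> (conv ?k g x) = (\<integral>y. dflux p \<xi> (?k (x - y) *\<^sub>R g y) \<partial>lborel)"
          unfolding conv_def by (rule integral_bounded_linear[OF bl ig, symmetric])
        also have "\<dots> = (\<integral>y. ?k (x - y) *\<^sub>R dflux p \<xi> (g y) \<partial>lborel)"
          by (simp only: linear_cmul[OF linear_dflux])
        finally have "dflux p \<xi> (conv ?k g x) = (\<integral>y. ?k (x - y) *\<^sub>R dflux p \<xi> (g y) \<partial>lborel)" .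
        moreover have "integrable lborel (\<lambda>y. ?k (x - y) *\<^sub>R dflux p \<xi> (g y))"
          by (rule conv_integrable[OF kernelD(3,5)[OF k] cdg])
        ultimately show ?thesis
          unfolding D_Basis[OF b] using iF by (simp add: conv_def scaleR_diff_right)
      qed
      moreover have "(norm (conv ?k ?f x))\<^sup>2 \<le> C0 * \<tau>\<^sup>2 * Q e x"
      proof (rule C0(2)[OF e(1) b], goal_cases)
        case 2
        show ?case by (intro continuous_on_diff F_cont cdg)
      next
        case 3
        show ?case
      proof
        fix y :: "real ^ 'n" assume y: "y \<in> cball 0 e"
        have "dist (g (x - y)) (g x) < \<delta> / 2" using y e(6) by (intro d2(2)[OF x]) (simp add: dist_norm)
        then have "g (x - y) \<in> ball \<xi> \<delta>" "g x \<in> ball \<xi> \<delta>"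
          using xg \<tau>'(3) \<delta>(1) dist_triangle[of \<xi> "g (x - y)" "g x"] by (auto simp: dist_norm norm_minus_commute)
        from \<delta>(2)[OF \<xi>K this] show "norm (?f (x - y) - ?f x) \<le> \<tau> * norm (g (x - y) - g x)"
          by (simp add: linear_diff[OF linear_dflux] algebra_simps)
      qed
      qed (use \<tau> in simp)
      moreover have "C0 * \<tau>\<^sup>2 * Q e x \<le> (\<tau> * S x)\<^sup>2" by (simp add: power_mult_distrib S2 algebra_simps)
      ultimately have "(norm (D e F x b - dflux p \<xi> (D e g x b)))\<^sup>2 \<le> (\<tau> * S x)\<^sup>2" by (simp only:)
      then show "norm (D e F x b - dflux p (conv (mollifier e) g x) (D e g x b)) \<le> \<tau> * S x"
        unfolding \<xi>_def[symmetric] using \<tau> S1[of x] by (elim power2_le_imp_le) simp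
    qed
  qed
qed

end

section \<open>The gradient estimate\<close>

text \<open>The field is the gradient of the logarithm of the weight (R^2 - |x - x0|^2)^m.\<close>

lemma log_gradient_has_derivative:
  fixes x x0 :: "'a::real_inner"
  assumes "R\<^sup>2 - (x - x0) \<bullet> (x - x0) > 0"
  shows "((\<lambda>x. (- 2 * m / (R\<^sup>2 - (x - x0) \<bullet> (x - x0))) *\<^sub>R (x - x0)) has_derivative
    (\<lambda>h. (- 2 * m / (R\<^sup>2 - (x - x0) \<bullet> (x - x0))) *\<^sub>R h
      + (- 4 * m * ((x - x0) \<bullet> h) / (R\<^sup>2 - (x - x0) \<bullet> (x - x0))\<^sup>2) *\<^sub>R (x - x0))) (at x)"
proof -
  let ?d = "R\<^sup>2 - (x - x0) \<bullet> (x - x0)"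
  have "((\<lambda>x. R\<^sup>2 - (x - x0) \<bullet> (x - x0)) has_derivative (\<lambda>h. - (2 * ((x - x0) \<bullet> h)))) (at x)"
    by (auto intro!: derivative_eq_intros simp: inner_commute)
  then have "((\<lambda>x. inverse (R\<^sup>2 - (x - x0) \<bullet> (x - x0))) has_derivative
      (\<lambda>h. - (inverse ?d * - (2 * ((x - x0) \<bullet> h)) * inverse ?d))) (at x)"
    using assms by (intro Deriv.has_derivative_inverse) auto
  from has_derivative_mult_right[OF this, of "- 2 * m"]
  have "((\<lambda>x. (- 2 * m) * inverse (R\<^sup>2 - (x - x0) \<bullet> (x - x0))) has_derivative
      (\<lambda>h. (- 2 * m) * (- (inverse ?d * - (2 * ((x - x0) \<bullet> h)) * inverse ?d)))) (at x)" .
  from has_derivative_scaleR[OF this, of "\<lambda>x. x - x0" "\<lambda>h. h"]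
  show ?thesis
    unfolding divide_inverse
    by (rule has_derivative_eq_rhs)
      (auto intro!: derivative_eq_intros simp: fun_eq_iff power2_eq_square mult_ac)
qed

lemma weight_GDERIV:
  fixes x x0 :: "'a::real_inner"
  assumes "R\<^sup>2 - (x - x0) \<bullet> (x - x0) > 0"
  shows "GDERIV (\<lambda>x. (R\<^sup>2 - (x - x0) \<bullet> (x - x0)) powr m) x :>
    (R\<^sup>2 - (x - x0) \<bullet> (x - x0)) powr m *\<^sub>R ((- 2 * m / (R\<^sup>2 - (x - x0) \<bullet> (x - x0))) *\<^sub>R (x - x0))"
proof -
  let ?d = "R\<^sup>2 - (x - x0) \<bullet> (x - x0)"
  have "((\<lambda>x. R\<^sup>2 - (x - x0) \<bullet> (x - x0)) has_derivative (\<lambda>h. - (2 * ((x - x0) \<bullet> h)))) (at x)"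
    by (auto intro!: derivative_eq_intros simp: inner_commute)
  then have "((\<lambda>x. (R\<^sup>2 - (x - x0) \<bullet> (x - x0)) powr m) has_derivative
      (\<lambda>h. ?d powr m * (0 * ln ?d + - (2 * ((x - x0) \<bullet> h)) * m / ?d))) (at x)"
    by (rule has_derivative_powr) (use assms in auto)
  then show ?thesis unfolding gderiv_def
    by (rule has_derivative_eq_rhs) (simp add: fun_eq_iff inner_commute)
qed

lemma compact_norm_bound:
  fixes f :: "'a::topological_space \<Rightarrow> 'b::real_normed_vector"
  assumes "compact K" "continuous_on K f"
  obtains B where "B > 0" "\<And>x. x \<in> K \<Longrightarrow> norm (f x) \<le> B"
proof -
  have "bounded (f ` K)" using compact_continuous_image[OF assms(2,1)] by (rule compact_imp_bounded)
  then obtain B where "B > 0" "\<forall>y\<in>f ` K. norm y \<le> B" unfolding bounded_pos by blast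
  then show ?thesis using that by simp
qed

context hamilton_jacobi
begin

text \<open>By contradiction: if the bound fails, \<zeta> |g|^2 exceeds M at the centre. The
  integrated Bernstein inequality then bounds a positive quantity that does not depend on \<tau> by
  a constant times \<tau>.\<close>

lemma gradient_estimate:
  assumes bc: "bernstein_const TYPE(real ^ 'n) p q k c C"
  defines "s \<equiv> q + 1 - p"
  defines "m \<equiv> 2 / s"
  defines "K1 \<equiv> C * (4 * m\<^sup>2 + 6 * m)"
  shows "norm (g x0) \<le> (2 * K1 / c) powr (1 / (2 * s)) * R powr (- (1 / s))"
proof (rule ccontr)
  assume neg: "\<not> ?thesis"
  have c: "c > 0" and C: "C > 0" using bc unfolding bernstein_const_def by blast+
  note P = bc[unfolded bernstein_const_def, THEN conjunct2, THEN conjunct2, rule_format]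
  have s: "s > 0" using qp by (simp add: s_def)
  have m: "m > 0" using s by (simp add: m_def)
  have K1: "K1 > 0" using C m by (simp add: K1_def add_pos_pos)
  \<comment> \<open>Chosen so that where \<zeta> z > M the absorption term c z^s is at least 2 K1
    R^2 / d^2, twice the contribution of the weight. \<open>K1\<close> collects the constants 4 m^2
    of \<open>lvb\<close> and 6 m of \<open>Dlb\<close>.\<close>
  define M where "M = (2 * K1 / c * R\<^sup>2) powr (1 / s)"
  have M: "M > 0" using K1 c R0 by (simp add: M_def)
  have Ms: "M powr s = 2 * K1 / c * R\<^sup>2" using s K1 c R0 by (simp add: M_def powr_powr)
  define d where "d x = R\<^sup>2 - (x - x0) \<bullet> (x - x0)" for x
  define \<zeta> where "\<zeta> x = d x powr m" for x
  define Zm where "Zm = (R\<^sup>2) powr m"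
  have Zm: "Zm > 0" using R0 by (simp add: Zm_def)
  have dball: "d x > 0" if "x \<in> ball x0 R" for x
  proof -
    have "norm (x - x0) < R" using that by (simp add: dist_norm norm_minus_commute)
    then have "(norm (x - x0))\<^sup>2 < R\<^sup>2" by (intro power_strict_mono) auto
    then show ?thesis by (simp add: d_def power2_norm_eq_inner)
  qed
  have dcball: "d x \<ge> 0" "d x \<le> R\<^sup>2" if "x \<in> cball x0 R" for x
  proof -
    have "norm (x - x0) \<le> R" using that by (simp add: dist_norm norm_minus_commute)
    then have "(norm (x - x0))\<^sup>2 \<le> R\<^sup>2" by (intro power_mono) auto
    then show "d x \<ge> 0" "d x \<le> R\<^sup>2" by (simp_all add: d_def power2_norm_eq_inner[symmetric])
  qed
  have \<zeta>0: "\<zeta> x \<ge> 0" for x by (simp add: \<zeta>_def)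
  have \<zeta>Z: "\<zeta> x \<le> Zm" if "x \<in> cball x0 R" for x
    unfolding \<zeta>_def Zm_def using dcball[OF that] m by (intro powr_mono2) auto
  have c\<zeta>: "continuous_on (cball x0 R) \<zeta>"
    unfolding \<zeta>_def using dcball m
    by (intro continuous_on_powr' continuous_on_const) (auto simp: d_def intro!: continuous_intros)
  \<comment> \<open>At the centre \<zeta> equals R^(2m) = R^(4/s), so M is \<zeta> x0 times the
    square of the claimed bound.\<close>
  have big: "\<zeta> x0 * (norm (g x0))\<^sup>2 > M"
  proof -
    let ?a = "(2 * K1 / c) powr (1 / (2 * s))" and ?b = "R powr (- (1 / s))"
    have "?a * ?b < norm (g x0)" using neg by simp
    then have "(?a * ?b)\<^sup>2 < (norm (g x0))\<^sup>2" by (intro power_strict_mono) auto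
    moreover have "?a\<^sup>2 = (2 * K1 / c) powr (1 / s)"
      unfolding power2_eq_square by (simp flip: powr_add)
    moreover have "?b\<^sup>2 = R powr (- (2 / s))"
      unfolding power2_eq_square by (simp flip: powr_add)
    ultimately have "(2 * K1 / c) powr (1 / s) * R powr (- (2 / s)) < (norm (g x0))\<^sup>2"
      by (simp add: power_mult_distrib)
    then have "R powr (4 / s) * ((2 * K1 / c) powr (1 / s) * R powr (- (2 / s))) < R powr (4 / s) * (norm (g x0))\<^sup>2"
      using R0 by (intro mult_strict_left_mono) auto
    moreover have R2: "(R\<^sup>2) powr t = R powr (2 * t)" for t
      using R0 powr_powr[of R 2 t] by simp
    have "\<zeta> x0 = R powr (4 / s)" by (simp add: \<zeta>_def d_def R2 m_def)
    moreover have "R powr (4 / s) * ((2 * K1 / c) powr (1 / s) * R powr (- (2 / s))) = M"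
    proof -
      have "R powr (4 / s) * R powr (- (2 / s)) = R powr (2 / s)" by (simp flip: powr_add)
      moreover have "M = (2 * K1 / c) powr (1 / s) * R powr (2 / s)"
        unfolding M_def using K1 c by (subst powr_mult) (auto simp: R2)
      ultimately show ?thesis by (simp add: mult.left_commute)
    qed
    ultimately show ?thesis by simp
  qed
  define w where "w x = \<zeta> x * (norm (g x))\<^sup>2" for x
  have cg: "continuous_on T g" for T using continuous_on_subset[OF g_cont subset_UNIV] .
  have cw: "continuous_on (cball x0 R) w" unfolding w_def by (intro continuous_intros c\<zeta> cg)
  \<comment> \<open>The level M / 2 instead of M leaves room for replacing \<open>g\<close> by the
    mollified gradient: \<Psi> will still vanish off \<open>K\<close>. As \<zeta> vanishes on the
    sphere, \<open>K\<close> is a compact subset of the open ball.\<close>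
  define K where "K = {x \<in> cball x0 R. M / 2 \<le> w x}"
  have K: "compact K"
  proof -
    have "closed K" unfolding K_def
      by (intro continuous_on_closed_Collect_le continuous_on_const cw closed_cball)
    moreover have "K = cball x0 R \<inter> K" by (auto simp: K_def)
    ultimately show ?thesis by (metis compact_Int_closed compact_cball)
  qed
  have Kc: "K \<subseteq> cball x0 R" by (auto simp: K_def)
  have KR: "K \<subseteq> ball x0 R"
  proof
    fix x assume x: "x \<in> K"
    show "x \<in> ball x0 R"
    proof (rule ccontr)
      assume "x \<notin> ball x0 R"
      then have "norm (x - x0) = R" using x Kc by (auto simp: dist_norm norm_minus_commute)
      then have "d x = 0" by (simp add: d_def power2_norm_eq_inner[symmetric])
      then show False using x M by (simp add: K_def w_def \<zeta>_def)
    qed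
  qed
  \<comment> \<open>Half of the lower bound M / (2 Zm) for |g|^2 on \<open>K\<close>; the other half
    is the margin for the mollification.\<close>
  define lo where "lo = M / (4 * Zm)"
  have lo: "lo > 0" using M Zm by (simp add: lo_def)
  have Klo: "2 * lo \<le> (norm (g x))\<^sup>2" if "x \<in> K" for x
  proof -
    have "M / 2 \<le> \<zeta> x * (norm (g x))\<^sup>2" using that by (simp add: K_def w_def)
    also have "\<dots> \<le> Zm * (norm (g x))\<^sup>2" using \<zeta>Z that Kc by (intro mult_right_mono) auto
    finally show ?thesis using Zm by (simp add: lo_def field_simps)
  qed
  obtain G where G: "G > 0" "\<And>x. x \<in> cball x0 R \<Longrightarrow> norm (g x) \<le> G"
    using compact_norm_bound[OF compact_cball cg] by blast
  obtain I where I: "\<And>\<tau> r. 0 < \<tau> \<Longrightarrow> \<tau> \<le> 1 \<Longrightarrow> \<tau> * (2 * G + 1) \<le> lo \<Longrightarrow> 0 < r \<Longrightarrow>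
    \<exists>e S. 0 < e \<and> e < r \<and> set_integrable lborel K (\<lambda>x. (S x)\<^sup>2) \<and> (LINT x:K|lborel. (S x)\<^sup>2) \<le> I \<and>
      (\<forall>x\<in>cball x0 R. norm (conv (mollifier e) g x - g x) \<le> \<tau>) \<and>
      (\<forall>x\<in>K. S x \<ge> 1 \<and> (\<forall>b\<in>Basis. norm (D e g x b) \<le> S x \<and>
          norm (D e F x b - dflux p (conv (mollifier e) g x) (D e g x b)) \<le> \<tau> * S x) \<and>
        \<bar>norm (conv (mollifier e) g x) powr q - tr (D e F x)\<bar> \<le> \<tau>)"
    by (rule approximation[OF K KR lo Klo G(2)], assumption, assumption, rule that)
  define M0 where "M0 = w x0 - M"
  have M0: "M0 > 0" using big by (simp add: M0_def w_def)
  \<comment> \<open>\<open>M0\<close> is the excess over M at the centre. At least half of it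
    persists on this ball, and a quarter survives the mollification.\<close>
  obtain \<rho> where \<rho>: "\<rho> > 0" "\<rho> < R" "\<And>x. x \<in> cball x0 \<rho> \<Longrightarrow> M + M0 / 2 \<le> w x"
  proof -
    obtain \<delta> where \<delta>: "\<delta> > 0" "\<forall>x\<in>cball x0 R. dist x x0 < \<delta> \<longrightarrow> dist (w x) (w x0) < M0 / 2"
      using cw M0 R0 unfolding continuous_on_iff by (metis centre_in_cball half_gt_zero less_imp_le)
    show ?thesis
    proof (rule that[of "min \<delta> R / 2"])
      fix x assume "x \<in> cball x0 (min \<delta> R / 2)"
      then have "dist x x0 < \<delta>" "x \<in> cball x0 R" using \<delta>(1) R0 by (auto simp: dist_commute)
      then have "dist (w x) (w x0) < M0 / 2" using \<delta>(2) by blast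
      moreover have "w x0 = M + M0" by (simp add: M0_def)
      ultimately show "M + M0 / 2 \<le> w x" unfolding dist_real_def by linarith
    qed (use \<delta>(1) R0 in auto)
  qed
  have \<rho>K: "cball x0 \<rho> \<subseteq> K"
  proof
    fix x assume x: "x \<in> cball x0 \<rho>"
    then have "M / 2 \<le> w x" using \<rho>(3)[OF x] M M0 by linarith
    then show "x \<in> K" using x \<rho>(2) by (simp add: K_def)
  qed
  obtain r1 where r1: "r1 > 0" "(\<Union>x\<in>K. cball x r1) \<subseteq> ball x0 R"
    using compact_subset_open_imp_cball_epsilon_subset[OF K open_ball KR] by blast

  \<comment> \<open>The gradient of the logarithm of the weight and its derivative\<close>
  define lv where "lv x = (- 2 * m / d x) *\<^sub>R (x - x0)" for x
  define Dl where "Dl x h = (- 2 * m / d x) *\<^sub>R h + (- 4 * m * ((x - x0) \<bullet> h) / (d x)\<^sup>2) *\<^sub>R (x - x0)" for x h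
  have lv_der: "(lv has_derivative Dl x) (at x)" if "x \<in> ball x0 R" for x
    using log_gradient_has_derivative[of R x x0 m] dball[OF that]
    unfolding d_def[symmetric] by (simp add: lv_def[abs_def] Dl_def[abs_def])
  have cd: "continuous_on T d" for T unfolding d_def by (intro continuous_intros)
  have cDl: "continuous_on (ball x0 R) (\<lambda>x. Dl x b)" for b
    unfolding Dl_def using dball by (intro continuous_intros cd) (auto simp: less_imp_neq[symmetric] dest: dball)
  have clv: "continuous_on (ball x0 R) lv" using has_derivative_continuous_on_open[OF lv_der] .
  obtain \<Lambda> where \<Lambda>: "\<Lambda> > 0" "\<And>x. x \<in> K \<Longrightarrow> norm (lv x) \<le> \<Lambda>"
    using compact_norm_bound[OF K continuous_on_subset[OF clv KR]] by blast
  have nxR: "(x - x0) \<bullet> (x - x0) \<le> R\<^sup>2" "norm (x - x0) \<le> R" if "x \<in> ball x0 R" for x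
    using dball[OF that] that by (auto simp: d_def dist_norm norm_minus_commute)
  have lvb: "lv x \<bullet> lv x \<le> 4 * m\<^sup>2 * (R\<^sup>2 / (d x)\<^sup>2)" if "x \<in> ball x0 R" for x
  proof -
    have "lv x \<bullet> lv x = 4 * m\<^sup>2 / (d x)\<^sup>2 * ((x - x0) \<bullet> (x - x0))"
      by (simp add: lv_def power2_eq_square)
    also have "\<dots> \<le> 4 * m\<^sup>2 / (d x)\<^sup>2 * R\<^sup>2" using nxR[OF that] by (intro mult_left_mono) auto
    finally show ?thesis by simp
  qed
  have Dlb: "norm (Dl x h) \<le> 6 * m * (R\<^sup>2 / (d x)\<^sup>2) * norm h" if x: "x \<in> ball x0 R" for x h
  proof -
    have dx: "d x > 0" "d x \<le> R\<^sup>2" using dball[OF x] dcball(2)[of x] x by auto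
    have "norm (Dl x h) \<le> 2 * m / d x * norm h + 4 * m * \<bar>(x - x0) \<bullet> h\<bar> / (d x)\<^sup>2 * norm (x - x0)"
      unfolding Dl_def using dx m by (intro norm_triangle_le add_mono) (auto simp: abs_mult)
    also have "\<dots> \<le> 2 * m * (R\<^sup>2 / (d x)\<^sup>2) * norm h + 4 * m * (R * norm h) / (d x)\<^sup>2 * R"
    proof (rule add_mono)
      have "1 / d x \<le> R\<^sup>2 / (d x)\<^sup>2" using dx by (simp add: power2_eq_square field_simps)
      then have "2 * m * norm h * (1 / d x) \<le> 2 * m * norm h * (R\<^sup>2 / (d x)\<^sup>2)" using m by (intro mult_left_mono) auto
      then show "2 * m / d x * norm h \<le> 2 * m * (R\<^sup>2 / (d x)\<^sup>2) * norm h" by (simp add: mult_ac)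
      have "\<bar>(x - x0) \<bullet> h\<bar> \<le> R * norm h"
        using order_trans[OF Cauchy_Schwarz_ineq2 mult_right_mono[OF nxR(2)[OF x] norm_ge_zero]] .
      then show "4 * m * \<bar>(x - x0) \<bullet> h\<bar> / (d x)\<^sup>2 * norm (x - x0) \<le> 4 * m * (R * norm h) / (d x)\<^sup>2 * R"
        using nxR(2)[OF x] m R0 dx by (intro mult_mono divide_right_mono mult_left_mono) auto
    qed
    also have "\<dots> = 6 * m * (R\<^sup>2 / (d x)\<^sup>2) * norm h" by (simp add: power2_eq_square algebra_simps)
    finally show ?thesis .
  qed

  \<comment> \<open>Constants that are independent of the mollification\<close>
  define Zb where "Zb = (G + 1)\<^sup>2"
  \<comment> \<open>An upper bound for z^a on the interval from \<open>lo\<close> to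
    \<open>Zb\<close>, for exponents of either sign.\<close>
  define za where "za a = lo powr a + Zb powr a" for a
  have za0: "za a \<ge> 0" for a by (simp add: za_def)
  define P0 where "P0 = Zm * Zb"
  have Zb: "Zb > 0" using G(1) by (simp add: Zb_def)
  have P0: "P0 > 0" using Zm Zb by (simp add: P0_def)
  define N where "N = real DIM(real ^ 'n)"
  \<comment> \<open>Bounds the gradient of \<phi> by A1 S; its two summands correspond to those of
    \<open>d\<phi>\<close> below.\<close>
  define A1 where "A1 = \<bar>k - p / 2\<bar> * za (k - p / 2 - 1) * P0\<^sup>2 * (2 * (N * (G + 1)))
      + za (k - p / 2) * (2 * P0 * Zm * (2 * (N * (G + 1)) + Zb * \<Lambda>))"
  define A where "A = za (k - p / 2) * P0\<^sup>2 + (G + 1) + A1 + C * (P0\<^sup>2 * za (k + 1 - p))"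
  have N0: "N \<ge> 0" by (simp add: N_def)
  have A1: "A1 \<ge> 0"
    unfolding A1_def using za0 P0 N0 G(1) Zm Zb \<Lambda>(1) by (intro add_nonneg_nonneg mult_nonneg_nonneg) auto
  have A: "za (k - p / 2) * P0\<^sup>2 \<le> A" "G + 1 \<le> A" "A1 \<le> A" "C * (P0\<^sup>2 * za (k + 1 - p)) \<le> A"
    using za0[of "k - p / 2"] za0[of "k + 1 - p"] A1 G(1) C unfolding A_def by (simp_all add: add_increasing add_increasing2)
  define con where "con = 2 * A * N + N * A\<^sup>2 + A\<^sup>2 + A * (N + 1)\<^sup>2"
  have con: "con \<ge> 0" unfolding con_def using A(2) G(1) N0 by (intro add_nonneg_nonneg mult_nonneg_nonneg) auto
  \<comment> \<open>A lower bound for z^k times K1 / R^2, the part of the absorption term that is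
    left where f > M.\<close>
  define \<kappa> where "\<kappa> = min (lo powr k) (Zb powr k) * (K1 / R\<^sup>2)"
  have \<kappa>: "\<kappa> > 0" using lo Zb K1 R0 by (simp add: \<kappa>_def)
  define v0 where "v0 = (M0 / 4)\<^sup>2 * measure lborel (cball x0 \<rho>)"
  have v0: "v0 > 0" using M0 \<rho>(1) by (simp add: v0_def)

  \<comment> \<open>The integrated Bernstein inequality for a fixed \<tau>\<close>
  have claim: "\<kappa> * v0 \<le> con * \<tau> * I"
    if \<tau>: "0 < \<tau>" "\<tau> \<le> 1" "\<tau> * (2 * G + 1) \<le> lo" "\<tau> * (2 * G + 1) \<le> M0 / (4 * Zm)" for \<tau>
  proof -
    obtain e S where e: "0 < e" "e < r1 / 2" and S: "set_integrable lborel K (\<lambda>x. (S x)\<^sup>2)" "(LINT x:K|lborel. (S x)\<^sup>2) \<le> I"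
      and ap: "\<And>x. x \<in> cball x0 R \<Longrightarrow> norm (conv (mollifier e) g x - g x) \<le> \<tau>"
      and SK: "\<And>x. x \<in> K \<Longrightarrow> S x \<ge> 1" "\<And>x b. x \<in> K \<Longrightarrow> b \<in> Basis \<Longrightarrow> norm (D e g x b) \<le> S x"
        "\<And>x b. x \<in> K \<Longrightarrow> b \<in> Basis \<Longrightarrow> norm (D e F x b - dflux p (conv (mollifier e) g x) (D e g x b)) \<le> \<tau> * S x"
        "\<And>x. x \<in> K \<Longrightarrow> \<bar>norm (conv (mollifier e) g x) powr q - tr (D e F x)\<bar> \<le> \<tau>"
      using I[OF \<tau>(1-3) half_gt_zero[OF r1(1)]] by (elim exE conjE) (rule that, (assumption | blast)+)
    define \<xi> where "\<xi> = conv (mollifier e) g"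
    define B where "B = D e g"
    define L where "L = D e F"
    define z where "z x = \<xi> x \<bullet> \<xi> x" for x
    have z: "z x = (norm (\<xi> x))\<^sup>2" for x by (simp add: z_def power2_norm_eq_inner)
    have \<xi>G: "norm (\<xi> x) \<le> G + 1" if "x \<in> cball x0 R" for x
      using ap[OF that] G(2)[OF that] norm_triangle_sub[of "\<xi> x" "g x"] \<tau>(2) unfolding \<xi>_def by linarith
    have zdiff: "\<bar>z x - (norm (g x))\<^sup>2\<bar> \<le> \<tau> * (2 * G + 1)" if x: "x \<in> cball x0 R" for x
    proof -
      have "\<bar>norm (\<xi> x) - norm (g x)\<bar> \<le> \<tau>"
        using norm_triangle_ineq3[of "\<xi> x" "g x"] ap[OF x] unfolding \<xi>_def by linarith
      moreover have "norm (\<xi> x) + norm (g x) \<le> 2 * G + 1" using \<xi>G[OF x] G(2)[OF x] by linarith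
      ultimately have "\<bar>norm (\<xi> x) - norm (g x)\<bar> * (norm (\<xi> x) + norm (g x)) \<le> \<tau> * (2 * G + 1)"
        using \<tau>(1) by (intro mult_mono) auto
      moreover have "z x - (norm (g x))\<^sup>2 = (norm (\<xi> x) - norm (g x)) * (norm (\<xi> x) + norm (g x))"
        by (simp add: z power2_eq_square algebra_simps)
      ultimately show ?thesis by (simp add: abs_mult)
    qed
    have zZ: "z x \<le> Zb" if "x \<in> cball x0 R" for x
      unfolding z Zb_def using \<xi>G[OF that] by (intro power_mono) auto
    have zlo: "lo \<le> z x" if "x \<in> K" for x
      using Klo[OF that] zdiff[of x] Kc that \<tau>(3) by fastforce
    define f where "f x = \<zeta> x * z x" for x
    have fw: "\<bar>f x - w x\<bar> \<le> Zm * (\<tau> * (2 * G + 1))" if x: "x \<in> cball x0 R" for x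
    proof -
      have "\<bar>f x - w x\<bar> = \<zeta> x * \<bar>z x - (norm (g x))\<^sup>2\<bar>"
        using \<zeta>0[of x] by (simp add: f_def w_def abs_mult flip: right_diff_distrib)
      also have "\<dots> \<le> Zm * (\<tau> * (2 * G + 1))"
        using \<zeta>Z[OF x] zdiff[OF x] Zm by (intro mult_mono) auto
      finally show ?thesis .
    qed
    have f0: "f x \<ge> 0" for x using \<zeta>0 by (simp add: f_def z)
    have fP: "f x \<le> P0" if "x \<in> cball x0 R" for x
      unfolding f_def P0_def using \<zeta>Z[OF that] zZ[OF that] Zm by (intro mult_mono) (auto simp: z)
    \<comment> \<open>The open neighbourhood of \<open>K\<close> on which the divergence lemmas
      operate. Half of \<open>r1\<close> is reserved for the mollification radius, and \<xi>
      \<noteq> 0 is imposed to make all powers of z differentiable.\<close>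
    define U where "U = (\<Union>y\<in>K. ball y (r1 / 2)) \<inter> {x. \<xi> x \<noteq> 0}"
    have \<xi>_der: "(\<xi> has_derivative B x) (at x)" for x
      unfolding \<xi>_def B_def by (rule D_has_derivative[OF e(1) g_cont])
    have c\<xi>: "continuous_on T \<xi>" for T
      unfolding \<xi>_def by (rule conv_kernel_continuous[OF mollifier_kernel[OF e(1)] g_cont])
    have linB: "linear (B x)" and linL: "linear (L x)" for x unfolding B_def L_def by (rule linear_D)+
    have cB: "continuous_on T (\<lambda>x. B x b)" if "b \<in> Basis" for T b
      unfolding B_def by (rule D_continuous[OF e(1) g_cont that])
    have cB\<xi>: "continuous_on T (\<lambda>x. B x (\<xi> x))" for T
    proof -
      have "B x (\<xi> x) = (\<Sum>b\<in>Basis. (\<xi> x \<bullet> b) *\<^sub>R B x b)" for x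
        by (rule linear_eq_sum_Basis[OF linB])
      then show ?thesis by (simp add: continuous_intros c\<xi> cB)
    qed
    have U: "open U"
    proof -
      have "open {x. \<xi> x \<noteq> 0}" using c\<xi>[of UNIV] by (intro open_Collect_neq) auto
      then show ?thesis unfolding U_def by (intro open_Int open_UN) auto
    qed
    have KU: "K \<subseteq> U"
    proof
      fix x assume x: "x \<in> K"
      have "\<xi> x \<noteq> 0" using zlo[OF x] lo by (auto simp: z_def)
      then show "x \<in> U" using x r1(1) unfolding U_def by (auto intro!: bexI[of _ x])
    qed
    have Ucb: "cball x e \<subseteq> ball x0 R" if x: "x \<in> U" for x
    proof -
      obtain y where y: "y \<in> K" "dist y x < r1 / 2" using x unfolding U_def by auto
      have "cball x e \<subseteq> cball y r1"
      proof
        fix t assume "t \<in> cball x e"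
        then show "t \<in> cball y r1" using y(2) e dist_triangle[of y t x] by simp
      qed
      also have "cball y r1 \<subseteq> ball x0 R" using r1(2) y(1) by blast
      finally show ?thesis .
    qed
    have UR: "x \<in> ball x0 R" if "x \<in> U" for x using Ucb[OF that] e(1) by (meson centre_in_cball less_imp_le subsetD)
    have URc: "x \<in> cball x0 R" if "x \<in> U" for x using UR[OF that] by simp
    have U0: "\<xi> x \<noteq> 0" "z x > 0" if "x \<in> U" for x using that by (auto simp: U_def z_def)
    define \<Psi> where "\<Psi> x = (max 0 (f x - M))\<^sup>2" for x
    define \<Psi>1 where "\<Psi>1 x = 2 * max 0 (f x - M)" for x
    define d\<Psi> where "d\<Psi> x = (\<Psi>1 x * \<zeta> x) *\<^sub>R (2 *\<^sub>R B x (\<xi> x) + z x *\<^sub>R lv x)" for x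
    define \<phi> where "\<phi> x = z x powr (k - p / 2) * \<Psi> x" for x
    define d\<phi> where "d\<phi> x = ((k - p / 2) * z x powr (k - p / 2 - 1) * \<Psi> x) *\<^sub>R (2 *\<^sub>R B x (\<xi> x))
        + z x powr (k - p / 2) *\<^sub>R d\<Psi> x" for x
    define J where "J x = z x powr k *\<^sub>R lv x + ((p - 2) * z x powr (k - 1) * (\<xi> x \<bullet> lv x)) *\<^sub>R \<xi> x" for x
    have symB: "B x h \<bullet> y = h \<bullet> B x y" if "x \<in> U" for x h y
      unfolding B_def by (rule D_symmetric[OF e(1) Ucb[OF that]])
    have z_der: "GDERIV z x :> 2 *\<^sub>R B x (\<xi> x)" if "x \<in> U" for x
    proof -
      have "(z has_derivative (\<lambda>h. \<xi> x \<bullet> B x h + B x h \<bullet> \<xi> x)) (at x)"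
        unfolding z_def[abs_def] by (rule has_derivative_inner[OF \<xi>_der \<xi>_der])
      moreover have "\<xi> x \<bullet> B x h + B x h \<bullet> \<xi> x = h \<bullet> (2 *\<^sub>R B x (\<xi> x))" for h
        using symB[OF that, of "\<xi> x" h] by (simp add: inner_commute)
      ultimately show ?thesis unfolding gderiv_def by (simp only:)
    qed
    have \<zeta>_der: "GDERIV \<zeta> x :> \<zeta> x *\<^sub>R lv x" if "x \<in> U" for x
      using weight_GDERIV[of R x x0 m] dball[OF UR[OF that]]
      unfolding d_def[symmetric] by (simp add: \<zeta>_def[abs_def] lv_def)
    have f_der: "GDERIV f x :> \<zeta> x *\<^sub>R (2 *\<^sub>R B x (\<xi> x) + z x *\<^sub>R lv x)" if "x \<in> U" for x
      using GDERIV_mult[OF \<zeta>_der[OF that] z_der[OF that]]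
      by (simp add: f_def[abs_def] scaleR_add_right mult.commute)
    have \<Psi>_der: "GDERIV \<Psi> x :> d\<Psi> x" if "x \<in> U" for x
      using GDERIV_DERIV_compose[OF GDERIV_diff[OF f_der[OF that] GDERIV_const, of M] DERIV_pos_part_square]
      by (simp add: \<Psi>_def[abs_def] d\<Psi>_def \<Psi>1_def)
    have zp_der: "GDERIV (\<lambda>x. z x powr a) x :> (a * z x powr (a - 1)) *\<^sub>R (2 *\<^sub>R B x (\<xi> x))" if "x \<in> U" for x a
      using GDERIV_DERIV_compose[OF z_der[OF that] has_real_derivative_powr[OF U0(2)[OF that], of a]] .
    have \<phi>_der: "GDERIV \<phi> x :> d\<phi> x" if "x \<in> U" for x
      using GDERIV_mult[OF zp_der[OF that, of "k - p / 2"] \<Psi>_der[OF that]]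
      by (simp add: \<phi>_def[abs_def] d\<phi>_def add.commute mult_ac)
    have cz: "continuous_on T z" for T unfolding z_def by (intro continuous_intros c\<xi>)
    have czp: "continuous_on U (\<lambda>x. z x powr a)" for a
      using U0(2) by (intro continuous_intros cz) (metis less_irrefl)
    have UcR: "U \<subseteq> cball x0 R" using URc by blast
    have clU: "continuous_on U lv" using continuous_on_subset[OF clv] UR by blast
    have cDlU: "continuous_on U (\<lambda>x. Dl x b)" for b using continuous_on_subset[OF cDl] UR by blast
    have c\<zeta>U: "continuous_on U \<zeta>" using continuous_on_subset[OF c\<zeta> UcR] .
    have cf: "continuous_on U f" unfolding f_def by (intro continuous_intros c\<zeta>U cz)
    have c\<Psi>: "continuous_on U \<Psi>" unfolding \<Psi>_def by (intro continuous_intros cf)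
    have cd\<Psi>: "continuous_on U d\<Psi>"
      unfolding d\<Psi>_def \<Psi>1_def by (intro continuous_intros cf c\<zeta>U cB\<xi> cz clU)
    have cd\<phi>: "continuous_on U d\<phi>"
      unfolding d\<phi>_def by (intro continuous_on_add continuous_on_scaleR continuous_on_mult continuous_on_const czp c\<Psi> cB\<xi> cd\<Psi>)
    have \<Psi>0: "\<Psi> x = 0" if "x \<in> U - K" for x
    proof -
      have x: "x \<in> cball x0 R" using that URc by blast
      \<comment> \<open>Off \<open>K\<close> the mollification adds at most M / 4 to a value below M
        / 2, so f stays below M.\<close>
      then have "w x < M / 2" using that by (simp add: K_def)
      moreover have "Zm * (\<tau> * (2 * G + 1)) \<le> M / 4"
        using mult_left_mono[OF \<tau>(3), of Zm] Zm by (simp add: lo_def)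
      ultimately have "f x < M" using fw[OF x] M by linarith
      then show ?thesis by (simp add: \<Psi>_def)
    qed
    \<comment> \<open>The three integrands with integral zero; the first two are tested with \<phi>,
      the third with \<Psi>.\<close>
    define i1 where "i1 x = \<phi> x * (\<Sum>b\<in>Basis. B x b \<bullet> L x b) + L x (\<xi> x) \<bullet> d\<phi> x - tr (L x) * (\<phi> x * tr (B x) + \<xi> x \<bullet> d\<phi> x)" for x
    define i2 where "i2 x = norm (\<xi> x) powr q * (\<phi> x * tr (B x) + \<xi> x \<bullet> d\<phi> x) + \<phi> x * (q * norm (\<xi> x) powr (q - 2) * (B x (\<xi> x) \<bullet> \<xi> x))" for x
    define i3 where "i3 x = J x \<bullet> d\<Psi> x + \<Psi> x * divJ p k (\<xi> x) (B x) (lv x) (Dl x)" for x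
    have i1: "set_integrable lborel K i1" "(LINT x:K|lborel. i1 x) = 0"
      using bochner_identity[OF e(1) U K KU Ucb \<phi>_der cd\<phi>] \<Psi>0
      unfolding i1_def[abs_def] \<xi>_def B_def L_def by (simp_all add: \<phi>_def)
    have i2: "set_integrable lborel K i2" "(LINT x:K|lborel. i2 x) = 0"
      using hamiltonian_divergence[OF U K KU \<xi>_der U0(1) cB \<phi>_der cd\<phi>, of q] \<Psi>0
      unfolding i2_def[abs_def] by (simp_all add: \<phi>_def)
    have i3: "set_integrable lborel K i3" "(LINT x:K|lborel. i3 x) = 0"
      using J_divergence[OF U K KU \<xi>_der U0(1) cB symB lv_der[OF UR] cDlU \<Psi>_der cd\<Psi> \<Psi>0, of k p]
      unfolding i3_def[abs_def] J_def z_def by simp_all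
    have pw: "\<kappa> * \<Psi> x \<le> i1 x + i2 x + (1 / 2) * i3 x + con * \<tau> * (S x)\<^sup>2" if x: "x \<in> K" for x
    proof -
      have xU: "x \<in> U" and xR: "x \<in> ball x0 R" and xc: "x \<in> cball x0 R" using x KU KR Kc by auto
      have zb: "lo \<le> z x" "z x \<le> Zb" using zlo[OF x] zZ[OF xc] by auto
      have zp: "z x powr a \<le> za a" "min (lo powr a) (Zb powr a) \<le> z x powr a" for a
        using powr_between[OF lo zb, of a] by (auto simp: za_def)
      have \<Psi>p: "0 \<le> \<Psi> x" "\<Psi> x \<le> P0\<^sup>2" and \<Psi>1p: "0 \<le> \<Psi>1 x" "\<Psi>1 x \<le> 2 * P0"
        using fP[OF xc] f0[of x] M P0 by (auto simp: \<Psi>_def \<Psi>1_def max_def intro!: power_mono)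
      define mm where "mm = 6 * m * (R\<^sup>2 / (d x)\<^sup>2)"
      have ll: "C * (lv x \<bullet> lv x + mm) \<le> K1 * (R\<^sup>2 / (d x)\<^sup>2)"
      proof -
        have "C * (lv x \<bullet> lv x + mm) \<le> C * (4 * m\<^sup>2 * (R\<^sup>2 / (d x)\<^sup>2) + mm)"
          using lvb[OF xR] C by (intro mult_left_mono) auto
        also have "\<dots> = K1 * (R\<^sup>2 / (d x)\<^sup>2)" by (simp add: K1_def mm_def algebra_simps)
        finally show ?thesis .
      qed
      define err where "err = \<bar>\<phi> x * (\<Sum>b\<in>Basis. B x b \<bullet> (L x b - dflux p (\<xi> x) (B x b))) + (L x (\<xi> x) - dflux p (\<xi> x) (B x (\<xi> x))) \<bullet> d\<phi> x
          + (norm (\<xi> x) powr q - tr (L x)) * (\<phi> x * tr (B x) + \<xi> x \<bullet> d\<phi> x)\<bar>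
        + (C * (\<Psi> x * z x powr (k + 1 - p))) * (tr (\<lambda>h. dflux p (\<xi> x) (B x h)) - norm (\<xi> x) powr q)\<^sup>2"
      have main: "\<Psi> x * z x powr k * (c * z x powr (q + 1 - p) - C * (lv x \<bullet> lv x + mm)) \<le> i1 x + i2 x + (1 / 2) * i3 x + err"
      proof -
        have "\<Psi> x * z x powr k * (c * z x powr (q + 1 - p) - C * (lv x \<bullet> lv x + mm)) \<le>
            i1 x + i2 x + (1 / 2) * i3 x
            + \<bar>\<phi> x * (\<Sum>b\<in>Basis. B x b \<bullet> (L x b - dflux p (\<xi> x) (B x b))) + (L x (\<xi> x) - dflux p (\<xi> x) (B x (\<xi> x))) \<bullet> d\<phi> x
              + (norm (\<xi> x) powr q - tr (L x)) * (\<phi> x * tr (B x) + \<xi> x \<bullet> d\<phi> x)\<bar>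
            + C * (\<Psi> x * z x powr (k + 1 - p)) * (tr (\<lambda>h. dflux p (\<xi> x) (B x h)) - norm (\<xi> x) powr q)\<^sup>2"
          unfolding i1_def i2_def i3_def z_def
        proof (rule P[where \<zeta> = "\<zeta> x" and ?\<Psi>1.0 = "\<Psi>1 x"])
          show "\<xi> x \<noteq> 0" by (rule U0(1)[OF xU])
          show "linear (B x)" "linear (L x)" by (rule linB linL)+
          show "B x h \<bullet> y = h \<bullet> B x y" for h y by (rule symB[OF xU])
          show "linear (Dl x)" using lv_der[OF xR] has_derivative_linear by blast
          show "norm (Dl x h) \<le> mm * norm h" for h unfolding mm_def by (rule Dlb[OF xR])
          show "0 \<le> \<Psi> x" "0 \<le> \<Psi>1 x" "0 \<le> \<zeta> x" by (rule \<Psi>p \<Psi>1p \<zeta>0)+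
        qed (simp_all add: \<phi>_def d\<phi>_def d\<Psi>_def J_def z_def)
        then show ?thesis unfolding err_def by (simp add: add.assoc)
      qed
      have errb: "err \<le> con * \<tau> * (S x)\<^sup>2"
        unfolding err_def con_def N_def
      proof (rule error_bound[OF linB linL linear_dflux])
        show "0 \<le> \<tau>" "\<tau> \<le> 1" using \<tau> by auto
        show Sx: "1 \<le> S x" by (rule SK(1)[OF x])
        show Bb: "norm (B x b) \<le> S x" if "b \<in> Basis" for b unfolding B_def by (rule SK(2)[OF x that])
        show "norm (L x b - dflux p (\<xi> x) (B x b)) \<le> \<tau> * S x" if "b \<in> Basis" for b
          unfolding L_def B_def \<xi>_def by (rule SK(3)[OF x that])
        show "\<bar>norm (\<xi> x) powr q - tr (L x)\<bar> \<le> \<tau>" unfolding L_def \<xi>_def by (rule SK(4)[OF x])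
        have "z x powr (k - p / 2) * \<Psi> x \<le> za (k - p / 2) * P0\<^sup>2" using zp \<Psi>p za0 by (intro mult_mono) auto
        then show "\<bar>\<phi> x\<bar> \<le> A" using A(1) \<Psi>p by (simp add: \<phi>_def abs_mult)
        show "norm (\<xi> x) \<le> A" using \<xi>G[OF xc] A(2) by linarith
        show "0 \<le> C * (\<Psi> x * z x powr (k + 1 - p))" using C \<Psi>p by simp
        have "C * (\<Psi> x * z x powr (k + 1 - p)) \<le> C * (P0\<^sup>2 * za (k + 1 - p))"
          using zp \<Psi>p C by (intro mult_left_mono mult_mono) auto
        then show "C * (\<Psi> x * z x powr (k + 1 - p)) \<le> A" using A(4) by linarith
        have B\<xi>: "norm (B x (\<xi> x)) \<le> N * (G + 1) * S x"
        proof -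
          have "B x (\<xi> x) = (\<Sum>b\<in>Basis. (\<xi> x \<bullet> b) *\<^sub>R B x b)"
            by (rule linear_eq_sum_Basis[OF linB])
          then have "norm (B x (\<xi> x)) \<le> (\<Sum>b\<in>(Basis::(real^'n) set). norm ((\<xi> x \<bullet> b) *\<^sub>R B x b))"
            using norm_sum[of "\<lambda>b. (\<xi> x \<bullet> b) *\<^sub>R B x b" Basis] by simp
          also have "\<dots> \<le> (\<Sum>b\<in>(Basis::(real^'n) set). (G + 1) * S x)"
          proof (rule sum_mono)
            fix b :: "real ^ 'n" assume b: "b \<in> Basis"
            have "\<bar>\<xi> x \<bullet> b\<bar> \<le> G + 1" using Basis_le_norm[OF b, of "\<xi> x"] \<xi>G[OF xc] by linarith
            then show "norm ((\<xi> x \<bullet> b) *\<^sub>R B x b) \<le> (G + 1) * S x"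
              unfolding norm_scaleR using Bb[OF b] G(1) by (intro mult_mono) auto
          qed
          finally show ?thesis by (simp add: N_def)
        qed
        define T where "T = 2 * (N * (G + 1)) * S x"
        have T: "norm (2 *\<^sub>R B x (\<xi> x)) \<le> T" using B\<xi> by (simp add: T_def)
        have d\<Psi>b: "norm (d\<Psi> x) \<le> 2 * P0 * Zm * ((2 * (N * (G + 1)) + Zb * \<Lambda>) * S x)"
        proof -
          have "norm (z x *\<^sub>R lv x) \<le> Zb * \<Lambda>"
            unfolding norm_scaleR using zb lo \<Lambda>(2)[OF x] \<Lambda>(1) Zb by (intro mult_mono) auto
          also have "\<dots> \<le> Zb * \<Lambda> * S x" using mult_left_mono[OF Sx, of "Zb * \<Lambda>"] Zb \<Lambda>(1) by simp
          finally have "norm (2 *\<^sub>R B x (\<xi> x) + z x *\<^sub>R lv x) \<le> (2 * (N * (G + 1)) + Zb * \<Lambda>) * S x"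
            using T norm_triangle_ineq[of "2 *\<^sub>R B x (\<xi> x)" "z x *\<^sub>R lv x"] unfolding T_def distrib_right by linarith
          moreover have "\<bar>\<Psi>1 x * \<zeta> x\<bar> \<le> 2 * P0 * Zm"
            unfolding abs_mult using \<Psi>1p \<zeta>0[of x] \<zeta>Z[OF xc] P0 by (intro mult_mono) auto
          ultimately show ?thesis unfolding d\<Psi>_def norm_scaleR using P0 Zm by (intro mult_mono) auto
        qed
        have "norm (d\<phi> x) \<le> norm (((k - p / 2) * z x powr (k - p / 2 - 1) * \<Psi> x) *\<^sub>R (2 *\<^sub>R B x (\<xi> x)))
            + norm (z x powr (k - p / 2) *\<^sub>R d\<Psi> x)"
          unfolding d\<phi>_def by (rule norm_triangle_ineq)
        also have "norm (((k - p / 2) * z x powr (k - p / 2 - 1) * \<Psi> x) *\<^sub>R (2 *\<^sub>R B x (\<xi> x)))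
            \<le> (\<bar>k - p / 2\<bar> * za (k - p / 2 - 1) * P0\<^sup>2) * T"
        proof -
          have "\<bar>(k - p / 2) * z x powr (k - p / 2 - 1) * \<Psi> x\<bar> \<le> \<bar>k - p / 2\<bar> * za (k - p / 2 - 1) * P0\<^sup>2"
            unfolding abs_mult using zp[of "k - p / 2 - 1"] \<Psi>p za0 by (intro mult_mono mult_nonneg_nonneg) auto
          then show ?thesis unfolding norm_scaleR[of "(k - p / 2) * z x powr (k - p / 2 - 1) * \<Psi> x"]
            using T za0 by (intro mult_mono mult_nonneg_nonneg) auto
        qed
        also have "norm (z x powr (k - p / 2) *\<^sub>R d\<Psi> x)
            \<le> za (k - p / 2) * (2 * P0 * Zm * ((2 * (N * (G + 1)) + Zb * \<Lambda>) * S x))"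
          unfolding norm_scaleR using zp[of "k - p / 2"] d\<Psi>b za0 by (intro mult_mono) auto
        finally have "norm (d\<phi> x) \<le> A1 * S x" by (simp add: A1_def T_def algebra_simps)
        also have "\<dots> \<le> A * S x" using A(3) Sx by (intro mult_right_mono) auto
        finally show "norm (d\<phi> x) \<le> A * S x" by simp
      qed
      \<comment> \<open>Both sides vanish unless f > M. There half of the absorption term pays for
        the derivatives of the weight, and the other half is at least K1 / R^2.\<close>
      have lower: "\<kappa> * \<Psi> x \<le> \<Psi> x * z x powr k * (c * z x powr (q + 1 - p) - C * (lv x \<bullet> lv x + mm))"
      proof (cases "f x > M")
        case False
        then have "\<Psi> x = 0" by (simp add: \<Psi>_def)
        then show ?thesis by simp
      next
        case True
        have dx: "d x > 0" "d x \<le> R\<^sup>2" using dball[OF xR] dcball(2)[OF xc] by auto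
        have "M / \<zeta> x < z x" using True dx by (simp add: f_def \<zeta>_def field_simps)
        then have "(M / \<zeta> x) powr s \<le> z x powr s" using M s \<zeta>0[of x] by (intro powr_mono2) auto
        \<comment> \<open>Here m = 2 / s is decisive: it makes \<zeta>^s equal to d^2, the
          denominator in the bounds for \<open>lv\<close> and its derivative.\<close>
        moreover have "(M / \<zeta> x) powr s = 2 * K1 / c * (R\<^sup>2 / (d x)\<^sup>2)"
        proof -
          have "\<zeta> x powr s = (d x)\<^sup>2" using dx s by (simp add: \<zeta>_def powr_powr m_def)
          then show ?thesis using M \<zeta>0[of x] by (simp add: powr_divide Ms)
        qed
        ultimately have "c * (2 * K1 / c * (R\<^sup>2 / (d x)\<^sup>2)) \<le> c * z x powr s" using c by (intro mult_left_mono) auto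
        then have "2 * (K1 * (R\<^sup>2 / (d x)\<^sup>2)) \<le> c * z x powr s" using c by simp
        then have 1: "K1 * (R\<^sup>2 / (d x)\<^sup>2) \<le> c * z x powr (q + 1 - p) - C * (lv x \<bullet> lv x + mm)"
          using ll by (simp add: s_def)
        have "(d x)\<^sup>2 \<le> (R\<^sup>2)\<^sup>2" using dx by (intro power_mono) auto
        then have "1 / R\<^sup>2 \<le> R\<^sup>2 / (d x)\<^sup>2" using dx R0 by (simp add: field_simps power2_eq_square)
        then have "K1 / R\<^sup>2 \<le> K1 * (R\<^sup>2 / (d x)\<^sup>2)" using mult_left_mono[of "1 / R\<^sup>2" "R\<^sup>2 / (d x)\<^sup>2" K1] K1 by simp
        then have 2: "K1 / R\<^sup>2 \<le> c * z x powr (q + 1 - p) - C * (lv x \<bullet> lv x + mm)" using 1 by linarith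
        have "\<kappa> \<le> z x powr k * (c * z x powr (q + 1 - p) - C * (lv x \<bullet> lv x + mm))"
          unfolding \<kappa>_def using 2 zp(2)[of k] K1 by (intro mult_mono) auto
        from mult_left_mono[OF this \<Psi>p(1)] show ?thesis by (simp add: mult_ac)
      qed
      show ?thesis using lower main errb by linarith
    qed
    have ij: "set_integrable lborel K (\<lambda>x. (1 / 2) * i3 x)" "set_integrable lborel K (\<lambda>x. con * \<tau> * (S x)\<^sup>2)"
      by (intro set_integrable_mult_right i3(1) S(1))+
    have "\<kappa> * (LINT x:K|lborel. \<Psi> x) = (LINT x:K|lborel. \<kappa> * \<Psi> x)" by (rule set_integral_mult_right[symmetric])
    also have "\<dots> \<le> (LINT x:K|lborel. i1 x + i2 x + (1 / 2) * i3 x + con * \<tau> * (S x)\<^sup>2)"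
    proof (rule set_integral_mono)
      show "set_integrable lborel K (\<lambda>x. \<kappa> * \<Psi> x)"
        by (intro set_integrable_mult_right set_integrable_continuous K continuous_on_subset[OF c\<Psi> KU])
      show "set_integrable lborel K (\<lambda>x. i1 x + i2 x + (1 / 2) * i3 x + con * \<tau> * (S x)\<^sup>2)"
        by (intro set_integral_add(1) i1(1) i2(1) ij)
    qed (rule pw)
    also have "\<dots> = con * \<tau> * (LINT x:K|lborel. (S x)\<^sup>2)"
    proof -
      have "(LINT x:K|lborel. i1 x + i2 x + (1 / 2) * i3 x + con * \<tau> * (S x)\<^sup>2)
          = (LINT x:K|lborel. i1 x) + (LINT x:K|lborel. i2 x) + (LINT x:K|lborel. (1 / 2) * i3 x)
            + (LINT x:K|lborel. con * \<tau> * (S x)\<^sup>2)"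
        by (subst set_integral_add(2), (intro set_integral_add(1) i1(1) i2(1) ij)+)+ (rule refl)
      also have "(LINT x:K|lborel. (1 / 2) * i3 x) = 0"
        unfolding set_integral_mult_right i3(2) by simp
      also have "(LINT x:K|lborel. con * \<tau> * (S x)\<^sup>2) = con * \<tau> * (LINT x:K|lborel. (S x)\<^sup>2)"
        by (rule set_integral_mult_right)
      finally show ?thesis by (simp add: i1(2) i2(2))
    qed
    also have "\<dots> \<le> con * \<tau> * I" using S(2) con \<tau>(1) by (intro mult_left_mono) auto
    finally have up: "\<kappa> * (LINT x:K|lborel. \<Psi> x) \<le> con * \<tau> * I" .
    have "v0 \<le> (LINT x:K|lborel. \<Psi> x)"
      unfolding v0_def
    proof (rule set_LINT_ge_cball[OF K continuous_on_subset[OF c\<Psi> KU] _ \<rho>K])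
      show "0 \<le> \<Psi> x" for x by (simp add: \<Psi>_def)
      fix x assume x: "x \<in> cball x0 \<rho>"
      have "Zm * (\<tau> * (2 * G + 1)) \<le> M0 / 4"
        using mult_left_mono[OF \<tau>(4), of Zm] Zm by simp
      then have "M0 / 4 \<le> f x - M" using fw[of x] \<rho>(3)[OF x] x \<rho>(2) by fastforce
      then have "(M0 / 4)\<^sup>2 \<le> (max 0 (f x - M))\<^sup>2" using M0 by (intro power_mono) auto
      then show "(M0 / 4)\<^sup>2 \<le> \<Psi> x" by (simp add: \<Psi>_def)
    qed
    from mult_left_mono[OF this, of \<kappa>] show ?thesis using up \<kappa> by linarith
  qed

  \<comment> \<open>Choice of \<tau> and contradiction\<close>
  define \<tau>0 where "\<tau>0 = min 1 (min (lo / (2 * G + 1)) (M0 / (4 * Zm) / (2 * G + 1)))"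
  have G1: "2 * G + 1 > 0" using G(1) by simp
  have \<tau>0: "\<tau>0 > 0" using lo M0 Zm G1 by (simp add: \<tau>0_def)
  \<comment> \<open>The second bound makes the right-hand side of \<open>claim\<close> at most half
    of the left-hand side; the absolute value and the summand 1 keep the divisor positive.\<close>
  define \<tau> where "\<tau> = min \<tau>0 (\<kappa> * v0 / (2 * (con * \<bar>I\<bar> + 1)))"
  have cI: "con * \<bar>I\<bar> + 1 > 0" using con by (simp add: add_nonneg_pos)
  have \<tau>: "\<tau> > 0" using \<tau>0 \<kappa> v0 cI by (simp add: \<tau>_def)
  have \<tau>1: "\<tau> \<le> 1" "\<tau> \<le> lo / (2 * G + 1)" "\<tau> \<le> M0 / (4 * Zm) / (2 * G + 1)"
    by (auto simp: \<tau>_def \<tau>0_def)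
  have "\<kappa> * v0 \<le> con * \<tau> * I"
    using \<tau>1 unfolding pos_le_divide_eq[OF G1] by (intro claim \<tau>)
  also have "\<dots> \<le> \<tau> * (con * \<bar>I\<bar> + 1)"
  proof -
    have "con * \<tau> * I \<le> con * \<tau> * \<bar>I\<bar>" using con \<tau> by (intro mult_left_mono) auto
    moreover have "\<tau> * (con * \<bar>I\<bar> + 1) = con * \<tau> * \<bar>I\<bar> + \<tau>" by (simp add: algebra_simps)
    ultimately show ?thesis using \<tau> by linarith
  qed
  also have "\<dots> \<le> \<kappa> * v0 / (2 * (con * \<bar>I\<bar> + 1)) * (con * \<bar>I\<bar> + 1)"
    using cI by (intro mult_right_mono) (auto simp: \<tau>_def)
  also have "\<dots> = \<kappa> * v0 / 2" using cI by (simp add: field_simps)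
  finally show False using mult_pos_pos[OF \<kappa> v0] by linarith
qed

end

text \<open>The nearest-point projection onto the closed ball yields the continuous extension of the
  gradient required by the locale. For test functions supported in the ball, the integrals over
  \<open>S\<close> and over the support agree because \<phi> and its gradient vanish
  elsewhere.\<close>

lemma weak_solution_hamilton_jacobi:
  fixes u :: "real ^ 'n \<Rightarrow> real"
  assumes p: "1 < p" "q > p - 1" and S: "open S" "cball x0 R \<subseteq> S" "R > 0" and u: "C1_weak_solution p q S u"
  shows "hamilton_jacobi p q u (\<lambda>x. grad u (closest_point (cball x0 R) x)) x0 R"
proof
  let ?g = "\<lambda>x. grad u (closest_point (cball x0 R) x)"
  have diff: "\<And>x. x \<in> S \<Longrightarrow> u differentiable (at x)" and cont: "continuous_on S (grad u)"
    using u unfolding C1_weak_solution_def C1_on_def by auto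
  have ne: "cball x0 R \<noteq> {}" using S(3) by simp
  have g: "?g x = grad u x" if "x \<in> cball x0 R" for x using closest_point_self[OF that] by simp
  show "1 < p" "p - 1 < q" "0 < R" using p S by auto
  show "continuous_on UNIV ?g"
  proof (rule continuous_on_compose2[OF cont])
    show "continuous_on UNIV (closest_point (cball x0 R))"
      by (rule continuous_on_closest_point[OF convex_cball closed_cball ne])
    show "closest_point (cball x0 R) ` UNIV \<subseteq> S"
      using closest_point_in_set[OF closed_cball ne] S(2) by blast
  qed
  show "GDERIV u x :> ?g x" if "x \<in> ball x0 R" for x
  proof -
    have x: "x \<in> cball x0 R" using that by simp
    show ?thesis unfolding g[OF x] by (rule GDERIV_grad) (use diff S(2) x in blast)
  qed
  fix \<phi> :: "real ^ 'n \<Rightarrow> real" and T :: "(real ^ 'n) set"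
  assume \<phi>: "smooth \<phi>" "compact T" "T \<subseteq> ball x0 R" "\<And>x. x \<notin> T \<Longrightarrow> \<phi> x = 0"
  have TS: "T \<subseteq> S" using \<phi>(3) S(2) ball_subset_cball by blast
  have "closure {x. \<phi> x \<noteq> 0} \<subseteq> T"
    by (rule closure_minimal) (use \<phi>(2,4) compact_imp_closed in auto)
  moreover from this have "compact (closure {x. \<phi> x \<noteq> 0})"
    using \<phi>(2) bounded_subset compact_imp_bounded compact_eq_bounded_closed closed_closure by metis
  ultimately have "test_function S \<phi>"
    unfolding test_function_def using \<phi>(1) TS by (auto simp: smooth_def)
  then have weak: "(LINT x:S|lborel. ((norm (grad u x) powr (p - 2)) *\<^sub>R grad u x) \<bullet> grad \<phi> x) +
      (LINT x:S|lborel. (norm (grad u x) powr q) * \<phi> x) = 0"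
    using u unfolding C1_weak_solution_def by blast
  have gz: "grad \<phi> x = 0" if "x \<notin> T" for x
    by (rule grad_zero_off_closed[OF compact_imp_closed[OF \<phi>(2)] \<phi>(4) that])
  have gT: "?g x = grad u x" if "x \<in> T" for x using \<phi>(3) that by (intro g) auto
  have "(LINT x:T|lborel. flux p (?g x) \<bullet> grad \<phi> x) = (LINT x:S|lborel. ((norm (grad u x) powr (p - 2)) *\<^sub>R grad u x) \<bullet> grad \<phi> x)"
    unfolding set_lebesgue_integral_def
    by (rule Bochner_Integration.integral_cong) (use gz gT TS in \<open>auto simp: indicator_def flux_def\<close>)
  moreover have "(LINT x:T|lborel. norm (?g x) powr q * \<phi> x) = (LINT x:S|lborel. (norm (grad u x) powr q) * \<phi> x)"
    unfolding set_lebesgue_integral_def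
    by (rule Bochner_Integration.integral_cong) (use \<phi>(4) gT TS in \<open>auto simp: indicator_def\<close>)
  ultimately show "(LINT x:T|lborel. flux p (?g x) \<bullet> grad \<phi> x) + (LINT x:T|lborel. norm (?g x) powr q * \<phi> x) = 0"
    using weak by simp
qed

text \<open>\<open>K\<close> is obtained before the solution, the open set, the centre and the
  radius, so it depends on p, q and the dimension only.\<close>

lemma ball_gradient_estimate:
  fixes p q :: real
  assumes "1 < p" "q > p - 1"
  obtains K where "K > 0" "\<And>(u :: real ^ 'n \<Rightarrow> real) S x R. open S \<Longrightarrow> C1_weak_solution p q S u \<Longrightarrow> R > 0 \<Longrightarrow> cball x R \<subseteq> S \<Longrightarrow>
    norm (grad u x) \<le> K * R powr (- (1 / (q + 1 - p)))"
proof -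
  define s m where "s = q + 1 - p" and "m = 2 / s"
  have s: "s > 0" and m: "m > 0" using assms by (auto simp: s_def m_def)
  obtain k c C where bc: "bernstein_const TYPE(real ^ 'n) p q k c C"
    using bernstein_pointwise[OF assms] by blast
  then have cC: "c > 0" "C > 0" unfolding bernstein_const_def by blast+
  define K where "K = (2 * (C * (4 * m\<^sup>2 + 6 * m)) / c) powr (1 / (2 * s))"
  have "C * (4 * m\<^sup>2 + 6 * m) > 0" using cC m by (simp add: add_pos_pos)
  then have "2 * (C * (4 * m\<^sup>2 + 6 * m)) / c > 0" using cC(1) by simp
  then have "K > 0" unfolding K_def powr_gt_zero by linarith
  then show ?thesis
  proof (rule that)
    fix u :: "real ^ 'n \<Rightarrow> real" and S x R
    assume S: "open S" "C1_weak_solution p q S u" "R > 0" "cball x R \<subseteq> S"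
    interpret hamilton_jacobi p q u "\<lambda>y. grad u (closest_point (cball x R) y)" x R
      by (rule weak_solution_hamilton_jacobi[OF assms S(1,4,3,2)])
    have "closest_point (cball x R) x = x" using S(3) by (intro closest_point_self) simp
    then show "norm (grad u x) \<le> K * R powr (- (1 / (q + 1 - p)))"
      using gradient_estimate[OF bc] by (simp only: K_def m_def s_def)
  qed
qed

theorem theoremA:
  fixes p q :: real
  assumes "CARD('n::finite) \<ge> 2"
    and "1 < p" and "p \<le> real CARD('n)"
    and "q > p - 1"
  shows "(\<exists>c>0. \<forall>(\<Omega> :: (real ^ 'n) set) u.
            open \<Omega> \<and> connected \<Omega> \<and> \<Omega> \<noteq> {} \<and> \<Omega> \<noteq> UNIV \<and> C1_weak_solution p q \<Omega> u \<longrightarrow>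
            (\<forall>x\<in>\<Omega>. norm (grad u x) \<le> c * infdist x (frontier \<Omega>) powr (- (1 / (q + 1 - p)))))
       \<and> (\<forall>u :: real ^ 'n \<Rightarrow> real. C1_weak_solution p q UNIV u \<longrightarrow> u constant_on UNIV)"
proof -
  define s where "s = q + 1 - p"
  have s: "s > 0" using assms by (simp add: s_def)
  obtain K where K: "K > 0" "\<And>(u :: real ^ 'n \<Rightarrow> real) S x R. open S \<Longrightarrow> C1_weak_solution p q S u \<Longrightarrow> R > 0 \<Longrightarrow> cball x R \<subseteq> S \<Longrightarrow>
    norm (grad u x) \<le> K * R powr (- (1 / (q + 1 - p)))"
    by (rule ball_gradient_estimate[OF assms(2,4)], rule that)
  note K = K[folded s_def]
  show ?thesis
    unfolding s_def[symmetric]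
  proof (intro conjI exI[of _ "K * 2 powr (1 / s)"] allI impI ballI)
    show "K * 2 powr (1 / s) > 0" using K(1) by simp
    fix \<Omega> :: "(real ^ 'n) set" and u x
    assume \<Omega>: "open \<Omega> \<and> connected \<Omega> \<and> \<Omega> \<noteq> {} \<and> \<Omega> \<noteq> UNIV \<and> C1_weak_solution p q \<Omega> u" and x: "x \<in> \<Omega>"
    define d where "d = infdist x (frontier \<Omega>)"
    have fr: "frontier \<Omega> \<noteq> {}" using \<Omega> frontier_eq_empty by blast
    have "x \<notin> frontier \<Omega>" using \<Omega> x by (simp add: frontier_def interior_open)
    then have d: "d > 0" unfolding d_def using fr by (intro infdist_pos_not_in_closed frontier_closed)
    \<comment> \<open>Half the distance keeps the closed ball inside \<Omega>, at the price of the
      factor \<open>2 powr (1 / s)\<close>. A ball is connected, so leaving \<Omega> would force it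
      to meet the frontier, which is too far away.\<close>
    have "cball x (d / 2) \<subseteq> \<Omega>"
    proof (rule ccontr)
      assume "\<not> cball x (d / 2) \<subseteq> \<Omega>"
      then have "cball x (d / 2) \<inter> frontier \<Omega> \<noteq> {}"
      proof (intro connected_Int_frontier convex_connected convex_cball)
        have "x \<in> cball x (d / 2) \<inter> \<Omega>" using d x by simp
        then show "cball x (d / 2) \<inter> \<Omega> \<noteq> {}" by blast
      qed blast
      then obtain y where "y \<in> frontier \<Omega>" "dist x y \<le> d / 2" by auto
      then show False using infdist_le[of y "frontier \<Omega>" x] d by (simp add: d_def[symmetric])
    qed
    then have "norm (grad u x) \<le> K * (d / 2) powr (- (1 / s))"
      using \<Omega> d by (intro K(2)[of \<Omega>]) auto
    also have "(d / 2) powr (- (1 / s)) = 2 powr (1 / s) * d powr (- (1 / s))"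
      using d by (simp add: powr_divide powr_minus field_simps)
    finally show "norm (grad u x) \<le> K * 2 powr (1 / s) * infdist x (frontier \<Omega>) powr (- (1 / s))"
      by (simp add: d_def)
  next
    fix u :: "real ^ 'n \<Rightarrow> real" assume u: "C1_weak_solution p q UNIV u"
    have g0: "grad u x = 0" for x
    proof (rule ccontr)
      assume "grad u x \<noteq> 0"
      define a where "a = norm (grad u x)"
      have a: "a > 0" using \<open>grad u x \<noteq> 0\<close> by (simp add: a_def)
      \<comment> \<open>With this radius the ball estimate reads a \<le> a / 2.\<close>
      define R where "R = (2 * K / a) powr s"
      have R: "R > 0" using K(1) a by (simp add: R_def)
      have "R powr (- (1 / s)) = a / (2 * K)"
        using s K(1) a by (simp add: R_def powr_powr powr_minus)
      moreover have "a \<le> K * R powr (- (1 / s))"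
        unfolding a_def by (rule K(2)[OF open_UNIV u R]) simp
      ultimately show False using a K(1) by simp
    qed
    have gd: "GDERIV u x :> grad u x" for x
      using u unfolding C1_weak_solution_def C1_on_def by (intro GDERIV_grad) simp
    have "(u has_derivative (\<lambda>h. 0)) (at x)" for x
      using gd[of x] unfolding gderiv_def g0 by simp
    then have "\<exists>c. \<forall>x\<in>UNIV. u x = c"
      by (intro has_derivative_zero_constant convex_UNIV) (simp add: has_derivative_at_withinI)
    then show "u constant_on UNIV" by (simp add: constant_on_def)
  qed
qed

end
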